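(* The sequence of functionals $\{F_n\}_{n\in\mathbb N}$ $\Gamma$-converges, with respect to the weak-$*$ convergence in $L^\infty(0,1)$, as $n\to+\infty$, to the functional $F\colon L^\infty(0,1)\to[0,+\infty]$ given by $$F(u)=\begin{cases} 2\,\mathcal H^1(\{x\in(0,1): 0<u(x)<1\})+|Du|(0,1) & \text{if } u\in BV(0,1),\ 0\le u\le 1,\\ +\infty & \text{otherwise.}\end{cases}$$
   Context: For each $n\in\mathbb N=\{1,2,\dots\}$ let $$\mathcal E_n=\big\{\{i,j\}:\ i,j\in\mathbb N\cap(0,n^2]\ \text{and}\ |i-j|=1\ \text{or}\ |i-j|=n\big\}$$ (a set of unordered pairs). Let $\mathcal A_n$ be the set of functions $u\colon(0,1]\to\{0,1\}$ that are constant on each interval $(\frac{i-1}{n^2},\frac{i}{n^2}]$, $i=1,\dots,n^2$; write $u_i=u(\frac{i}{n^2})$. For $u\in\mathcal A_n$ define $$F_n(u)=\frac1n\sum_{\{i,j\}\in\mathcal E_n}(u_i-u_j)^2,$$ and set $F_n(u)=+\infty$ for $u\in L^\infty(0,1)$ not (a.e. equal to an element) in $\mathcal A_n$. $\mathcal H^1$ is the one-dimensional Hausdorff (here Lebesgue) measure, $BV(0,1)$ is the space of functions of bounded variation on $(0,1)$, and $|Du|$ is the total variation measure of the distributional derivative $Du$. $\Gamma$-convergence of $F_n$ to $F$ with respect to the weak-$*$ convergence in $L^\infty(0,1)$ means: (i) for every $u\in L^\infty(0,1)$ and every sequence $u_n$ converging weakly-$*$ to $u$ in $L^\infty(0,1)$,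 $F(u)\le\liminf_{n\to+\infty}F_n(u_n)$; (ii) for every $u\in L^\infty(0,1)$ there is a sequence $u_n$ converging weakly-$*$ to $u$ in $L^\infty(0,1)$ with $\limsup_{n\to+\infty}F_n(u_n)\le F(u)$. *)

theory Defs
  imports "HOL-Analysis.Analysis"
begin

abbreviation unit_interval :: "real set" where
  "unit_interval \<equiv> {0<..<1}"

(* Elements of L^1 and L^infinity are represented by functions on the reals, of which only the
   values on (0,1) matter and only up to null sets; all notions below respect equality a.e. *)
definition Linfty :: "(real \<Rightarrow> real) set" where
  "Linfty = {u \<in> borel_measurable (lebesgue_on unit_interval).
               \<exists>C. AE x in lebesgue_on unit_interval. \<bar>u x\<bar> \<le> C}"

definition weak_star_conv :: "(nat \<Rightarrow> real \<Rightarrow> real) \<Rightarrow> (real \<Rightarrow> real) \<Rightarrow> bool" where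
  "weak_star_conv us u \<longleftrightarrow>
     (\<forall>n. us n \<in> Linfty) \<and> u \<in> Linfty \<and>
     (\<forall>\<phi>. integrable (lebesgue_on unit_interval) \<phi> \<longrightarrow>
        (\<lambda>n. integral\<^sup>L (lebesgue_on unit_interval) (\<lambda>x. us n x * \<phi> x))
          \<longlonglongrightarrow> integral\<^sup>L (lebesgue_on unit_interval) (\<lambda>x. u x * \<phi> x))"

(* Sequential Gamma-convergence on X with respect to a notion of convergence conv.
   Sequences start at 0; the terms of index 0 affect neither limits, liminf nor limsup. *)
definition Gamma_converges ::
    "'a set \<Rightarrow> ((nat \<Rightarrow> 'a) \<Rightarrow> 'a \<Rightarrow> bool) \<Rightarrow> (nat \<Rightarrow> 'a \<Rightarrow> ennreal) \<Rightarrow> ('a \<Rightarrow> ennreal) \<Rightarrow> bool" where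
  "Gamma_converges X conv Fs F \<longleftrightarrow>
     (\<forall>u\<in>X. \<forall>us. (\<forall>n. us n \<in> X) \<and> conv us u \<longrightarrow> F u \<le> liminf (\<lambda>n. Fs n (us n))) \<and>
     (\<forall>u\<in>X. \<exists>us. (\<forall>n. us n \<in> X) \<and> conv us u \<and> limsup (\<lambda>n. Fs n (us n)) \<le> F u)"

definition edges :: "nat \<Rightarrow> nat set set" where
  "edges n = {{i, j} | i j. i \<in> {1..n^2} \<and> j \<in> {1..n^2} \<and>
                 (\<bar>int i - int j\<bar> = 1 \<or> \<bar>int i - int j\<bar> = int n)}"

definition grid_functions :: "nat \<Rightarrow> (real \<Rightarrow> real) set" where
  "grid_functions n = {u. (\<forall>x\<in>{0<..1}. u x \<in> {0, 1}) \<and>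
      (\<forall>i\<in>{1..n^2}. u constant_on {(real i - 1) / real (n^2) <.. real i / real (n^2)})}"

(* For n > 0 every edge has exactly two elements, namely its minimum and its maximum. *)
definition grid_energy :: "nat \<Rightarrow> (real \<Rightarrow> real) \<Rightarrow> real" where
  "grid_energy n u =
     1 / real n * (\<Sum>e\<in>edges n. (u (real (Min e) / real (n^2)) - u (real (Max e) / real (n^2)))^2)"

(* The energy is that of the grid function to which u is a.e. equal; the values of this grid
   function on (0,1] are uniquely determined by u. *)
definition F_discrete :: "nat \<Rightarrow> (real \<Rightarrow> real) \<Rightarrow> ennreal" where
  "F_discrete n u =
     (if \<exists>v\<in>grid_functions n. AE x in lebesgue_on unit_interval. u x = v x
      then ennreal (grid_energy n
             (SOME v. v \<in> grid_functions n \<and> (AE x in lebesgue_on unit_interval. u x = v x)))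
      else \<infinity>)"

definition test_functions :: "(real \<Rightarrow> real) set" where
  "test_functions = {\<phi>. (\<forall>k x. (deriv ^^ k) \<phi> field_differentiable (at x)) \<and>
     (\<exists>a b. 0 < a \<and> a \<le> b \<and> b < 1 \<and> (\<forall>x. x \<notin> {a..b} \<longrightarrow> \<phi> x = 0))}"

abbreviation borel_unit :: "real measure" where
  "borel_unit \<equiv> restrict_space borel unit_interval"

(* The finite signed Borel measure nu on (0,1) is the distributional derivative of u. A finite
   signed measure is the same as a difference M - N of finite positive measures, and integration
   against nu is integration against M minus integration against N, whatever M and N are chosen. *)
definition has_derivative_measure :: "(real \<Rightarrow> real) \<Rightarrow> (real set \<Rightarrow> real) \<Rightarrow> bool" where
  "has_derivative_measure u \<nu> \<longleftrightarrow>
     (\<exists>M N. finite_measure M \<and> finite_measure N \<and>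
        sets M = sets borel_unit \<and> sets N = sets borel_unit \<and>
        (\<forall>B\<in>sets borel_unit. \<nu> B = measure M B - measure N B) \<and>
        (\<forall>\<phi>\<in>test_functions.
           integral\<^sup>L (lebesgue_on unit_interval) (\<lambda>x. u x * deriv \<phi> x)
             = - (integral\<^sup>L M \<phi> - integral\<^sup>L N \<phi>)))"

definition BV :: "(real \<Rightarrow> real) set" where
  "BV = {u. integrable (lebesgue_on unit_interval) u \<and> (\<exists>\<nu>. has_derivative_measure u \<nu>)}"

(* For u in BV the values on the Borel subsets of (0,1) are uniquely determined. *)
definition derivative_measure :: "(real \<Rightarrow> real) \<Rightarrow> real set \<Rightarrow> real" where
  "derivative_measure u = (SOME \<nu>. has_derivative_measure u \<nu>)"

definition total_variation :: "(real set \<Rightarrow> real) \<Rightarrow> real set \<Rightarrow> ennreal" where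
  "total_variation \<nu> B =
     (SUP P \<in> {P :: nat \<Rightarrow> real set. range P \<subseteq> sets borel_unit \<and> disjoint_family P \<and>
                (\<Union>n. P n) = B}. \<Sum>n. ennreal \<bar>\<nu> (P n)\<bar>)"

definition F_limit :: "(real \<Rightarrow> real) \<Rightarrow> ennreal" where
  "F_limit u =
     (if u \<in> BV \<and> (AE x in lebesgue_on unit_interval. 0 \<le> u x \<and> u x \<le> 1)
      then 2 * emeasure lebesgue {x \<in> unit_interval. 0 < u x \<and> u x < 1}
           + total_variation (derivative_measure u) unit_interval
      else \<infinity>)"

end

theory Submission
  imports Defs "HOL-Probability.Helly_Selection"
begin

text \<open>
  The edges arrange the \<open>n\<^sup>2\<close> cells in \<open>n\<close> rows of \<open>n\<close> consecutive cells, wound up like a helix: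
  an edge \<open>{i, i + 1}\<close> is horizontal and also leads from the end of a row to the start of the next
  one, an edge \<open>{i, i + n}\<close> is vertical. The energy is the number of horizontal and vertical jumps
  of a 0-1 sequence \<open>z\<close>, divided by \<open>n\<close> (\<open>lattice_energy\<close>). Row \<open>k\<close> occupies the interval from
  \<open>k / n\<close> to \<open>(k + 1) / n\<close>, hence a weak limit sees the mean of each row only. A variation of this
  mean has to be paid for by vertical jumps, which gives the term \<open>|Du|\<close>. A mean strictly between
  0 and 1 forces, up to lower order, two horizontal jumps per row, which gives the factor 2.

  Lower bound. Let \<open>W i\<close> be the mean of \<open>z\<close> over the window of \<open>n\<close> cells that starts at \<open>i\<close>. Since
  \<open>W (i + 1) - W i = (z (i + n) - z i) / n\<close>, the total variation of \<open>W\<close> is exactly the vertical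
  part of the energy. If \<open>0 < W i < 1\<close>, both values occur on the closed loop that runs through the
  window from \<open>i\<close> to \<open>i + n\<close> and returns along the vertical edge, so the loop has at least two
  jumps (\<open>nonconstant_window\<close>). Every horizontal edge lies in at most \<open>n\<close> windows, and summation
  over \<open>i\<close> yields the bound for fixed \<open>n\<close> with an error of order \<open>1 / n\<close>
  (\<open>lattice_energy_lower_bound\<close>). The step functions made of the \<open>W i\<close> have the same weak limit as
  the grid functions (\<open>window_fn_integral_close\<close>) and bounded variation. Jordan decomposition and
  Helly's theorem make them converge almost everywhere to a difference of monotone functions
  (\<open>window_compactness\<close>), whose Stieltjes measures represent \<open>Du\<close>
  (\<open>has_derivative_measure_monotone_difference\<close>). The measure of the set where the limit is
  fractional is controlled by Fatou's lemma, because the condition \<open>0 < t < 1\<close> is open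
  (\<open>emeasure_fractional_le_liminf\<close>).

  Upper bound. Row \<open>k\<close> is filled with \<open>m k\<close> ones followed by zeros, where \<open>m k\<close> is a rounding of
  \<open>n * u (x k)\<close> for a sample point \<open>x k\<close> of the row. The vertical jumps number \<open>\<bar>m (k + 1) - m k\<bar>\<close>
  between two rows. Rounding the values independently could add 1 for every row, which does not
  vanish after division by \<open>n\<close>; rounding towards the previous value adds at most 1 altogether
  (\<open>sticky_round_variation\<close>). A horizontal descent from 1 to 0 occurs only inside a nonconstant
  row or between a full row and an empty one, and ascents alternate with descents; this bounds the
  horizontal jumps by twice the number of nonconstant rows, up to lower order
  (\<open>lattice_energy_prefix_rows\<close>). If \<open>x k\<close> is chosen with \<open>u (x k)\<close> equal to 0 or 1 whenever that
  is possible, a nonconstant row lies almost entirely in the set where \<open>u\<close> is fractional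
  (\<open>row_sample\<close>).

  The derivative measure is an arbitrary choice among all representations of \<open>Du\<close>, and both halves
  have to cope with this. The lower bound uses that the representation is unique
  (\<open>derivative_measure_unique\<close>), the upper bound that a function with derivative measure \<open>M - N\<close>
  is almost everywhere the difference of the distribution functions of \<open>M\<close> and \<open>N\<close> up to a
  constant (\<open>has_derivative_measure_representation\<close>). Both rest on explicit smooth bumps that
  approximate the indicators of intervals.
\<close>

section \<open>Smooth functions with compact support\<close>

text \<open>Counting derivatives recursively allows sums, products and compositions to be treated by
  induction, without formulas for iterated derivatives.\<close>

fun times_differentiable :: "nat \<Rightarrow> (real \<Rightarrow> real) \<Rightarrow> bool" where
  "times_differentiable 0 f \<longleftrightarrow> (\<forall>x. f field_differentiable at x)"
| "times_differentiable (Suc m) f \<longleftrightarrow>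
     (\<forall>x. f field_differentiable at x) \<and> times_differentiable m (deriv f)"

lemma times_differentiable_iff:
  "times_differentiable m f \<longleftrightarrow> (\<forall>k\<le>m. \<forall>x. (deriv ^^ k) f field_differentiable at x)"
proof (induction m arbitrary: f)
  case 0
  then show ?case by simp
next
  case (Suc m)
  have "(\<forall>k\<le>Suc m. P k) \<longleftrightarrow> P 0 \<and> (\<forall>k\<le>m. P (Suc k))" for P
    by (metis Suc_le_mono not0_implies_Suc zero_le)
  from this[of "\<lambda>k. \<forall>x. (deriv ^^ k) f field_differentiable at x"]
  show ?case
    using Suc by (simp add: funpow_swap1)
qed

lemma smooth_iff:
  "(\<forall>k x. (deriv ^^ k) f field_differentiable at x) \<longleftrightarrow> (\<forall>m. times_differentiable m f)"
  unfolding times_differentiable_iff by blast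

lemma times_differentiable_has_derivative:
  "times_differentiable m f \<Longrightarrow> (f has_field_derivative deriv f x) (at x)"
  by (cases m) (auto simp: DERIV_deriv_iff_field_differentiable)

lemma times_differentiable_SucI:
  assumes "\<And>x. (f has_field_derivative f' x) (at x)" "times_differentiable m f'"
  shows "times_differentiable (Suc m) f"
proof -
  have "deriv f = f'"
    using assms(1) by (auto intro: DERIV_imp_deriv)
  then show ?thesis
    using assms by (auto simp: field_differentiable_def)
qed

lemma times_differentiable_0I:
  assumes "\<And>x. (f has_field_derivative f' x) (at x)"
  shows "times_differentiable 0 f"
  using assms by (auto simp: field_differentiable_def)

lemma times_differentiable_Suc_imp:
  "times_differentiable (Suc m) f \<Longrightarrow> times_differentiable m f"
  by (simp add: times_differentiable_iff del: times_differentiable.simps)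

lemma times_differentiable_const [simp]: "times_differentiable m (\<lambda>x. c)"
proof (induction m arbitrary: c)
  case 0
  then show ?case by simp
next
  case (Suc m)
  show ?case
    by (rule times_differentiable_SucI[where f' = "\<lambda>_. 0"]) (auto intro: Suc)
qed

lemma times_differentiable_add:
  "times_differentiable m f \<Longrightarrow> times_differentiable m g \<Longrightarrow> times_differentiable m (\<lambda>x. f x + g x)"
proof (induction m arbitrary: f g)
  case 0
  then show ?case by (auto intro: field_differentiable_add)
next
  case (Suc m)
  show ?case
    by (rule times_differentiable_SucI[where f' = "\<lambda>x. deriv f x + deriv g x"])
       (use Suc in \<open>auto intro!: DERIV_add Suc.IH simp: DERIV_deriv_iff_field_differentiable\<close>)
qed

lemma times_differentiable_mult:
  "times_differentiable m f \<Longrightarrow> times_differentiable m g \<Longrightarrow> times_differentiable m (\<lambda>x. f x * g x)"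
proof (induction m arbitrary: f g)
  case 0
  then show ?case by (auto intro: field_differentiable_mult)
next
  case (Suc m)
  show ?case
  proof (rule times_differentiable_SucI)
    fix x
    show "((\<lambda>x. f x * g x) has_field_derivative f x * deriv g x + deriv f x * g x) (at x)"
      using Suc.prems by (intro DERIV_mult') (auto simp: DERIV_deriv_iff_field_differentiable)
    show "times_differentiable m (\<lambda>x. f x * deriv g x + deriv f x * g x)"
      using Suc.prems times_differentiable_Suc_imp[of m]
      by (intro times_differentiable_add Suc.IH) auto
  qed
qed

lemma times_differentiable_affine:
  "times_differentiable m f \<Longrightarrow> times_differentiable m (\<lambda>x. f (a * x + b))"
proof (induction m arbitrary: f)
  case 0
  have "((\<lambda>x. f (a * x + b)) has_field_derivative deriv f (a * x + b) * a) (at x)" for x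
    by (rule DERIV_chain2[where g = "\<lambda>x. a * x + b"])
       (use 0 in \<open>auto simp: DERIV_deriv_iff_field_differentiable intro!: derivative_eq_intros\<close>)
  then show ?case by (rule times_differentiable_0I)
next
  case (Suc m)
  have "((\<lambda>x. f (a * x + b)) has_field_derivative deriv f (a * x + b) * a) (at x)" for x
    by (rule DERIV_chain2[where g = "\<lambda>x. a * x + b"])
       (use Suc.prems in \<open>auto simp: DERIV_deriv_iff_field_differentiable intro!: derivative_eq_intros\<close>)
  then show ?case
    by (rule times_differentiable_SucI)
       (use Suc in \<open>auto intro!: times_differentiable_mult\<close>)
qed

text \<open>The functions \<open>exp (- c / x) / x ^ k\<close> are needed for all \<open>k\<close> at once: the derivative of one of
  them is a linear combination of two others, so smoothness follows by induction from first
  derivatives alone.\<close>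

definition flat_exp :: "real \<Rightarrow> nat \<Rightarrow> real \<Rightarrow> real" where
  "flat_exp c k x = (if x > 0 then exp (- c / x) / x ^ k else 0)"

lemma flat_exp_tendsto_0:
  fixes c :: real
  assumes "c > 0"
  shows "((\<lambda>x. exp (- c / x) / x ^ k) \<longlongrightarrow> 0) (at_right 0)"
proof -
  have *: "filterlim (\<lambda>x. c * inverse x) at_top (at_right 0)"
    using tendsto_const assms filterlim_inverse_at_top_right
    by (rule filterlim_tendsto_pos_mult_at_top)
  have "((\<lambda>x. inverse (c ^ k) * ((c * inverse x) ^ k / exp (c * inverse x))) \<longlongrightarrow> inverse (c ^ k) * 0) (at_right 0)"
    by (intro tendsto_mult tendsto_const filterlim_compose[OF tendsto_power_div_exp_0 *])
  moreover have "inverse (c ^ k) * ((c * inverse x) ^ k / exp (c * inverse x)) = exp (- c / x) / x ^ k" for x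
    using assms by (simp add: exp_minus power_mult_distrib power_inverse divide_inverse)
  ultimately show ?thesis
    by simp
qed

lemma flat_exp_has_derivative:
  assumes "c > 0"
  shows "(flat_exp c k has_field_derivative c * flat_exp c (k + 2) x + (- real k) * flat_exp c (k + 1) x) (at x)"
proof (cases x "0::real" rule: linorder_cases)
  case greater
  have "((\<lambda>x. exp (- c / x)) has_field_derivative exp (- c / x) * (c / x\<^sup>2)) (at x)"
    using greater by (auto intro!: derivative_eq_intros simp: power2_eq_square)
  moreover have "((\<lambda>x. 1 / x ^ k) has_field_derivative - real k / x ^ (k + 1)) (at x)"
  proof (cases k)
    case (Suc j)
    have "((\<lambda>x. inverse (x ^ k)) has_field_derivative - (inverse (x ^ k) * (real k * x ^ (k - Suc 0)) * inverse (x ^ k))) (at x)"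
      using greater by (intro DERIV_inverse' DERIV_pow) auto
    moreover have "- (inverse (x ^ k) * (real k * x ^ (k - Suc 0)) * inverse (x ^ k)) = - real k / x ^ (k + 1)"
      using greater by (simp add: Suc divide_simps)
    ultimately show ?thesis by (simp add: inverse_eq_divide)
  qed simp
  ultimately have "((\<lambda>x. exp (- c / x) * (1 / x ^ k)) has_field_derivative
      exp (- c / x) * (- real k / x ^ (k + 1)) + exp (- c / x) * (c / x\<^sup>2) * (1 / x ^ k)) (at x)"
    by (rule DERIV_mult')
  moreover have "exp (- c / x) * (- real k / x ^ (k + 1)) + exp (- c / x) * (c / x\<^sup>2) * (1 / x ^ k)
      = c * flat_exp c (k + 2) x + (- real k) * flat_exp c (k + 1) x"
    using greater by (simp add: flat_exp_def power_add power2_eq_square mult.assoc mult.commute)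
  ultimately have "((\<lambda>x. exp (- c / x) / x ^ k) has_field_derivative
      c * flat_exp c (k + 2) x + (- real k) * flat_exp c (k + 1) x) (at x)"
    by simp
  then show ?thesis
    by (rule has_field_derivative_transform_within[where S = UNIV and d = x])
       (use greater in \<open>auto simp: flat_exp_def dist_real_def\<close>)
next
  case less
  have "((\<lambda>x. 0) has_field_derivative c * flat_exp c (k + 2) x + (- real k) * flat_exp c (k + 1) x) (at x)"
    using less by (simp add: flat_exp_def)
  then show ?thesis
    by (rule has_field_derivative_transform_within[where S = UNIV and d = "- x"])
       (use less in \<open>auto simp: flat_exp_def dist_real_def\<close>)
next
  case equal
  \<comment> \<open>On the right the difference quotient at 0 is the same function with \<open>k + 1\<close> in
    place of \<open>k\<close>.\<close>
  have "((\<lambda>h. (flat_exp c k (0 + h) - flat_exp c k 0) / h) \<longlongrightarrow> 0) (at 0)"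
    unfolding filterlim_at_split
  proof
    have "eventually (\<lambda>h. 0 = (flat_exp c k (0 + h) - flat_exp c k 0) / h) (at_left 0)"
      by (auto simp: eventually_at_filter flat_exp_def)
    then show "((\<lambda>h. (flat_exp c k (0 + h) - flat_exp c k 0) / h) \<longlongrightarrow> 0) (at_left 0)"
      by (rule Lim_transform_eventually[OF tendsto_const])
    have "eventually (\<lambda>h. exp (- c / h) / h ^ (Suc k) = (flat_exp c k (0 + h) - flat_exp c k 0) / h) (at_right 0)"
      by (auto simp: eventually_at_filter flat_exp_def)
    then show "((\<lambda>h. (flat_exp c k (0 + h) - flat_exp c k 0) / h) \<longlongrightarrow> 0) (at_right 0)"
      by (rule Lim_transform_eventually[OF flat_exp_tendsto_0[OF assms]])
  qed
  then show ?thesis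
    using equal by (simp add: DERIV_def flat_exp_def)
qed

lemma times_differentiable_flat_exp:
  "c > 0 \<Longrightarrow> times_differentiable m (flat_exp c k)"
proof (induction m arbitrary: k)
  case 0
  then show ?case
    by (intro times_differentiable_0I[OF flat_exp_has_derivative])
next
  case (Suc m)
  show ?case
    by (intro times_differentiable_SucI[OF flat_exp_has_derivative] times_differentiable_add
          times_differentiable_mult times_differentiable_const Suc)
qed

definition bump :: "real \<Rightarrow> real \<Rightarrow> real \<Rightarrow> real \<Rightarrow> real" where
  "bump c a b x = flat_exp c 0 (x - a) * flat_exp c 0 (b - x)"

lemma bump_le_1: "c > 0 \<Longrightarrow> 0 \<le> bump c a b x" "c > 0 \<Longrightarrow> bump c a b x \<le> 1"
  by (auto simp: bump_def flat_exp_def mult_le_one)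

lemma bump_eq_0: "x \<notin> {a<..<b} \<Longrightarrow> bump c a b x = 0"
  by (auto simp: bump_def flat_exp_def)

lemma times_differentiable_bump:
  assumes "c > 0"
  shows "times_differentiable m (bump c a b)"
proof -
  have "times_differentiable m (\<lambda>x. flat_exp c 0 (1 * x + - a) * flat_exp c 0 ((-1) * x + b))"
    using assms by (intro times_differentiable_mult times_differentiable_affine times_differentiable_flat_exp)
  also have "(\<lambda>x. flat_exp c 0 (1 * x + - a) * flat_exp c 0 ((-1) * x + b)) = bump c a b"
    by (auto simp: bump_def)
  finally show ?thesis .
qed

lemma bump_test_function:
  assumes "c > 0" "0 < a" "a < b" "b < 1"
  shows "bump c a b \<in> test_functions"
proof -
  have "\<forall>k x. (deriv ^^ k) (bump c a b) field_differentiable at x"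
    unfolding smooth_iff using times_differentiable_bump[OF assms(1)] by blast
  moreover have "0 < a \<and> a \<le> b \<and> b < 1 \<and> (\<forall>x. x \<notin> {a..b} \<longrightarrow> bump c a b x = 0)"
    using assms by (auto intro!: bump_eq_0)
  ultimately show ?thesis
    unfolding test_functions_def by blast
qed

text \<open>As the decay constant tends to 0, the same formula approximates the indicator of the interval.
  Together with \<open>0 \<le> bump \<le> 1\<close> this lets dominated convergence do the work of mollification.\<close>

lemma bump_tendsto_indicator:
  "(\<lambda>m. bump (1 / real (Suc m)) a b x) \<longlonglongrightarrow> indicator {a<..<b} x"
proof (cases "x \<in> {a<..<b}")
  case True
  have "(\<lambda>m. exp (- (1 / real (Suc m)) / (x - a)) * exp (- (1 / real (Suc m)) / (b - x)))
          \<longlonglongrightarrow> exp (- 0 / (x - a)) * exp (- 0 / (b - x))"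
    using True by (intro tendsto_intros LIMSEQ_Suc[OF lim_1_over_n]) auto
  moreover have "bump (1 / real (Suc m)) a b x
      = exp (- (1 / real (Suc m)) / (x - a)) * exp (- (1 / real (Suc m)) / (b - x))" for m
    using True by (simp add: bump_def flat_exp_def)
  ultimately show ?thesis
    using True by simp
qed (simp add: bump_eq_0)

lemma test_function_times_differentiable:
  "\<phi> \<in> test_functions \<Longrightarrow> times_differentiable m \<phi>"
  using smooth_iff by (auto simp: test_functions_def)

lemma test_function_DERIV:
  "\<phi> \<in> test_functions \<Longrightarrow> (\<phi> has_field_derivative deriv \<phi> x) (at x)"
  using times_differentiable_has_derivative test_function_times_differentiable by blast

lemma test_function_continuous_on: "\<phi> \<in> test_functions \<Longrightarrow> continuous_on A \<phi>"
  using test_function_DERIV DERIV_isCont continuous_at_imp_continuous_on by blast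

lemma test_function_deriv:
  assumes "\<phi> \<in> test_functions"
  shows "deriv \<phi> \<in> test_functions"
proof -
  obtain a b where ab: "0 < a" "a \<le> b" "b < 1" "\<And>x. x \<notin> {a..b} \<Longrightarrow> \<phi> x = 0"
    using assms by (auto simp: test_functions_def)
  have "deriv \<phi> x = 0" if "x \<notin> {a..b}" for x
  proof (rule DERIV_imp_deriv)
    have "open (- {a..b})" by auto
    then have "eventually (\<lambda>y. y \<in> - {a..b}) (nhds x)"
      using that by (auto simp: eventually_nhds)
    then have "eventually (\<lambda>y. \<phi> y = 0) (nhds x)"
      by eventually_elim (use ab in auto)
    then show "(\<phi> has_field_derivative 0) (at x)"
      using DERIV_cong_ev[of x x \<phi> "\<lambda>_. 0" 0 0] by simp
  qed
  moreover have "(deriv ^^ k) (deriv \<phi>) field_differentiable at x" for k x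
  proof -
    have "(deriv ^^ Suc k) \<phi> field_differentiable at x"
      using assms by (simp add: test_functions_def del: funpow.simps)
    then show ?thesis by (simp add: funpow_swap1)
  qed
  ultimately show ?thesis
    using ab by (auto simp: test_functions_def)
qed

lemma test_function_integral_Icc:
  assumes "\<phi> \<in> test_functions" "x \<le> y"
  shows "(deriv \<phi> has_integral \<phi> y - \<phi> x) {x..y}"
proof (rule fundamental_theorem_of_calculus[OF assms(2)])
  fix t
  have "(\<phi> has_vector_derivative deriv \<phi> t) (at t)"
    using test_function_DERIV[OF assms(1)]
    by (simp add: has_real_derivative_iff_has_vector_derivative)
  then show "(\<phi> has_vector_derivative deriv \<phi> t) (at t within {x..y})"
    by (rule has_vector_derivative_at_within)
qed

text \<open>The integral from the left end of the support vanishes to the left of it, and to the right of it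
  as well because the mean is zero.\<close>

lemma mean_zero_test_function_primitive:
  assumes \<psi>: "\<psi> \<in> test_functions" and zero: "integral {0..1} \<psi> = 0"
  obtains \<phi> where "\<phi> \<in> test_functions" "deriv \<phi> = \<psi>"
proof -
  obtain a b where ab: "0 < a" "a \<le> b" "b < 1" "\<And>x. x \<notin> {a..b} \<Longrightarrow> \<psi> x = 0"
    using \<psi> by (auto simp: test_functions_def)
  define \<phi> where "\<phi> x = integral {a..x} \<psi>" for x
  have cont: "continuous_on A \<psi>" for A
    using \<psi> by (rule test_function_continuous_on)
  have int: "\<psi> integrable_on {x..y}" for x y
    by (intro integrable_continuous_interval cont)
  have left: "\<phi> x = 0" if "x \<le> a" for x
  proof -
    have "{a..x} = {} \<or> {a..x} = {a}" using that by auto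
    then show ?thesis by (auto simp: \<phi>_def)
  qed
  have vanish: "integral {x..y} \<psi> = 0" if "{x<..<y} \<inter> {a..b} = {}" for x y
  proof -
    have "integral {x..y} \<psi> = integral {x..y} (\<lambda>_. 0)"
    proof (rule integral_spike[of "{x,y}"])
      fix t assume "t \<in> {x..y} - {x, y}"
      then have "t \<in> {x<..<y}" by auto
      with that have "t \<notin> {a..b}" by blast
      with ab(4) show "0 = \<psi> t" by simp
    qed auto
    then show ?thesis by simp
  qed
  have right: "\<phi> x = 0" if "x \<ge> b" for x
  proof -
    have "integral {0..a} \<psi> + integral {a..b} \<psi> = integral {0..b} \<psi>"
      using ab int by (intro Henstock_Kurzweil_Integration.integral_combine) auto
    moreover have "integral {0..b} \<psi> + integral {b..1} \<psi> = integral {0..1} \<psi>"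
      using ab int by (intro Henstock_Kurzweil_Integration.integral_combine) auto
    moreover have "integral {a..b} \<psi> + integral {b..x} \<psi> = integral {a..x} \<psi>"
      using ab int that by (intro Henstock_Kurzweil_Integration.integral_combine) auto
    moreover have "integral {0..a} \<psi> = 0" "integral {b..1} \<psi> = 0" "integral {b..x} \<psi> = 0"
      by (auto intro!: vanish)
    ultimately show ?thesis using zero by (simp add: \<phi>_def)
  qed
  have der: "(\<phi> has_field_derivative \<psi> x) (at x)" for x
  proof -
    \<comment> \<open>A base point to the left of \<open>x\<close> from which the integral is still \<open>\<phi>\<close>.\<close>
    define A where "A = min a (x - 1)"
    have Aa: "A \<le> a" "A < x" by (auto simp: A_def)
    have eq: "\<phi> y = integral {A..y} \<psi>" if "y > A" for y
    proof (cases "y \<ge> a")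
      case True
      have "integral {A..a} \<psi> + integral {a..y} \<psi> = integral {A..y} \<psi>"
        using Aa int True by (intro Henstock_Kurzweil_Integration.integral_combine) auto
      moreover have "integral {A..a} \<psi> = 0" by (auto intro!: vanish)
      ultimately show ?thesis by (simp add: \<phi>_def)
    next
      case False
      have "integral {A..y} \<psi> = 0" by (rule vanish) (use False in auto)
      then show ?thesis using False left by simp
    qed
    have "((\<lambda>u. integral {A..u} \<psi>) has_real_derivative \<psi> x) (at x within {A..x+1})"
      by (rule integral_has_real_derivative) (use cont Aa in auto)
    moreover have "at x within {A..x+1} = at x"
      by (rule at_within_interior) (use Aa in auto)
    ultimately have "((\<lambda>u. integral {A..u} \<psi>) has_real_derivative \<psi> x) (at x)"
      by simp
    then show ?thesis
      by (rule has_field_derivative_transform_within[where S = UNIV and d = "x - A"]) (use Aa eq in \<open>auto simp: dist_real_def\<close>)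
  qed
  have "times_differentiable m \<phi>" for m
    by (rule times_differentiable_Suc_imp, rule times_differentiable_SucI[OF der])
       (rule test_function_times_differentiable[OF \<psi>])
  then have "\<phi> \<in> test_functions"
  proof -
    have "0 < a \<and> a \<le> b \<and> b < 1 \<and> (\<forall>x. x \<notin> {a..b} \<longrightarrow> \<phi> x = 0)"
      using ab(1-3) left right by auto
    then show ?thesis
      using \<open>\<And>m. times_differentiable m \<phi>\<close> smooth_iff[of \<phi>] unfolding test_functions_def by blast
  qed
  moreover have "deriv \<phi> = \<psi>"
    using der by (auto intro: DERIV_imp_deriv)
  ultimately show ?thesis using that by blast
qed

section \<open>Functions on the unit interval that are determined by their integrals over subintervals\<close>

abbreviation leb01 :: "real measure" where
  "leb01 \<equiv> lebesgue_on unit_interval"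

text \<open>A bump can be a test function only if its support has a positive distance from 0 and 1; these
  intervals still generate the Borel sets of the unit interval.\<close>

definition inner_intervals :: "real set set" where
  "inner_intervals = {{a<..<b} | a b. 0 < a \<and> b < 1}"

lemma Int_stable_inner_intervals: "Int_stable inner_intervals"
proof (rule Int_stableI)
  fix A B assume "A \<in> inner_intervals" "B \<in> inner_intervals"
  then obtain a b c d where "A = {a<..<b}" "B = {c<..<d}" "0 < a" "b < 1" "0 < c" "d < 1"
    by (auto simp: inner_intervals_def)
  then show "A \<inter> B \<in> inner_intervals"
    unfolding inner_intervals_def
    by (intro CollectI exI[of _ "max a c"] exI[of _ "min b d"]) auto
qed

lemma inner_intervals_subset: "inner_intervals \<subseteq> Pow unit_interval"
  by (auto simp: inner_intervals_def)

definition inner_interval :: "nat \<Rightarrow> real set" where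
  "inner_interval i = {1 / real (Suc i)<..<1 - 1 / real (Suc i)}"

lemma inner_interval: "inner_interval i \<in> inner_intervals"
  unfolding inner_intervals_def inner_interval_def by (intro CollectI exI conjI) auto

lemma incseq_inner_interval: "incseq inner_interval"
proof (rule incseq_SucI)
  fix i
  have "1 / real (Suc (Suc i)) \<le> 1 / real (Suc i)" by (simp add: field_simps)
  then show "inner_interval i \<le> inner_interval (Suc i)" unfolding inner_interval_def by auto
qed

lemma UN_inner_interval: "(\<Union>i. inner_interval i) = unit_interval"
proof (intro set_eqI iffI)
  fix x :: real assume "x \<in> unit_interval"
  then have "0 < min x (1 - x)" by auto
  then obtain n where "1 / real (Suc n) < min x (1 - x)" using nat_approx_posE by blast
  then have "x \<in> inner_interval n" by (auto simp: inner_interval_def)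
  then show "x \<in> (\<Union>i. inner_interval i)" by blast
next
  fix x assume "x \<in> (\<Union>i. inner_interval i)"
  then show "x \<in> unit_interval" using inner_interval inner_intervals_subset by blast
qed

lemma sets_borel_unit: "sets borel_unit = sigma_sets unit_interval inner_intervals"
proof -
  have "sets borel_unit = (\<inter>) unit_interval ` sigma_sets UNIV (range (\<lambda>(a, b). {a<..<b :: real}))"
    unfolding sets_restrict_space by (subst borel_eq_box) (simp add: box_real split_def)
  also have "\<dots> = sigma_sets unit_interval ((\<inter>) unit_interval ` range (\<lambda>(a, b). {a<..<b :: real}))"
    by (rule sigma_sets_Int) auto
  also have "\<dots> = sigma_sets unit_interval inner_intervals"
  proof (rule sigma_sets_eqI)
    fix A assume "A \<in> (\<inter>) unit_interval ` range (\<lambda>(a, b). {a<..<b :: real})"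
    then obtain a b :: real where A: "A = unit_interval \<inter> {a<..<b}" by auto
    have *: "A = (\<Union>n. {max 0 a + 1 / real (Suc n)<..<min 1 b - 1 / real (Suc n)})"
    proof (intro set_eqI iffI)
      fix x assume "x \<in> A"
      then have "0 < min (x - max 0 a) (min 1 b - x)" using A by auto
      then obtain n where "1 / real (Suc n) < min (x - max 0 a) (min 1 b - x)"
        using nat_approx_posE by blast
      then have "x \<in> {max 0 a + 1 / real (Suc n)<..<min 1 b - 1 / real (Suc n)}" by auto
      then show "x \<in> (\<Union>n. {max 0 a + 1 / real (Suc n)<..<min 1 b - 1 / real (Suc n)})" by blast
    next
      fix x assume "x \<in> (\<Union>n. {max 0 a + 1 / real (Suc n)<..<min 1 b - 1 / real (Suc n)})"
      then obtain n where "max 0 a + 1 / real (Suc n) < x" "x < min 1 b - 1 / real (Suc n)"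
        by auto
      moreover have "0 < 1 / real (Suc n)" by simp
      ultimately have "max 0 a < x" "x < min 1 b" by linarith+
      then show "x \<in> A" using A by auto
    qed
    have "{max 0 a + 1 / real (Suc n)<..<min 1 b - 1 / real (Suc n)} \<in> inner_intervals" for n
    proof -
      have "0 < 1 / real (Suc n)" by simp
      then have "0 < max 0 a + 1 / real (Suc n)" "min 1 b - 1 / real (Suc n) < 1" by linarith+
      then show ?thesis unfolding inner_intervals_def by blast
    qed
    then show "A \<in> sigma_sets unit_interval inner_intervals"
      unfolding * by (intro sigma_sets.Union sigma_sets.Basic) auto
  next
    fix A assume "A \<in> inner_intervals"
    then obtain a b where "0 < a" "b < 1" "A = {a<..<b}" by (auto simp: inner_intervals_def)
    then have "A = unit_interval \<inter> (\<lambda>(a, b). {a<..<b}) (a, b)" by auto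
    then show "A \<in> sigma_sets unit_interval ((\<inter>) unit_interval ` range (\<lambda>(a, b). {a<..<b :: real}))"
      by blast
  qed
  finally show ?thesis .
qed

lemma space_leb01 [simp]: "space leb01 = unit_interval"
  by (simp add: space_restrict_space)

lemma sets_borel_unit_iff: "A \<in> sets borel_unit \<longleftrightarrow> A \<in> sets borel \<and> A \<subseteq> unit_interval"
  by (auto simp: sets_restrict_space_iff)

lemma sets_borel_unit_subset: "A \<in> sets borel_unit \<Longrightarrow> A \<in> sets leb01"
  by (auto simp: sets_restrict_space_iff sets_borel_unit_iff)

lemma finite_measure_leb01: "finite_measure leb01"
  by (rule finite_measure_lebesgue_on) auto

lemma borel_measurable_leb01:
  assumes "h \<in> borel_measurable borel" shows "h \<in> borel_measurable leb01"
proof -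
  have "h \<in> borel_measurable lebesgue" using assms by (simp add: measurable_completion)
  then show ?thesis by (rule measurable_restrict_space1)
qed

lemma integrable_leb01_bounded:
  fixes h :: "real \<Rightarrow> real"
  assumes "h \<in> borel_measurable leb01" "AE x in leb01. \<bar>h x\<bar> \<le> C"
  shows "integrable leb01 h"
  using assms finite_measure_leb01
  by (intro finite_measure.integrable_const_bound[where B = C]) auto

lemma integrable_bounded_mult:
  fixes g \<phi> :: "real \<Rightarrow> real"
  assumes g: "g \<in> borel_measurable M" "AE x in M. \<bar>g x\<bar> \<le> D" and \<phi>: "integrable M \<phi>"
  shows "integrable M (\<lambda>x. g x * \<phi> x)"
proof (rule Bochner_Integration.integrable_bound[where f = "\<lambda>x. D * \<phi> x"])
  show "AE x in M. norm (g x * \<phi> x) \<le> norm (D * \<phi> x)"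
    using g(2) by eventually_elim (auto simp: abs_mult intro!: mult_right_mono)
qed (use \<phi> g(1) in auto)

text \<open>By the uniform bound, the pairings with \<open>f n\<close> are equicontinuous in the \<open>L\<^sup>1\<close> norm of the other
  factor.\<close>

lemma pairing_limit_dominated:
  fixes f :: "nat \<Rightarrow> real \<Rightarrow> real" and C :: real
  assumes meas: "\<And>n. f n \<in> borel_measurable leb01"
    and bound: "\<And>n. AE x in leb01. \<bar>f n x\<bar> \<le> C"
    and s: "\<And>i. integrable leb01 (s i)" and h: "integrable leb01 h"
    and lim: "\<And>x. x \<in> unit_interval \<Longrightarrow> (\<lambda>i. s i x) \<longlonglongrightarrow> \<psi> x"
    and dom: "\<And>i x. x \<in> unit_interval \<Longrightarrow> \<bar>s i x\<bar> \<le> h x"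
    and zero: "\<And>i. (\<lambda>n. \<integral>x. f n x * s i x \<partial>leb01) \<longlonglongrightarrow> 0"
  shows "(\<lambda>n. \<integral>x. f n x * \<psi> x \<partial>leb01) \<longlonglongrightarrow> 0"
proof (rule LIMSEQ_I)
  have \<psi>: "integrable leb01 \<psi>"
  proof (rule integrable_dominated_convergence[where s = s and w = h])
    show "\<psi> \<in> borel_measurable leb01"
      by (rule borel_measurable_LIMSEQ_real[where u = s]) (use lim s in auto)
  qed (use lim dom s h in auto)
  note fint = integrable_bounded_mult[OF meas bound]
  fix e :: real assume "0 < e"
  have "(\<lambda>i. \<integral>x. \<bar>\<psi> x - s i x\<bar> \<partial>leb01) \<longlonglongrightarrow> (\<integral>x. 0 \<partial>leb01)"
  proof (rule integral_dominated_convergence[where w = "\<lambda>x. \<bar>\<psi> x\<bar> + h x"])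
    show "AE x in leb01. (\<lambda>i. \<bar>\<psi> x - s i x\<bar>) \<longlonglongrightarrow> 0"
    proof (rule AE_I2)
      fix x assume "x \<in> space leb01"
      then have "(\<lambda>i. \<bar>\<psi> x - s i x\<bar>) \<longlonglongrightarrow> \<bar>\<psi> x - \<psi> x\<bar>"
        using lim by (intro tendsto_intros) auto
      then show "(\<lambda>i. \<bar>\<psi> x - s i x\<bar>) \<longlonglongrightarrow> 0" by simp
    qed
    show "AE x in leb01. norm \<bar>\<psi> x - s i x\<bar> \<le> \<bar>\<psi> x\<bar> + h x" for i
    proof (rule AE_I2)
      fix x assume "x \<in> space leb01"
      then show "norm \<bar>\<psi> x - s i x\<bar> \<le> \<bar>\<psi> x\<bar> + h x" using dom[of x i] by auto
    qed
  qed (use \<psi> s h in auto)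
  then have "(\<lambda>i. \<bar>C\<bar> * (\<integral>x. \<bar>\<psi> x - s i x\<bar> \<partial>leb01)) \<longlonglongrightarrow> \<bar>C\<bar> * 0"
    by (intro tendsto_intros) simp
  then have "eventually (\<lambda>i. \<bar>C\<bar> * (\<integral>x. \<bar>\<psi> x - s i x\<bar> \<partial>leb01) < e / 2) sequentially"
    by (rule order_tendstoD) (use \<open>0 < e\<close> in auto)
  then obtain i where i: "\<bar>C\<bar> * (\<integral>x. \<bar>\<psi> x - s i x\<bar> \<partial>leb01) < e / 2"
    by (auto simp: eventually_sequentially)
  obtain N where N: "\<And>n. n \<ge> N \<Longrightarrow> \<bar>\<integral>x. f n x * s i x \<partial>leb01\<bar> < e / 2"
    using LIMSEQ_D[OF zero[of i], of "e / 2"] \<open>0 < e\<close> by auto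
  show "\<exists>N. \<forall>n\<ge>N. norm ((\<integral>x. f n x * \<psi> x \<partial>leb01) - 0) < e"
  proof (intro exI allI impI)
    fix n assume "N \<le> n"
    have "(\<integral>x. f n x * \<psi> x \<partial>leb01) - (\<integral>x. f n x * s i x \<partial>leb01)
        = (\<integral>x. f n x * (\<psi> x - s i x) \<partial>leb01)"
      using fint[OF \<psi>] fint[OF s] by (simp add: right_diff_distrib)
    moreover have "\<bar>\<integral>x. f n x * (\<psi> x - s i x) \<partial>leb01\<bar> \<le> (\<integral>x. \<bar>C\<bar> * \<bar>\<psi> x - s i x\<bar> \<partial>leb01)"
    proof (rule integral_abs_bound[THEN order_trans], rule integral_mono_AE)
      show "AE x in leb01. \<bar>f n x * (\<psi> x - s i x)\<bar> \<le> \<bar>C\<bar> * \<bar>\<psi> x - s i x\<bar>"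
        using bound[of n] by eventually_elim (auto simp: abs_mult intro!: mult_right_mono)
    qed (use \<psi> s in \<open>auto intro!: fint\<close>)
    ultimately show "norm ((\<integral>x. f n x * \<psi> x \<partial>leb01) - 0) < e"
      using i N[OF \<open>N \<le> n\<close>] by simp
  qed
qed

text \<open>For bounded sequences, weak-* convergence can be tested on intervals: a \<open>\<pi>\<close>-\<open>\<lambda>\<close> argument extends
  the convergence to Borel sets, approximation by simple functions to integrable Borel functions,
  and the Borel representative of a Lebesgue measurable function to the rest.\<close>

lemma weak_null_sequence:
  fixes f :: "nat \<Rightarrow> real \<Rightarrow> real" and C :: real
  assumes meas: "\<And>n. f n \<in> borel_measurable leb01"
    and bound: "\<And>n. AE x in leb01. \<bar>f n x\<bar> \<le> C"
    and intervals: "\<And>a b. \<lbrakk>0 < a; a < b; b < 1\<rbrakk> \<Longrightarrow>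
      (\<lambda>n. \<integral>x. f n x * indicator {a<..<b} x \<partial>leb01) \<longlonglongrightarrow> 0"
    and \<phi>: "integrable leb01 \<phi>"
  shows "(\<lambda>n. \<integral>x. f n x * \<phi> x \<partial>leb01) \<longlonglongrightarrow> 0"
proof -
  interpret L: finite_measure leb01 by (rule finite_measure_leb01)
  define P where "P \<psi> \<longleftrightarrow> (\<lambda>n. \<integral>x. f n x * \<psi> x \<partial>leb01) \<longlonglongrightarrow> 0" for \<psi>
  note fint = integrable_bounded_mult[OF meas bound]
  have P_lim: "P \<psi>" if "\<And>i. integrable leb01 (s i)" "integrable leb01 h"
    "\<And>x. x \<in> unit_interval \<Longrightarrow> (\<lambda>i. s i x) \<longlonglongrightarrow> \<psi> x"
    "\<And>i x. x \<in> unit_interval \<Longrightarrow> \<bar>s i x\<bar> \<le> h x" "\<And>i. P (s i)" for \<psi> s h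
    using pairing_limit_dominated[where f = f and s = s and \<psi> = \<psi>, OF meas bound that(1-4)] that(5) unfolding P_def by simp
  have P_add: "P (\<lambda>x. g x + h x)"
    if "integrable leb01 g" "integrable leb01 h" "P g" "P h" for g h
    using tendsto_add[OF that(3)[unfolded P_def] that(4)[unfolded P_def]]
    by (simp add: P_def distrib_left fint that(1,2))
  have P_cmult: "P (\<lambda>x. c * g x)" if "P g" for g c
    using tendsto_mult_left[OF that[unfolded P_def], of c] unfolding P_def
    by (simp add: mult.left_commute)
  have P_cong: "P g \<longleftrightarrow> P h" if "\<And>x. x \<in> unit_interval \<Longrightarrow> g x = h x" for g h
    unfolding P_def by (intro arg_cong[where f = "\<lambda>F. F \<longlonglongrightarrow> 0"] ext Bochner_Integration.integral_cong) (auto simp: that)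
  have ind: "integrable leb01 (indicator A :: real \<Rightarrow> real)" if "A \<in> sets borel_unit" for A
    using sets_borel_unit_subset[OF that] by (intro integrable_real_indicator) (simp_all add: L.emeasure_finite less_top[symmetric])
  have borel_ind: "A \<in> sets borel_unit" if "A \<in> inner_intervals" for A
    unfolding sets_borel_unit using that by (rule sigma_sets.Basic)
  have P_inner: "P (indicator A)" if inner: "A \<in> inner_intervals" for A
  proof -
    obtain a b where A: "A = {a<..<b}" "0 < a" "b < 1"
      using inner by (auto simp: inner_intervals_def)
    show ?thesis
      using intervals[of a b] A by (cases "a < b") (auto simp: P_def)
  qed
  have P_unit: "P (indicator unit_interval)"
  proof (rule P_lim)
    show "P (indicator (inner_interval i))" for i by (rule P_inner[OF inner_interval])
    show "integrable leb01 (indicator (inner_interval i) :: real \<Rightarrow> real)" for i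
      by (rule ind[OF borel_ind[OF inner_interval]])
    show "(\<lambda>i. indicator (inner_interval i) x) \<longlonglongrightarrow> (indicator unit_interval x :: real)" for x
      using LIMSEQ_indicator_incseq[OF incseq_inner_interval, of x] by (simp only: UN_inner_interval)
    show "integrable leb01 (\<lambda>_. 1 :: real)" by simp
  qed (auto simp: indicator_def)
  have P_borel: "P (indicator A)" if "A \<in> sets borel_unit" for A
    using Int_stable_inner_intervals inner_intervals_subset that[unfolded sets_borel_unit]
  proof (induction rule: sigma_sets_induct_disjoint)
    case (basic A)
    then show ?case by (rule P_inner)
  next
    case empty
    then show ?case by (simp add: P_def)
  next
    case (compl A)
    then have A: "A \<in> sets borel_unit" by (simp add: sets_borel_unit)
    have "P (\<lambda>x. indicator unit_interval x + (-1) * indicator A x)"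
      using compl A by (intro P_add P_unit P_cmult integrable_mult_right ind) (auto simp: sets_borel_unit_iff)
    moreover have "(\<lambda>x. indicator unit_interval x + (-1) * indicator A x) = (indicator (unit_interval - A) :: real \<Rightarrow> real)"
      using A by (auto simp: fun_eq_iff indicator_def sets_borel_unit_iff)
    ultimately show ?case by simp
  next
    case (union A)
    then have A: "A i \<in> sets borel_unit" for i by (auto simp: sets_borel_unit)
    have fin: "P (indicator (\<Union>j<i. A j))" for i
    proof (induction i)
      case 0
      then show ?case by (simp add: P_def)
    next
      case (Suc i)
      have "P (\<lambda>x. indicator (\<Union>j<i. A j) x + indicator (A i) x)"
        by (intro P_add Suc union.IH ind A) (auto intro: A)
      moreover have "(\<lambda>x. indicator (\<Union>j<i. A j) x + indicator (A i) x) = (indicator (\<Union>j<Suc i. A j) :: real \<Rightarrow> real)"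
      proof
        fix x
        have "x \<notin> A j" if "x \<in> A i" "j < i" for j
          using disjoint_family_onD[OF \<open>disjoint_family A\<close>, of i j] that by auto
        then show "indicator (\<Union>j<i. A j) x + indicator (A i) x = (indicator (\<Union>j<Suc i. A j) x :: real)"
          by (auto simp: indicator_def less_Suc_eq)
      qed
      ultimately show ?case by simp
    qed
    show ?case
    proof (rule P_lim[OF _ _ _ _ fin])
      show "integrable leb01 (indicator (\<Union>j<i. A j) :: real \<Rightarrow> real)" for i
        by (intro ind) (auto intro: A)
      show "(\<lambda>i. indicator (\<Union>j<i. A j) x) \<longlonglongrightarrow> (indicator (\<Union> (range A)) x :: real)" for x
        by (rule LIMSEQ_indicator_UN)
      show "integrable leb01 (\<lambda>_. 1 :: real)" by simp
    qed (auto simp: indicator_def)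
  qed
  define U where "U = restrict_space lborel unit_interval"
  have sets_U: "sets U = sets borel_unit" by (simp add: U_def sets_restrict_space)
  have space_U: "space U = unit_interval" by (simp add: U_def space_restrict_space)
  have int_U: "integrable leb01 g" if "integrable U g" for g :: "real \<Rightarrow> real"
  proof -
    have "integrable lborel (\<lambda>x. indicator unit_interval x *\<^sub>R g x)"
      using that unfolding U_def by (subst (asm) integrable_restrict_space) auto
    then show ?thesis
      by (subst integrable_restrict_space) (auto intro: integrable_completion[THEN iffD2])
  qed
  have P_U: "P g" if "integrable U g" for g
    using that
  proof (induction rule: integrable_induct)
    case (base A c)
    then have "P (\<lambda>x. c * indicator A x)" by (intro P_cmult P_borel) (simp add: sets_U)
    then show ?case by (simp add: mult.commute)
  next
    case (add f g)
    then show ?case by (intro P_add int_U) auto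
  next
    case (lim f s)
    show ?case
      by (rule P_lim[where s = s and h = "\<lambda>x. 2 * \<bar>f x\<bar>"])
         (use lim space_U in \<open>auto intro: int_U\<close>)
  qed
  have "(\<lambda>x. indicator unit_interval x *\<^sub>R \<phi> x) \<in> borel_measurable lebesgue"
    using \<phi> by (auto simp: integrable_restrict_space)
  then obtain h where h: "h \<in> borel_measurable lborel"
    "AE x in lborel. indicator unit_interval x *\<^sub>R \<phi> x = h x"
    using completion_ex_borel_measurable_real by blast
  have ae: "AE x in leb01. \<phi> x = h x"
  proof (subst AE_restrict_space_iff)
    show "AE x in lebesgue. x \<in> unit_interval \<longrightarrow> \<phi> x = h x"
      using AE_completion[OF h(2)] by eventually_elim (auto simp: indicator_def)
  qed auto
  have "integrable leb01 h"
    using \<phi> ae by (rule_tac integrable_cong_AE_imp[OF \<phi>])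
       (use h(1) in \<open>auto intro: borel_measurable_leb01\<close>)
  then have "integrable U h"
    using h(1) unfolding U_def by (subst integrable_restrict_space)
      (auto simp: integrable_restrict_space integrable_completion)
  from P_U[OF this] have "(\<lambda>n. \<integral>x. f n x * h x \<partial>leb01) \<longlonglongrightarrow> 0"
    by (simp add: P_def)
  moreover have "(\<integral>x. f n x * h x \<partial>leb01) = (\<integral>x. f n x * \<phi> x \<partial>leb01)" for n
  proof (rule integral_cong_AE)
    show "AE x in leb01. f n x * h x = f n x * \<phi> x"
      using ae by eventually_elim simp
    show "(\<lambda>x. f n x * h x) \<in> borel_measurable leb01"
      using h(1) by (intro borel_measurable_times meas borel_measurable_leb01) simp
    show "(\<lambda>x. f n x * \<phi> x) \<in> borel_measurable leb01"
      using \<phi> by (intro borel_measurable_times meas) simp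
  qed
  ultimately show ?thesis by simp
qed

text \<open>The constant sequence \<open>f\<close>, paired with \<open>f\<close> itself, gives \<open>\<integral> f\<^sup>2 = 0\<close>.\<close>

lemma AE_zero_if_interval_integrals_zero:
  fixes f :: "real \<Rightarrow> real"
  assumes meas: "f \<in> borel_measurable leb01"
    and bound: "AE x in leb01. \<bar>f x\<bar> \<le> C"
    and intervals: "\<And>a b. \<lbrakk>0 < a; a < b; b < 1\<rbrakk> \<Longrightarrow>
      (\<integral>x. f x * indicator {a<..<b} x \<partial>leb01) = 0"
  shows "AE x in leb01. f x = 0"
proof -
  have int: "integrable leb01 f"
    by (rule integrable_leb01_bounded[OF meas bound])
  have "(\<lambda>n::nat. \<integral>x. f x * f x \<partial>leb01) \<longlonglongrightarrow> 0"
    by (rule weak_null_sequence[OF meas bound _ int]) (simp add: intervals)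
  then have "(\<integral>x. f x * f x \<partial>leb01) = 0"
    using LIMSEQ_unique[OF tendsto_const] by blast
  moreover have "integrable leb01 (\<lambda>x. f x * f x)"
  proof (rule integrable_leb01_bounded)
    show "AE x in leb01. \<bar>f x * f x\<bar> \<le> C * C"
      using bound proof eventually_elim
      case (elim x)
      then show ?case using mult_mono[of "\<bar>f x\<bar>" C "\<bar>f x\<bar>" C] by (simp add: abs_mult)
    qed
  qed (use meas in auto)
  ultimately have "AE x in leb01. f x * f x = 0"
    by (subst (asm) integral_nonneg_eq_0_iff_AE) auto
  then show ?thesis by simp
qed

section \<open>The derivative measure of a function of bounded variation\<close>

lemma test_function_bounded:
  assumes "\<phi> \<in> test_functions"
  obtains B where "\<And>x. \<bar>\<phi> x\<bar> \<le> B"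
proof -
  obtain a b where ab: "0 < a" "a \<le> b" "b < 1" "\<And>x. x \<notin> {a..b} \<Longrightarrow> \<phi> x = 0"
    using assms by (auto simp: test_functions_def)
  have "compact (\<phi> ` {a..b})"
    by (intro compact_continuous_image test_function_continuous_on[OF assms]) auto
  then obtain B where B: "\<And>y. y \<in> \<phi> ` {a..b} \<Longrightarrow> \<bar>y\<bar> \<le> B"
    by (meson compact_imp_bounded bounded_real)
  have "\<bar>\<phi> x\<bar> \<le> \<bar>B\<bar>" for x
    using ab(4)[of x] B[of "\<phi> x"] by (cases "x \<in> {a..b}") (auto intro: order_trans)
  then show ?thesis by (rule that)
qed

lemma test_function_borel: "\<phi> \<in> test_functions \<Longrightarrow> \<phi> \<in> borel_measurable borel"
  by (intro borel_measurable_continuous_onI test_function_continuous_on)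

lemma test_function_combine:
  assumes "\<phi> \<in> test_functions" "\<psi> \<in> test_functions"
  shows "(\<lambda>x. \<phi> x + c * \<psi> x) \<in> test_functions"
proof -
  obtain a b where ab: "0 < a" "a \<le> b" "b < 1" "\<And>x. x \<notin> {a..b} \<Longrightarrow> \<phi> x = 0"
    using assms by (auto simp: test_functions_def)
  obtain a' b' where ab': "0 < a'" "a' \<le> b'" "b' < 1" "\<And>x. x \<notin> {a'..b'} \<Longrightarrow> \<psi> x = 0"
    using assms by (auto simp: test_functions_def)
  have "\<forall>m. times_differentiable m (\<lambda>x. \<phi> x + c * \<psi> x)"
    by (intro allI times_differentiable_add times_differentiable_mult times_differentiable_const
        test_function_times_differentiable assms)
  moreover have "0 < min a a' \<and> min a a' \<le> max b b' \<and> max b b' < 1 \<and>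
      (\<forall>x. x \<notin> {min a a'..max b b'} \<longrightarrow> \<phi> x + c * \<psi> x = 0)"
  proof (intro conjI allI impI)
    fix x assume "x \<notin> {min a a'..max b b'}"
    then have "x \<notin> {a..b}" "x \<notin> {a'..b'}" by auto
    then show "\<phi> x + c * \<psi> x = 0" using ab(4) ab'(4) by simp
  qed (use ab(1-3) ab'(1-3) in auto)
  ultimately show ?thesis
    unfolding test_functions_def smooth_iff by blast
qed

lemma integrable_test_function:
  assumes "\<phi> \<in> test_functions"
  shows "integrable leb01 \<phi>"
proof -
  obtain B where "\<And>x. \<bar>\<phi> x\<bar> \<le> B" using test_function_bounded[OF assms] by blast
  then show ?thesis
    using borel_measurable_leb01[OF test_function_borel[OF assms]]
    by (intro integrable_leb01_bounded) auto
qed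

lemma integral_leb01:
  assumes "integrable leb01 (f :: real \<Rightarrow> real)"
  shows "integral\<^sup>L leb01 f = integral {0..1} f"
  using lebesgue_integral_eq_integral[OF assms] by (simp add: integral_open_interval_real)

definition cumulative :: "real measure \<Rightarrow> real \<Rightarrow> real" where
  "cumulative M x = measure M (unit_interval \<inter> {..x})"

lemma borel_measurable_borel_unit:
  assumes "sets M = sets borel_unit" "h \<in> borel_measurable borel"
  shows "h \<in> borel_measurable M"
proof -
  have "h \<in> borel_measurable borel_unit" using assms(2) by (rule measurable_restrict_space1)
  then show ?thesis using assms(1) by (simp cong: measurable_cong_sets)
qed

lemma space_borel_unit:
  assumes "sets M = sets borel_unit" shows "space M = unit_interval"
  using sets_eq_imp_space_eq[OF assms] by (simp add: space_restrict_space)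

lemma test_function_eq_integral:
  assumes \<phi>: "\<phi> \<in> test_functions" and t: "t \<in> unit_interval"
  shows "(\<integral>x. indicator {t..} x * deriv \<phi> x \<partial>leb01) = - \<phi> t"
proof -
  note \<phi>' = test_function_deriv[OF \<phi>]
  have int: "integrable leb01 (\<lambda>x. indicator {t..} x * deriv \<phi> x)"
  proof (rule Bochner_Integration.integrable_bound[OF integrable_test_function[OF \<phi>']])
    show "(\<lambda>x. indicator {t..} x * deriv \<phi> x) \<in> borel_measurable leb01"
      by (intro borel_measurable_leb01 borel_measurable_times test_function_borel[OF \<phi>']) auto
  qed (auto simp: indicator_def)
  have "(\<integral>x. indicator {t..} x * deriv \<phi> x \<partial>leb01)
      = integral {0..1} (\<lambda>x. indicator {t..} x * deriv \<phi> x)"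
    by (rule integral_leb01[OF int])
  also have "\<dots> = integral {0..1} (\<lambda>x. if x \<in> {t..1} then deriv \<phi> x else 0)"
    by (intro Henstock_Kurzweil_Integration.integral_cong) (auto simp: indicator_def)
  also have "\<dots> = integral {t..1} (deriv \<phi>)"
    using t by (subst integral_restrict_Int) (simp add: Int_absorb1)
  also have "\<dots> = \<phi> 1 - \<phi> t"
    using t by (intro integral_unique test_function_integral_Icc \<phi>) auto
  also have "\<phi> 1 = 0"
    using \<phi> by (auto simp: test_functions_def)
  finally show ?thesis by simp
qed

text \<open>Fubini's theorem for the integrand \<open>\<phi>' x\<close> on the set \<open>t \<le> x\<close>: integration over \<open>x\<close> gives
  \<open>- \<phi> t\<close>, integration over \<open>t\<close> gives the distribution function.\<close>

lemma cumulative_integration_by_parts: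
  assumes M: "finite_measure M" "sets M = sets borel_unit" and \<phi>: "\<phi> \<in> test_functions"
  shows "(\<integral>x. cumulative M x * deriv \<phi> x \<partial>leb01) = - integral\<^sup>L M \<phi>"
proof -
  interpret M: finite_measure M by fact
  interpret L: finite_measure leb01 by (rule finite_measure_leb01)
  interpret LM: pair_sigma_finite leb01 M ..
  interpret LMf: finite_measure "leb01 \<Otimes>\<^sub>M M"
    by (rule finite_measure_pair_measure) unfold_locales
  note \<phi>' = test_function_deriv[OF \<phi>]
  obtain B where B: "\<And>x. \<bar>deriv \<phi> x\<bar> \<le> B" using test_function_bounded[OF \<phi>'] by blast
  have spM: "space M = unit_interval" by (rule space_borel_unit[OF M(2)])
  have [measurable]: "(\<lambda>x. x) \<in> borel_measurable leb01" "deriv \<phi> \<in> borel_measurable leb01"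
    by (intro borel_measurable_leb01 test_function_borel[OF \<phi>']; simp)+
  have [measurable]: "(\<lambda>x. x) \<in> borel_measurable M"
    by (intro borel_measurable_borel_unit[OF M(2)]) simp
  define k where "k = (\<lambda>(x, t). if t \<le> x then deriv \<phi> x else 0 :: real)"
  have [measurable]: "k \<in> borel_measurable (leb01 \<Otimes>\<^sub>M M)"
    unfolding k_def by measurable
  have int: "integrable (leb01 \<Otimes>\<^sub>M M) (\<lambda>(x, t). if t \<le> x then deriv \<phi> x else 0)"
    unfolding k_def[symmetric]
    by (rule LMf.integrable_const_bound[where B = "\<bar>B\<bar>"])
       (use order_trans[OF B abs_ge_self] in \<open>auto simp: k_def\<close>)
  have "integral\<^sup>L M \<phi> = (\<integral>t. - (\<integral>x. (if t \<le> x then deriv \<phi> x else 0) \<partial>leb01) \<partial>M)"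
  proof (rule Bochner_Integration.integral_cong[OF refl])
    fix t assume "t \<in> space M"
    then have "- \<phi> t = (\<integral>x. indicator {t..} x * deriv \<phi> x \<partial>leb01)"
      using test_function_eq_integral[OF \<phi>] spM by simp
    also have "\<dots> = (\<integral>x. (if t \<le> x then deriv \<phi> x else 0) \<partial>leb01)"
      by (intro Bochner_Integration.integral_cong) (auto simp: indicator_def)
    finally show "\<phi> t = - (\<integral>x. (if t \<le> x then deriv \<phi> x else 0) \<partial>leb01)" by simp
  qed
  also have "\<dots> = - (\<integral>x. (\<integral>t. (if t \<le> x then deriv \<phi> x else 0) \<partial>M) \<partial>leb01)"
    using LM.Fubini_integral[OF int] by simp
  also have "(\<integral>x. (\<integral>t. (if t \<le> x then deriv \<phi> x else 0) \<partial>M) \<partial>leb01)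
      = (\<integral>x. cumulative M x * deriv \<phi> x \<partial>leb01)"
  proof (rule Bochner_Integration.integral_cong[OF refl])
    fix x
    have "(\<integral>t. (if t \<le> x then deriv \<phi> x else 0) \<partial>M) = (\<integral>t. indicator {..x} t * deriv \<phi> x \<partial>M)"
      by (intro Bochner_Integration.integral_cong) (auto simp: indicator_def)
    also have "\<dots> = measure M ({..x} \<inter> space M) * deriv \<phi> x"
      by simp
    finally show "(\<integral>t. (if t \<le> x then deriv \<phi> x else 0) \<partial>M) = cumulative M x * deriv \<phi> x"
      by (simp add: cumulative_def spM Int_commute)
  qed
  finally show ?thesis by simp
qed

lemma integral_bump_limit:
  fixes g :: "real \<Rightarrow> real"
  assumes "integrable M g" "\<And>c a b. c > 0 \<Longrightarrow> bump c a b \<in> borel_measurable M"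
    and "{a<..<b} \<inter> space M \<in> sets M"
  shows "(\<lambda>m. \<integral>x. g x * bump (1 / real (Suc m)) a b x \<partial>M) \<longlonglongrightarrow> (\<integral>x. g x * indicator {a<..<b} x \<partial>M)"
proof (rule integral_dominated_convergence[where w = "\<lambda>x. \<bar>g x\<bar>"])
  show "AE x in M. (\<lambda>m. g x * bump (1 / real (Suc m)) a b x) \<longlonglongrightarrow> g x * indicator {a<..<b} x"
    by (intro AE_I2 tendsto_mult tendsto_const bump_tendsto_indicator)
  show "AE x in M. norm (g x * bump (1 / real (Suc m)) a b x) \<le> \<bar>g x\<bar>" for m
    using bump_le_1[of "1 / real (Suc m)" a b]
    by (intro AE_I2) (auto simp: abs_mult intro!: mult_left_le)
  show "(\<lambda>x. g x * indicator {a<..<b} x) \<in> borel_measurable M"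
  proof -
    have "(\<lambda>x. indicator {a<..<b} x :: real) \<in> borel_measurable M"
      using assms(3) by (simp add: borel_measurable_indicator_iff)
    then show ?thesis using assms(1) by auto
  qed
qed (use assms in auto)

lemma bump_borel:
  assumes "c > 0"
  shows "bump c a b \<in> borel_measurable borel"
  by (intro borel_measurable_continuous_onI continuous_at_imp_continuous_on ballI)
     (rule DERIV_isCont[OF times_differentiable_has_derivative[OF times_differentiable_bump[OF assms, of 0]]])

text \<open>Bumps show that the two signed measures agree on inner intervals. A \<open>\<pi>\<close>-\<open>\<lambda>\<close> argument for their
  difference extends this to all Borel sets; it has to start with the whole interval, since the
  difference is not a positive measure and complements need the total mass.\<close>

lemma derivative_measure_unique:
  assumes "has_derivative_measure u \<nu>" "has_derivative_measure u \<nu>'" and B: "B \<in> sets borel_unit"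
  shows "\<nu> B = \<nu>' B"
proof -
  from assms(1) obtain M N where MN: "finite_measure M" "finite_measure N" "sets M = sets borel_unit" "sets N = sets borel_unit"
    "\<And>B. B \<in> sets borel_unit \<Longrightarrow> \<nu> B = measure M B - measure N B"
    "\<And>\<phi>. \<phi> \<in> test_functions \<Longrightarrow> (\<integral>x. u x * deriv \<phi> x \<partial>leb01) = - (integral\<^sup>L M \<phi> - integral\<^sup>L N \<phi>)"
    unfolding has_derivative_measure_def by blast
  from assms(2) obtain M' N' where MN': "finite_measure M'" "finite_measure N'" "sets M' = sets borel_unit" "sets N' = sets borel_unit"
    "\<And>B. B \<in> sets borel_unit \<Longrightarrow> \<nu>' B = measure M' B - measure N' B"
    "\<And>\<phi>. \<phi> \<in> test_functions \<Longrightarrow> (\<integral>x. u x * deriv \<phi> x \<partial>leb01) = - (integral\<^sup>L M' \<phi> - integral\<^sup>L N' \<phi>)"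
    unfolding has_derivative_measure_def by blast
  have lim: "(\<lambda>m. integral\<^sup>L K (bump (1 / real (Suc m)) a b)) \<longlonglongrightarrow> measure K {a<..<b}"
    if K: "finite_measure K" "sets K = sets borel_unit" and ab: "0 < a" "b < 1" for K a b
  proof -
    interpret K: finite_measure K by fact
    have s: "{a<..<b} \<in> sets K" using K(2) ab by (auto simp: sets_borel_unit_iff)
    then have "{a<..<b} \<inter> space K \<in> sets K" by auto
    then have "(\<lambda>m. \<integral>x. 1 * bump (1 / real (Suc m)) a b x \<partial>K) \<longlonglongrightarrow> (\<integral>x. 1 * indicator {a<..<b} x \<partial>K)"
      by (intro integral_bump_limit borel_measurable_borel_unit[OF K(2)] bump_borel) auto
    moreover have "(\<integral>x. indicator {a<..<b} x \<partial>K) = measure K {a<..<b}"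
      using s sets.sets_into_space[OF s] by (simp add: Int_absorb2)
    ultimately show ?thesis by simp
  qed
  define D where "D B = measure M B - measure N B - (measure M' B - measure N' B)" for B
  have D_inner: "D A = 0" if inner: "A \<in> inner_intervals" for A
  proof -
    obtain a b where A: "A = {a<..<b}" "0 < a" "b < 1"
      using inner by (auto simp: inner_intervals_def)
    show ?thesis
    proof (cases "a < b")
      case True
      have "(\<lambda>m. integral\<^sup>L M (bump (1 / real (Suc m)) a b) - integral\<^sup>L N (bump (1 / real (Suc m)) a b)
          - (integral\<^sup>L M' (bump (1 / real (Suc m)) a b) - integral\<^sup>L N' (bump (1 / real (Suc m)) a b)))
          \<longlonglongrightarrow> D A"
        unfolding D_def A(1) by (intro tendsto_diff lim MN MN' A)
      moreover have "integral\<^sup>L M (bump (1 / real (Suc m)) a b) - integral\<^sup>L N (bump (1 / real (Suc m)) a b)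
          - (integral\<^sup>L M' (bump (1 / real (Suc m)) a b) - integral\<^sup>L N' (bump (1 / real (Suc m)) a b)) = 0" for m
      proof -
        have t: "bump (1 / real (Suc m)) a b \<in> test_functions"
          using A True by (intro bump_test_function) auto
        show ?thesis using MN(6)[OF t] MN'(6)[OF t] by linarith
      qed
      ultimately show ?thesis by (simp only: LIMSEQ_const_iff)
    qed (simp add: D_def A)
  qed
  have sets: "sets K = sets borel_unit" if "K \<in> {M, N, M', N'}" for K using that MN MN' by auto
  have D_unit: "D unit_interval = 0"
  proof -
    have "(\<lambda>i. measure K (inner_interval i)) \<longlonglongrightarrow> measure K unit_interval"
      if "finite_measure K" "sets K = sets borel_unit" for K
    proof -
      have "range inner_interval \<subseteq> sets K" using inner_interval that(2) unfolding sets_borel_unit by auto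
      then show ?thesis
        using finite_measure.finite_Lim_measure_incseq[OF that(1) _ incseq_inner_interval]
        by (simp add: UN_inner_interval)
    qed
    then have "(\<lambda>i. D (inner_interval i)) \<longlonglongrightarrow> D unit_interval"
      unfolding D_def by (intro tendsto_diff) (use MN MN' in auto)
    then show ?thesis by (simp only: D_inner[OF inner_interval] LIMSEQ_const_iff)
  qed
  have "D B = 0"
    using Int_stable_inner_intervals inner_intervals_subset B[unfolded sets_borel_unit]
  proof (induction rule: sigma_sets_induct_disjoint)
    case (basic A)
    then show ?case by (rule D_inner)
  next
    case empty
    then show ?case by (simp add: D_def)
  next
    case (compl A)
    have "measure K (unit_interval - A) = measure K unit_interval - measure K A"
      if "finite_measure K" "sets K = sets borel_unit" for K
      using finite_measure.finite_measure_compl[OF that(1), of A] compl(1) that(2) space_borel_unit[OF that(2)]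
      by (simp add: sets_borel_unit)
    then show ?case
      using D_unit compl(2) MN(1-4) MN'(1-4) by (simp add: D_def)
  next
    case (union A)
    have "(\<lambda>i. measure K (A i)) sums measure K (\<Union>i. A i)"
      if "finite_measure K" "sets K = sets borel_unit" for K
      using union that by (intro finite_measure.finite_measure_UNION) (auto simp: sets_borel_unit)
    then have "(\<lambda>i. D (A i)) sums D (\<Union>i. A i)"
      unfolding D_def by (intro sums_diff) (use MN MN' in auto)
    then show ?case using sums_unique2[OF _ sums_zero] by (simp only: union.IH)
  qed
  then show ?thesis using MN(5)[OF B] MN'(5)[OF B] by (simp add: D_def)
qed

lemma total_variation_le:
  assumes "finite_measure M" "finite_measure N" "sets M = sets borel_unit" "sets N = sets borel_unit"
    and "\<And>B. B \<in> sets borel_unit \<Longrightarrow> \<nu> B = measure M B - measure N B"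
  shows "total_variation \<nu> unit_interval \<le> emeasure M unit_interval + emeasure N unit_interval"
  unfolding total_variation_def
proof (rule SUP_least)
  interpret M: finite_measure M by fact
  interpret N: finite_measure N by fact
  fix P :: "nat \<Rightarrow> real set"
  assume "P \<in> {P. range P \<subseteq> sets borel_unit \<and> disjoint_family P \<and> (\<Union>n. P n) = unit_interval}"
  then have P: "\<And>n. P n \<in> sets borel_unit" "disjoint_family P" "(\<Union>n. P n) = unit_interval" by auto
  have "(\<Sum>n. ennreal \<bar>\<nu> (P n)\<bar>) \<le> (\<Sum>n. emeasure M (P n) + emeasure N (P n))"
  proof (rule suminf_le)
    fix n
    have "\<bar>\<nu> (P n)\<bar> \<le> measure M (P n) + measure N (P n)"
      using assms(5)[OF P(1)] by (simp add: abs_le_iff add_increasing add_increasing2)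
    then have "ennreal \<bar>\<nu> (P n)\<bar> \<le> ennreal (measure M (P n) + measure N (P n))"
      by (rule ennreal_leI)
    then show "ennreal \<bar>\<nu> (P n)\<bar> \<le> emeasure M (P n) + emeasure N (P n)"
      by (simp add: M.emeasure_eq_measure N.emeasure_eq_measure)
  qed auto
  also have "\<dots> = (\<Sum>n. emeasure M (P n)) + (\<Sum>n. emeasure N (P n))"
    by (rule suminf_add[symmetric]) auto
  also have "\<dots> = emeasure M unit_interval + emeasure N unit_interval"
    using P assms by (simp add: suminf_emeasure image_subset_iff)
  finally show "(\<Sum>n. ennreal \<bar>\<nu> (P n)\<bar>) \<le> emeasure M unit_interval + emeasure N unit_interval" .
qed

lemma total_variation_cong:
  assumes "\<And>B. B \<in> sets borel_unit \<Longrightarrow> \<nu> B = \<nu>' B"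
  shows "total_variation \<nu> A = total_variation \<nu>' A"
  unfolding total_variation_def
  by (intro SUP_cong refl arg_cong[where f = suminf] ext) (use assms in \<open>auto simp: image_subset_iff\<close>)

text \<open>The half-open intervals between consecutive points, together with the rest of the unit interval,
  are one of the partitions over which the supremum is taken.\<close>

lemma sum_le_total_variation:
  assumes x: "\<And>k. k \<le> m \<Longrightarrow> x k \<in> unit_interval" and mono: "\<And>j k. j \<le> k \<Longrightarrow> k \<le> m \<Longrightarrow> x j \<le> x k"
  shows "ennreal (\<Sum>k<m. \<bar>\<nu> {x k<..x (Suc k)}\<bar>) \<le> total_variation \<nu> unit_interval"
proof -
  define P where "P n = (if n < m then {x n<..x (Suc n)} else if n = m then {0<..x 0} \<union> {x m<..<1} else {})" for n
  have P_sets: "P n \<in> sets borel_unit" for n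
    using x[of 0] x[of m] x[of n] x[of "Suc n"] by (auto simp: P_def sets_borel_unit_iff)
  have P_disj: "disjoint_family P"
  unfolding disjoint_family_on_def
  proof (intro ballI impI)
    have "P i \<inter> P j = {}" if "i < j" for i j
    proof -
      consider "j < m" | "j = m" | "j > m" by linarith
      then show ?thesis
      proof cases
        case 1
        then have "x (Suc i) \<le> x j" using that by (intro mono) auto
        then show ?thesis using 1 that by (auto simp: P_def)
      next
        case 2
        then have "x 0 \<le> x i" "x (Suc i) \<le> x m" using that by (auto intro!: mono)
        then show ?thesis using 2 that by (auto simp: P_def)
      qed (auto simp: P_def)
    qed
    then show "P i \<inter> P j = {}" if "i \<noteq> j" for i j
      using that by (metis inf_commute linorder_neqE_nat)
  qed
  have cover: "t \<in> (\<Union>n. P n)" if "x 0 < t" "t \<le> x m" for t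
  proof -
    define k where "k = (LEAST k. t \<le> x k)"
    have k: "t \<le> x k" unfolding k_def by (rule LeastI[of _ m]) (rule that)
    have km: "k \<le> m" unfolding k_def by (rule Least_le) (rule that)
    have "k \<noteq> 0" using k that(1) by (intro notI) simp
    then obtain j where j: "k = Suc j" using not0_implies_Suc by blast
    have "\<not> t \<le> x j" using j not_less_Least[of j "\<lambda>k. t \<le> x k"] k_def by auto
    then have "t \<in> P j" using k km j by (auto simp: P_def)
    then show ?thesis by blast
  qed
  have "(\<Union>n. P n) = unit_interval"
  proof (intro set_eqI iffI)
    fix t assume "t \<in> (\<Union>n. P n)"
    then obtain n where "t \<in> P n" by blast
    moreover have "P n \<subseteq> unit_interval" using P_sets[of n] by (simp add: sets_borel_unit_iff)
    ultimately show "t \<in> unit_interval" by blast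
  next
    fix t :: real assume t: "t \<in> unit_interval"
    have "t \<in> P m" if "t \<le> x 0 \<or> x m < t" using t that by (auto simp: P_def)
    then show "t \<in> (\<Union>n. P n)" using cover[of t] by fastforce
  qed
  then have "P \<in> {P. range P \<subseteq> sets borel_unit \<and> disjoint_family P \<and> (\<Union>n. P n) = unit_interval}"
    using P_sets P_disj by auto
  then have "(\<Sum>n. ennreal \<bar>\<nu> (P n)\<bar>) \<le> total_variation \<nu> unit_interval"
    unfolding total_variation_def by (rule SUP_upper)
  moreover have "ennreal (\<Sum>k<m. \<bar>\<nu> {x k<..x (Suc k)}\<bar>) = (\<Sum>k<m. ennreal \<bar>\<nu> (P k)\<bar>)"
    by (subst sum_ennreal[symmetric]) (auto simp: P_def)
  moreover have "(\<Sum>k<m. ennreal \<bar>\<nu> (P k)\<bar>) \<le> (\<Sum>n. ennreal \<bar>\<nu> (P n)\<bar>)"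
    by (rule sum_le_suminf) auto
  ultimately show ?thesis by simp
qed

lemma cumulative_mono:
  assumes "finite_measure M" "sets M = sets borel_unit" "x \<le> y"
  shows "cumulative M x \<le> cumulative M y"
  unfolding cumulative_def using assms
  by (intro finite_measure.finite_measure_mono) (auto simp: sets_borel_unit_iff)

lemma cumulative_bounds:
  assumes "finite_measure M" "sets M = sets borel_unit"
  shows "0 \<le> cumulative M x" "cumulative M x \<le> measure M unit_interval"
proof -
  show "0 \<le> cumulative M x" by (simp add: cumulative_def)
  show "cumulative M x \<le> measure M unit_interval"
    unfolding cumulative_def using assms(2)
    by (intro finite_measure.finite_measure_mono[OF assms(1)]) (auto simp: sets_borel_unit_iff)
qed

lemma cumulative_diff:
  assumes "finite_measure M" "sets M = sets borel_unit" "x \<le> y" "0 < x" "y < 1"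
  shows "measure M {x<..y} = cumulative M y - cumulative M x"
proof -
  have "{x<..y} = (unit_interval \<inter> {..y}) - (unit_interval \<inter> {..x})" using assms by auto
  moreover have "unit_interval \<inter> {..x} \<subseteq> unit_interval \<inter> {..y}" using assms by auto
  ultimately show ?thesis
    unfolding cumulative_def using finite_measure.finite_measure_Diff[OF assms(1)] assms(2)
    by (simp add: sets_borel_unit_iff)
qed

lemma cumulative_borel:
  assumes "finite_measure M" "sets M = sets borel_unit"
  shows "cumulative M \<in> borel_measurable borel"
  by (rule borel_measurable_mono) (auto intro!: monoI cumulative_mono assms)

lemma integrable_cumulative_mult:
  assumes M: "finite_measure M" "sets M = sets borel_unit" and \<phi>: "\<phi> \<in> test_functions"
  shows "integrable leb01 (\<lambda>x. cumulative M x * \<phi> x)"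
proof (rule integrable_bounded_mult[OF _ _ integrable_test_function[OF \<phi>]])
  show "cumulative M \<in> borel_measurable leb01"
    by (intro borel_measurable_leb01 cumulative_borel M)
  show "AE x in leb01. \<bar>cumulative M x\<bar> \<le> measure M unit_interval"
    using cumulative_bounds[OF M] by simp
qed

text \<open>The lemma of du Bois-Reymond. The difference \<open>f\<close> of the two sides, without the constant,
  annihilates all derivatives of test functions. These are the test functions of mean zero, so \<open>f\<close>
  acts on every test function as a constant \<open>c\<close> does, and bumps carry this over to intervals.\<close>

lemma has_derivative_measure_representation:
  assumes u: "u \<in> borel_measurable leb01" "AE x in leb01. \<bar>u x\<bar> \<le> C"
    and MN: "finite_measure M" "finite_measure N" "sets M = sets borel_unit" "sets N = sets borel_unit"
    and parts: "\<And>\<phi>. \<phi> \<in> test_functions \<Longrightarrow>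
      (\<integral>x. u x * deriv \<phi> x \<partial>leb01) = - (integral\<^sup>L M \<phi> - integral\<^sup>L N \<phi>)"
  obtains c where "AE x in leb01. u x = c + cumulative M x - cumulative N x"
proof -
  define f where "f x = u x - (cumulative M x - cumulative N x)" for x
  have cum_meas: "cumulative M \<in> borel_measurable leb01" "cumulative N \<in> borel_measurable leb01"
    by (intro borel_measurable_leb01 cumulative_borel MN)+
  have f_meas: "f \<in> borel_measurable leb01"
    unfolding f_def using u(1) cum_meas by auto
  define K where "K = C + measure M unit_interval + measure N unit_interval"
  have f_bound: "AE x in leb01. \<bar>f x\<bar> \<le> K"
    using u(2)
  proof eventually_elim
    case (elim x)
    then show ?case
      using cumulative_bounds[OF MN(1,3), of x] cumulative_bounds[OF MN(2,4), of x]
      unfolding f_def K_def abs_le_iff by linarith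
  qed
  note prod_int = integrable_bounded_mult[OF _ _ integrable_test_function]
  have f_zero: "(\<integral>x. f x * deriv \<phi> x \<partial>leb01) = 0" if \<phi>: "\<phi> \<in> test_functions" for \<phi>
  proof -
    note \<phi>' = test_function_deriv[OF \<phi>]
    have "(\<integral>x. f x * deriv \<phi> x \<partial>leb01) = (\<integral>x. u x * deriv \<phi> x \<partial>leb01)
        - ((\<integral>x. cumulative M x * deriv \<phi> x \<partial>leb01) - (\<integral>x. cumulative N x * deriv \<phi> x \<partial>leb01))"
      using prod_int[OF u \<phi>'] integrable_cumulative_mult[OF MN(1,3) \<phi>'] integrable_cumulative_mult[OF MN(2,4) \<phi>']
      by (simp add: f_def left_diff_distrib)
    then show ?thesis
      by (simp add: parts[OF \<phi>] cumulative_integration_by_parts[OF MN(1,3) \<phi>]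
          cumulative_integration_by_parts[OF MN(2,4) \<phi>])
  qed
  obtain \<eta> where \<eta>: "\<eta> \<in> test_functions" "integral\<^sup>L leb01 \<eta> \<noteq> 0"
  proof -
    interpret L: finite_measure leb01 by (rule finite_measure_leb01)
    have s: "{1/4<..<3/4 :: real} \<in> sets leb01"
      by (intro sets_borel_unit_subset) (auto simp: sets_borel_unit_iff)
    have "(\<lambda>m. \<integral>x. 1 * bump (1 / real (Suc m)) (1/4) (3/4) x \<partial>leb01)
        \<longlonglongrightarrow> (\<integral>x. 1 * indicator {1/4<..<3/4} x \<partial>leb01)"
      using s by (intro integral_bump_limit borel_measurable_leb01 bump_borel) auto
    moreover have "(\<integral>x. 1 * indicator {1/4<..<3/4} x \<partial>leb01) = (1/2 :: real)"
    proof -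
      have "measure leb01 {1/4<..<3/4} = (1/2 :: real)"
        by (subst measure_restrict_space) auto
      moreover have "{1/4<..<3/4} \<inter> unit_interval = {1/4<..<3/4 :: real}" by auto
      ultimately show ?thesis by simp
    qed
    ultimately have "(\<lambda>m. \<integral>x. 1 * bump (1 / real (Suc m)) (1/4) (3/4) x \<partial>leb01) \<longlonglongrightarrow> 1/2"
      by (simp only:)
    then have "eventually (\<lambda>m. 0 < (\<integral>x. 1 * bump (1 / real (Suc m)) (1/4) (3/4) x \<partial>leb01)) sequentially"
      by (rule order_tendstoD) simp
    then obtain m where "0 < (\<integral>x. bump (1 / real (Suc m)) (1/4) (3/4) x \<partial>leb01)"
      by (auto simp: eventually_sequentially)
    moreover have "bump (1 / real (Suc m)) (1/4) (3/4) \<in> test_functions"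
      by (rule bump_test_function) auto
    ultimately show ?thesis using that by fastforce
  qed
  \<comment> \<open>Subtracting a multiple of \<open>\<eta>\<close> makes any test function one of mean zero.\<close>
  define c where "c = (\<integral>x. f x * \<eta> x \<partial>leb01) / integral\<^sup>L leb01 \<eta>"
  have mean: "(\<integral>x. (f x - c) * \<psi> x \<partial>leb01) = 0" if \<psi>: "\<psi> \<in> test_functions" for \<psi>
  proof -
    define s where "s = - (integral\<^sup>L leb01 \<psi> / integral\<^sup>L leb01 \<eta>)"
    have t: "(\<lambda>x. \<psi> x + s * \<eta> x) \<in> test_functions" by (rule test_function_combine[OF \<psi> \<eta>(1)])
    have "integral {0..1} (\<lambda>x. \<psi> x + s * \<eta> x) = (\<integral>x. \<psi> x + s * \<eta> x \<partial>leb01)"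
      by (rule integral_leb01[symmetric, OF integrable_test_function[OF t]])
    also have "\<dots> = 0"
      using integrable_test_function[OF \<psi>] integrable_test_function[OF \<eta>(1)] \<eta>(2) by (simp add: s_def)
    finally obtain \<phi> where \<phi>: "\<phi> \<in> test_functions" "deriv \<phi> = (\<lambda>x. \<psi> x + s * \<eta> x)"
      using mean_zero_test_function_primitive[OF t] by blast
    have "0 = (\<integral>x. f x * (\<psi> x + s * \<eta> x) \<partial>leb01)"
      using f_zero[OF \<phi>(1)] \<phi>(2) by simp
    also have "\<dots> = (\<integral>x. f x * \<psi> x + s * (f x * \<eta> x) \<partial>leb01)"
      by (simp add: algebra_simps)
    also have "\<dots> = (\<integral>x. f x * \<psi> x \<partial>leb01) + s * (\<integral>x. f x * \<eta> x \<partial>leb01)"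
      using prod_int[OF f_meas f_bound \<psi>] prod_int[OF f_meas f_bound \<eta>(1)] by simp
    finally have "(\<integral>x. f x * \<psi> x \<partial>leb01) = c * integral\<^sup>L leb01 \<psi>"
      by (simp add: s_def c_def)
    then show ?thesis
      using prod_int[OF f_meas f_bound \<psi>] integrable_test_function[OF \<psi>] by (simp add: left_diff_distrib)
  qed
  have g_bound: "AE x in leb01. \<bar>f x - c\<bar> \<le> K + \<bar>c\<bar>"
    using f_bound by eventually_elim auto
  have g_meas: "(\<lambda>x. f x - c) \<in> borel_measurable leb01" using f_meas by simp
  have "AE x in leb01. f x - c = 0"
  proof (rule AE_zero_if_interval_integrals_zero[OF g_meas g_bound])
    fix a b :: real assume ab: "0 < a" "a < b" "b < 1"
    have "(\<lambda>m. \<integral>x. (f x - c) * bump (1 / real (Suc m)) a b x \<partial>leb01)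
        \<longlonglongrightarrow> (\<integral>x. (f x - c) * indicator {a<..<b} x \<partial>leb01)"
      using ab by (intro integral_bump_limit integrable_leb01_bounded[OF g_meas g_bound]
          borel_measurable_leb01 bump_borel) (auto intro!: sets_borel_unit_subset simp: sets_borel_unit_iff)
    moreover have "(\<integral>x. (f x - c) * bump (1 / real (Suc m)) a b x \<partial>leb01) = 0" for m
      using ab by (intro mean bump_test_function) auto
    ultimately show "(\<integral>x. (f x - c) * indicator {a<..<b} x \<partial>leb01) = 0"
      by (simp only: LIMSEQ_const_iff)
  qed
  then have "AE x in leb01. u x = c + cumulative M x - cumulative N x"
    by eventually_elim (simp add: f_def)
  then show ?thesis by (rule that)
qed

section \<open>The discrete energy in terms of the sequence of values\<close>

text \<open>Positions are counted from 0, so that position \<open>k * n + j\<close> is column \<open>j\<close> of row \<open>k\<close>.\<close>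

definition jumps :: "nat \<Rightarrow> nat \<Rightarrow> (nat \<Rightarrow> real) \<Rightarrow> real" where
  "jumps p N z = (\<Sum>i<N - p. \<bar>z (i + p) - z i\<bar>)"

definition lattice_energy :: "nat \<Rightarrow> (nat \<Rightarrow> real) \<Rightarrow> real" where
  "lattice_energy n z = (jumps 1 (n^2) z + jumps n (n^2) z) / real n"

text \<open>The cells are closed on the left here and on the right for grid functions; the functions differ
  only at the grid points, where a right continuous choice is more convenient.\<close>

definition step :: "nat \<Rightarrow> (nat \<Rightarrow> real) \<Rightarrow> real \<Rightarrow> real" where
  "step N z x = z (nat \<lfloor>real N * x\<rfloor>)"

lemma jumps_nonneg: "0 \<le> jumps p N z"
  by (simp add: jumps_def sum_nonneg)

lemma edges_eq:
  assumes "n \<ge> 1"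
  shows "edges n = (\<lambda>i. {i, i + 1}) ` {1..n^2 - 1} \<union> (\<lambda>i. {i, i + n}) ` {1..n^2 - n}"
proof (intro set_eqI iffI)
  fix e assume "e \<in> edges n"
  then obtain i j where ij: "e = {i, j}" "i \<in> {1..n^2}" "j \<in> {1..n^2}"
    "\<bar>int i - int j\<bar> = 1 \<or> \<bar>int i - int j\<bar> = int n"
    by (auto simp: edges_def)
  then consider "j = i + 1" | "i = j + 1" | "j = i + n" | "i = j + n" by linarith
  then show "e \<in> (\<lambda>i. {i, i + 1}) ` {1..n^2 - 1} \<union> (\<lambda>i. {i, i + n}) ` {1..n^2 - n}"
  proof cases
    case 1
    then have "e = {i, i + 1}" "i \<in> {1..n^2 - 1}" using ij by auto
    then show ?thesis by blast
  next
    case 2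
    then have "e = {j, j + 1}" "j \<in> {1..n^2 - 1}" using ij by auto
    then show ?thesis by blast
  next
    case 3
    then have "e = {i, i + n}" "i \<in> {1..n^2 - n}" using ij by auto
    then show ?thesis by blast
  next
    case 4
    then have "e = {j, j + n}" "j \<in> {1..n^2 - n}" using ij by auto
    then show ?thesis by blast
  qed
next
  fix e assume "e \<in> (\<lambda>i. {i, i + 1}) ` {1..n^2 - 1} \<union> (\<lambda>i. {i, i + n}) ` {1..n^2 - n}"
  then consider i where "e = {i, i + 1}" "i \<in> {1..n^2 - 1}" | i where "e = {i, i + n}" "i \<in> {1..n^2 - n}"
    by auto
  then show "e \<in> edges n"
  proof cases
    case 1
    then show ?thesis unfolding edges_def by (intro CollectI exI[of _ i] exI[of _ "i + 1"]) auto
  next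
    case 2
    then show ?thesis unfolding edges_def by (intro CollectI exI[of _ i] exI[of _ "i + n"]) auto
  qed
qed

lemma sum_pairs_eq_jumps:
  fixes z :: "nat \<Rightarrow> real"
  assumes z: "\<And>i. z i \<in> {0, 1}" and p: "p \<ge> 1"
    and uz: "\<And>i. 1 \<le> i \<Longrightarrow> i \<le> N \<Longrightarrow> U i = z (i - 1)"
  shows "(\<Sum>e\<in>(\<lambda>i. {i, i + p}) ` {1..N - p}. (U (Min e) - U (Max e))\<^sup>2) = jumps p N z"
proof -
  have inj: "inj_on (\<lambda>i. {i, i + p}) {1..N - p}"
  proof (rule inj_onI)
    fix i j :: nat assume "{i, i + p} = {j, j + p}"
    then have "Min {i, i + p} = Min {j, j + p}" by simp
    then show "i = j" by simp
  qed
  have "(\<Sum>e\<in>(\<lambda>i. {i, i + p}) ` {1..N - p}. (U (Min e) - U (Max e))\<^sup>2)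
      = (\<Sum>i\<in>{1..N - p}. (U i - U (i + p))\<^sup>2)"
    by (subst sum.reindex[OF inj]) simp
  also have "\<dots> = (\<Sum>i\<in>{1..N - p}. \<bar>z (i - 1 + p) - z (i - 1)\<bar>)"
  proof (rule sum.cong[OF refl])
    fix i assume i: "i \<in> {1..N - p}"
    then have "U i = z (i - 1)" by (intro uz) auto
    moreover have "U (i + p) = z (i + p - 1)" using i by (intro uz) auto
    moreover have "i + p - 1 = i - 1 + p" using i by simp
    ultimately have "U i = z (i - 1)" "U (i + p) = z (i - 1 + p)" by (simp_all only:)
    then show "(U i - U (i + p))\<^sup>2 = \<bar>z (i - 1 + p) - z (i - 1)\<bar>"
      using z[of "i - 1"] z[of "i - 1 + p"] by auto
  qed
  also have "\<dots> = jumps p N z"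
    unfolding jumps_def
    by (rule sum.reindex_bij_witness[where i = Suc and j = "\<lambda>i. i - 1"]) auto
  finally show ?thesis .
qed

lemma grid_energy_eq:
  assumes n: "n \<ge> 2" and z: "\<And>i. z i \<in> {0, 1}"
    and uz: "\<And>i. i < n^2 \<Longrightarrow> u (real (Suc i) / real (n^2)) = z i"
  shows "grid_energy n u = lattice_energy n z"
proof -
  define U where "U i = u (real i / real (n^2))" for i
  have U: "U i = z (i - 1)" if "1 \<le> i" "i \<le> n^2" for i
    using uz[of "i - 1"] that by (auto simp: U_def)
  have disj: "(\<lambda>i. {i, i + 1}) ` {1..n^2 - 1} \<inter> (\<lambda>i. {i, i + n}) ` {1..n^2 - n} = {}"
  proof (rule ccontr)
    assume "\<not> ?thesis"
    then obtain i j where e: "{i, i + 1} = {j, j + n}" by auto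
    have "Min {i, i + 1} = i" "Max {i, i + 1} = i + 1" "Min {j, j + n} = j" "Max {j, j + n} = j + n"
      by auto
    then have "i = j" "i + 1 = j + n" unfolding e by auto
    then show False using n by auto
  qed
  have "grid_energy n u = 1 / real n * (\<Sum>e\<in>edges n. (U (Min e) - U (Max e))\<^sup>2)"
    by (simp add: grid_energy_def U_def)
  also have "(\<Sum>e\<in>edges n. (U (Min e) - U (Max e))\<^sup>2) = jumps 1 (n^2) z + jumps n (n^2) z"
  proof -
    have "1 \<le> n" using n by simp
    then have "(\<Sum>e\<in>edges n. (U (Min e) - U (Max e))\<^sup>2)
        = (\<Sum>e\<in>(\<lambda>i. {i, i + 1}) ` {1..n^2 - 1}. (U (Min e) - U (Max e))\<^sup>2)
          + (\<Sum>e\<in>(\<lambda>i. {i, i + n}) ` {1..n^2 - n}. (U (Min e) - U (Max e))\<^sup>2)"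
      using disj by (subst edges_eq) (simp_all only: sum.union_disjoint finite_imageI finite_atLeastAtMost)
    also have "\<dots> = jumps 1 (n^2) z + jumps n (n^2) z"
      using \<open>1 \<le> n\<close> U by (intro arg_cong2[where f = "(+)"] sum_pairs_eq_jumps z) auto
    finally show ?thesis .
  qed
  finally show ?thesis by (simp add: lattice_energy_def)
qed

lemma step_eq:
  assumes "N > 0" "real i \<le> real N * x" "real N * x < real i + 1"
  shows "step N z x = z i"
proof -
  have "\<lfloor>real N * x\<rfloor> = int i" using assms by (intro floor_unique) auto
  then show ?thesis by (simp add: step_def)
qed

lemma step_borel: "step N z \<in> borel_measurable borel"
  unfolding step_def by measurable

lemma AE_not_in_countable:
  assumes "countable D"
  shows "AE x in leb01. x \<notin> D"
proof -
  have "D \<in> null_sets lebesgue"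
    using assms by (intro countable_imp_null_set_lborel[THEN null_sets_completionI])
  then have "AE x in lebesgue. x \<notin> D" by (rule AE_not_in)
  then show ?thesis by (subst AE_restrict_space_iff) auto
qed

lemma AE_not_grid_point: "AE x in leb01. x \<notin> range (\<lambda>i::nat. real i / real N)"
  by (intro AE_not_in_countable) simp

text \<open>Away from the grid points, both conventions for the cells agree.\<close>

lemma inner_point_cell:
  assumes N: "N > 0" and x: "x \<in> unit_interval" and ng: "x \<notin> range (\<lambda>i::nat. real i / real N)"
  obtains i where "i < N" "real i < real N * x" "real N * x < real i + 1"
proof -
  define i where "i = nat \<lfloor>real N * x\<rfloor>"
  have "0 \<le> real N * x" using x by auto
  then have i: "real i \<le> real N * x" "real N * x < real i + 1" by (auto simp: i_def)
  have "real i \<noteq> real N * x"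
  proof
    assume "real i = real N * x"
    then have "x = real i / real N" using N by (simp add: field_simps)
    then show False using ng by blast
  qed
  moreover have "real N * x < real N" using x N by auto
  ultimately have "i < N" "real i < real N * x" using i by auto
  then show ?thesis using i that by blast
qed

abbreviation grid_cell :: "nat \<Rightarrow> nat \<Rightarrow> real set" where
  "grid_cell n i \<equiv> {(real (Suc i) - 1) / real (n^2) <.. real (Suc i) / real (n^2)}"

lemma grid_function_constant_on_cell:
  assumes "v \<in> grid_functions n" "i < n^2"
  shows "v constant_on grid_cell n i"
proof -
  have "\<forall>i\<in>{1..n^2}. v constant_on {(real i - 1) / real (n^2) <.. real i / real (n^2)}"
    using assms(1) unfolding grid_functions_def by blast
  moreover have "Suc i \<in> {1..n^2}" using assms(2) by auto
  ultimately show ?thesis by (rule bspec)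
qed

lemma grid_function_AE_eq_step:
  assumes n: "n > 0" and v: "v \<in> grid_functions n"
    and z: "\<And>i. i < n^2 \<Longrightarrow> z i = v (real (Suc i) / real (n^2))"
  shows "AE x in leb01. v x = step (n^2) z x"
proof -
  have "AE x in leb01. x \<in> unit_interval" by (rule AE_I2) simp
  then show ?thesis using AE_not_grid_point[of "n^2"]
  proof eventually_elim
    case (elim x)
    have N: "n^2 > 0" using n by simp
    obtain i where i: "i < n^2" "real i < real (n^2) * x" "real (n^2) * x < real i + 1"
      using inner_point_cell[OF N elim] by blast
    have "v constant_on grid_cell n i"
      by (rule grid_function_constant_on_cell[OF v i(1)])
    moreover have "x \<in> grid_cell n i"
      "real (Suc i) / real (n^2) \<in> grid_cell n i"
      using i n by (auto simp: field_simps)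
    ultimately have "v x = v (real (Suc i) / real (n^2))" by (auto simp: constant_on_def)
    also have "\<dots> = step (n^2) z x"
      using step_eq[OF N _ i(3), of z] i z by simp
    finally show ?case .
  qed
qed

definition grid_function_of :: "nat \<Rightarrow> (nat \<Rightarrow> real) \<Rightarrow> real \<Rightarrow> real" where
  "grid_function_of n z x = z (nat (\<lceil>real (n^2) * x\<rceil> - 1))"

lemma grid_function_of_eq:
  assumes "n > 0" "x \<in> {(real i - 1) / real (n^2) <.. real i / real (n^2)}" "i \<ge> 1"
  shows "grid_function_of n z x = z (i - 1)"
proof -
  have "real i - 1 < real (n^2) * x" "real (n^2) * x \<le> real i"
    using assms by (auto simp: field_simps)
  then have "\<lceil>real (n^2) * x\<rceil> = int i" by (intro ceiling_unique) auto
  then show ?thesis using assms(3) by (simp add: grid_function_of_def nat_diff_distrib)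
qed

lemma grid_function_of_in_grid:
  assumes "n > 0" "\<And>i. z i \<in> {0, 1}"
  shows "grid_function_of n z \<in> grid_functions n"
  unfolding grid_functions_def
proof (intro CollectI conjI ballI)
  show "grid_function_of n z x \<in> {0, 1}" for x unfolding grid_function_of_def by (rule assms(2))
  fix i assume "i \<in> {1..n^2}"
  then show "grid_function_of n z constant_on {(real i - 1) / real (n^2) <.. real i / real (n^2)}"
    unfolding constant_on_def using grid_function_of_eq[OF assms(1)] by (intro exI[of _ "z (i - 1)"]) auto
qed

lemma grid_function_of_right_end:
  assumes "n > 0" "i < n^2"
  shows "grid_function_of n z (real (Suc i) / real (n^2)) = z i"
  using grid_function_of_eq[OF assms(1), of "real (Suc i) / real (n^2)" "Suc i" z] assms
  by (simp add: field_simps)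

lemma AE_leb01_ex:
  assumes "AE x in leb01. P x" "0 \<le> a" "a < b" "b \<le> 1"
  obtains x where "x \<in> {a<..<b}" "P x"
proof (rule ccontr)
  assume "\<not> thesis"
  then have no: "\<not> P x" if "x \<in> {a<..<b}" for x using \<open>\<And>x. \<lbrakk>x \<in> {a<..<b}; P x\<rbrakk> \<Longrightarrow> thesis\<close> that by blast
  have "AE x in lebesgue. x \<in> unit_interval \<longrightarrow> P x"
    using assms(1) by (subst (asm) AE_restrict_space_iff) auto
  then have "AE x in lebesgue. x \<notin> {a<..<b}"
    by eventually_elim (use no assms in auto)
  then have "{a<..<b} \<in> null_sets lebesgue"
    by (subst (asm) AE_iff_null_sets[symmetric]) auto
  then have "emeasure lebesgue {a<..<b} = 0" by (rule null_setsD1)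
  then show False using assms by simp
qed

text \<open>The grid function chosen in the definition of the energy is equal to \<open>step\<close> almost everywhere,
  hence somewhere in every cell, hence also at the right ends of the cells, where the energy
  evaluates it.\<close>

lemma F_discrete_step:
  assumes n: "n \<ge> 2" and z: "\<And>i. z i \<in> {0, 1}"
    and u: "AE x in leb01. u x = step (n^2) z x"
  shows "F_discrete n u = ennreal (lattice_energy n z)"
proof -
  have n0: "n > 0" using n by auto
  then have N: "0 < n^2" by simp
  define Q where "Q v \<longleftrightarrow> v \<in> grid_functions n \<and> (AE x in leb01. u x = v x)" for v
  have "AE x in leb01. grid_function_of n z x = step (n^2) z x"
    using n0 by (intro grid_function_AE_eq_step grid_function_of_in_grid z)
      (simp_all only: grid_function_of_right_end)
  then have "AE x in leb01. u x = grid_function_of n z x"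
    using u by eventually_elim simp
  then have Q: "Q (grid_function_of n z)"
    unfolding Q_def using grid_function_of_in_grid[of n z, OF n0 z] by blast
  define v where "v = (SOME v. Q v)"
  have v: "v \<in> grid_functions n" "AE x in leb01. u x = v x"
    using someI[of Q, OF Q] unfolding v_def Q_def by auto
  have "v (real (Suc i) / real (n^2)) = z i" if i: "i < n^2" for i
  proof -
    have "AE x in leb01. v x = step (n^2) z x" using u v(2) by eventually_elim simp
    moreover have "0 \<le> real i / real (n^2)" by simp
    moreover have "real i / real (n^2) < real (Suc i) / real (n^2)"
      using N by (intro divide_strict_right_mono) (simp_all del: of_nat_power)
    moreover have "real (Suc i) / real (n^2) \<le> 1" using i N by (simp del: of_nat_power)
    ultimately obtain x where x: "x \<in> {real i / real (n^2)<..<real (Suc i) / real (n^2)}" "v x = step (n^2) z x"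
      by (rule AE_leb01_ex)
    have "real i \<le> real (n^2) * x" "real (n^2) * x < real i + 1"
      using x(1) n0 by (auto simp: field_simps)
    then have "v x = z i" using step_eq[OF N, of i x z] x(2) by simp
    moreover have "v constant_on grid_cell n i"
      by (rule grid_function_constant_on_cell[OF v(1) i])
    moreover have "x \<in> grid_cell n i"
      "real (Suc i) / real (n^2) \<in> grid_cell n i"
      using x(1) n0 by (auto simp: field_simps)
    ultimately show ?thesis by (auto simp: constant_on_def)
  qed
  then have "grid_energy n v = lattice_energy n z"
    by (intro grid_energy_eq n z)
  then show ?thesis
    using Q unfolding F_discrete_def Q_def v_def by auto
qed

lemma F_discrete_finite_imp_step:
  assumes n: "n \<ge> 2" and fin: "F_discrete n u < \<infinity>"
  obtains z where "\<And>i. z i \<in> {0, 1}" "AE x in leb01. u x = step (n^2) z x"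
    "F_discrete n u = ennreal (lattice_energy n z)"
proof -
  obtain v where v: "v \<in> grid_functions n" "AE x in leb01. u x = v x"
    using fin unfolding F_discrete_def by (auto split: if_splits)
  define z where "z i = (if i < n^2 then v (real (Suc i) / real (n^2)) else 0)" for i
  have z: "z i \<in> {0, 1}" for i
  proof (cases "i < n^2")
    case True
    then have "real (Suc i) / real (n^2) \<le> 1" by (simp add: divide_le_eq del: of_nat_power)
    moreover have "0 < real (Suc i) / real (n^2)" using n by simp
    ultimately have "real (Suc i) / real (n^2) \<in> {0<..1}" by auto
    then have "v (real (Suc i) / real (n^2)) \<in> {0, 1}"
      using v(1) unfolding grid_functions_def by blast
    then show ?thesis using True by (simp add: z_def)
  qed (simp add: z_def)
  have "AE x in leb01. v x = step (n^2) z x"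
    using n by (intro grid_function_AE_eq_step v(1)) (auto simp: z_def)
  then have u: "AE x in leb01. u x = step (n^2) z x"
    using v(2) by eventually_elim simp
  show ?thesis
    by (rule that[of z, OF z u F_discrete_step[of n z u, OF n z u]])
qed

section \<open>Window averages and the lower bound for fixed size\<close>

definition window :: "nat \<Rightarrow> (nat \<Rightarrow> real) \<Rightarrow> nat \<Rightarrow> real" where
  "window n z i = (\<Sum>j<n. z (i + j)) / real n"

lemma window_bounds:
  assumes "n \<ge> 1" "\<And>i. z i \<in> {0, 1}"
  shows "0 \<le> window n z i" "window n z i \<le> 1"
proof -
  have z: "0 \<le> z i" "z i \<le> 1" for i using assms(2)[of i] by auto
  have "(\<Sum>j<n. z (i + j)) \<le> (\<Sum>j<n. 1)" by (intro sum_mono z)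
  then show "window n z i \<le> 1" using assms(1) by (simp add: window_def)
  show "0 \<le> window n z i" by (simp add: window_def sum_nonneg z)
qed

lemma window_Suc:
  assumes "n \<ge> 1"
  shows "window n z (Suc i) - window n z i = (z (i + n) - z i) / real n"
proof -
  have "(\<Sum>j<Suc n. z (i + j)) = z i + (\<Sum>j<n. z (Suc i + j))"
    by (subst sum.lessThan_Suc_shift) simp
  then have "(\<Sum>j<n. z (Suc i + j)) - (\<Sum>j<n. z (i + j)) = z (i + n) - z i" by simp
  then show ?thesis by (simp add: window_def diff_divide_distrib[symmetric])
qed

lemma abs_diff_le_sum:
  fixes f :: "nat \<Rightarrow> real"
  assumes "a \<le> b"
  shows "\<bar>f b - f a\<bar> \<le> (\<Sum>l\<in>{a..<b}. \<bar>f (Suc l) - f l\<bar>)"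
  using assms
proof (induction rule: dec_induct)
  case (step k)
  then show ?case by simp
qed simp

text \<open>The right-hand side counts the jumps on the closed loop that follows the sequence from \<open>i\<close> to
  \<open>i + n\<close> and returns along a vertical edge. A loop that meets both values has at least two jumps.\<close>

lemma nonconstant_window:
  assumes n: "n \<ge> 1" and z: "\<And>i. z i \<in> {0, 1 :: real}" and w: "0 < window n z i" "window n z i < 1"
  shows "2 \<le> (\<Sum>j<n. \<bar>z (i + j + 1) - z (i + j)\<bar>) + \<bar>z (i + n) - z i\<bar>"
proof -
  obtain j where j: "j < n" "z (i + j) \<noteq> z i"
  proof (rule ccontr)
    assume "\<not> thesis"
    then have "z (i + j) = z i" if "j < n" for j using that \<open>\<And>j. \<lbrakk>j < n; z (i + j) \<noteq> z i\<rbrakk> \<Longrightarrow> thesis\<close> by blast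
    then have "window n z i = z i" using n by (simp add: window_def)
    then show False using w z[of i] by auto
  qed
  define f where "f j = z (i + j)" for j
  have "\<bar>f j - f 0\<bar> + \<bar>f n - f j\<bar> \<le> (\<Sum>l\<in>{0..<j}. \<bar>f (Suc l) - f l\<bar>) + (\<Sum>l\<in>{j..<n}. \<bar>f (Suc l) - f l\<bar>)"
    using j by (intro add_mono abs_diff_le_sum) auto
  also have "\<dots> = (\<Sum>l\<in>{0..<n}. \<bar>f (Suc l) - f l\<bar>)"
    using j by (intro sum.atLeastLessThan_concat) auto
  finally have "\<bar>z (i + j) - z i\<bar> + \<bar>z (i + n) - z (i + j)\<bar> \<le> (\<Sum>l<n. \<bar>z (i + l + 1) - z (i + l)\<bar>)"
    by (simp add: f_def atLeast0LessThan)
  moreover have "2 \<le> \<bar>z (i + j) - z i\<bar> + \<bar>z (i + n) - z (i + j)\<bar> + \<bar>z (i + n) - z i\<bar>"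
    using z[of i] z[of "i + j"] z[of "i + n"] j(2) by auto
  ultimately show ?thesis by linarith
qed

text \<open>Summing \<open>nonconstant_window\<close> over all positions counts every horizontal edge at most \<open>n\<close> times.\<close>

lemma card_nonconstant_windows:
  assumes n: "n \<ge> 1" and z: "\<And>i. z i \<in> {0, 1 :: real}"
  shows "2 * real (card {i. i < N - n \<and> 0 < window n z i \<and> window n z i < 1})
    \<le> real n * jumps 1 N z + jumps n N z"
proof -
  define A where "A = {i. i < N - n \<and> 0 < window n z i \<and> window n z i < 1}"
  have A: "A \<subseteq> {..<N - n}" "finite A" by (auto simp: A_def)
  have "2 * real (card A) = (\<Sum>i\<in>A. 2)" by simp
  also have "\<dots> \<le> (\<Sum>i\<in>A. (\<Sum>j<n. \<bar>z (i + j + 1) - z (i + j)\<bar>) + \<bar>z (i + n) - z i\<bar>)"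
    by (intro sum_mono nonconstant_window n z) (auto simp: A_def)
  also have "\<dots> \<le> (\<Sum>i<N - n. (\<Sum>j<n. \<bar>z (i + j + 1) - z (i + j)\<bar>) + \<bar>z (i + n) - z i\<bar>)"
    by (intro sum_mono2 A) (auto intro!: add_nonneg_nonneg sum_nonneg)
  also have "\<dots> = (\<Sum>i<N - n. \<Sum>j<n. \<bar>z (i + j + 1) - z (i + j)\<bar>) + jumps n N z"
    by (simp add: sum.distrib jumps_def)
  also have "(\<Sum>i<N - n. \<Sum>j<n. \<bar>z (i + j + 1) - z (i + j)\<bar>)
      = (\<Sum>j<n. \<Sum>i<N - n. \<bar>z (i + j + 1) - z (i + j)\<bar>)"
    by (rule sum.swap)
  also have "\<dots> \<le> (\<Sum>j<n. jumps 1 N z)"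
  proof (rule sum_mono)
    fix j assume j: "j \<in> {..<n}"
    have "(\<Sum>i<N - n. \<bar>z (i + j + 1) - z (i + j)\<bar>) = (\<Sum>i\<in>(\<lambda>i. i + j) ` {..<N - n}. \<bar>z (i + 1) - z i\<bar>)"
      by (subst sum.reindex) (auto simp: inj_on_def)
    also have "\<dots> \<le> (\<Sum>i<N - 1. \<bar>z (i + 1) - z i\<bar>)"
      using j by (intro sum_mono2) auto
    finally show "(\<Sum>i<N - n. \<bar>z (i + j + 1) - z (i + j)\<bar>) \<le> jumps 1 N z"
      by (simp add: jumps_def)
  qed
  also have "(\<Sum>j<n. jumps 1 N z) = real n * jumps 1 N z" by simp
  finally show ?thesis unfolding A_def by simp
qed

definition pos_var :: "(nat \<Rightarrow> real) \<Rightarrow> nat \<Rightarrow> real" where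
  "pos_var f i = (\<Sum>j<i. max 0 (f (Suc j) - f j))"

definition neg_var :: "(nat \<Rightarrow> real) \<Rightarrow> nat \<Rightarrow> real" where
  "neg_var f i = (\<Sum>j<i. max 0 (f j - f (Suc j)))"

lemma pos_var_minus_neg_var: "f i = f 0 + pos_var f i - neg_var f i"
  by (induction i) (auto simp: pos_var_def neg_var_def max_def)

lemma mono_pos_var: "mono (pos_var f)" and mono_neg_var: "mono (neg_var f)"
  by (auto intro!: sum_mono2 simp: mono_def pos_var_def neg_var_def)

lemma pos_var_plus_neg_var: "pos_var f i + neg_var f i = (\<Sum>j<i. \<bar>f (Suc j) - f j\<bar>)"
  unfolding pos_var_def neg_var_def sum.distrib[symmetric]
  by (intro sum.cong) (auto simp: max_def)

text \<open>Windows that start after position \<open>n\<^sup>2 - n\<close> would leave the lattice. The last complete window is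
  used there instead, which changes the functions below on a set of measure of order \<open>1 / n\<close>.\<close>

definition cell :: "nat \<Rightarrow> real \<Rightarrow> nat" where
  "cell n x = min (nat \<lfloor>real (n^2) * x\<rfloor>) (n^2 - n)"

definition window_fn :: "nat \<Rightarrow> (nat \<Rightarrow> real) \<Rightarrow> real \<Rightarrow> real" where
  "window_fn n z x = window n z (cell n x)"

text \<open>The Jordan decomposition of \<open>window_fn\<close>; the increasing part carries the initial value.\<close>

definition rise :: "nat \<Rightarrow> (nat \<Rightarrow> real) \<Rightarrow> real \<Rightarrow> real" where
  "rise n z x = window n z 0 + pos_var (window n z) (cell n x)"

definition fall :: "nat \<Rightarrow> (nat \<Rightarrow> real) \<Rightarrow> real \<Rightarrow> real" where
  "fall n z x = neg_var (window n z) (cell n x)"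

lemma window_fn_eq: "window_fn n z x = rise n z x - fall n z x"
  unfolding window_fn_def rise_def fall_def by (rule pos_var_minus_neg_var)

lemma mono_cell: "mono (cell n)"
  unfolding cell_def mono_def
  by (intro allI impI min.mono nat_mono floor_mono mult_left_mono) auto

lemma cell_le: "cell n x \<le> n^2 - n"
  by (simp add: cell_def)

lemma cell_neg: "x < 0 \<Longrightarrow> cell n x = 0"
proof -
  assume "x < 0"
  then have "real (n^2) * x \<le> 0" by (intro mult_nonneg_nonpos) auto
  then have "\<lfloor>real (n^2) * x\<rfloor> \<le> 0" by linarith
  then show ?thesis by (simp only: cell_def nat_eq_iff2 nat_le_0 min_0L)
qed

lemma cell_ge_1:
  assumes "x \<ge> 1"
  shows "cell n x = n^2 - n"
proof -
  have "real (n^2) * 1 \<le> real (n^2) * x" using assms by (intro mult_left_mono) auto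
  then have "int (n^2) \<le> \<lfloor>real (n^2) * x\<rfloor>" by (simp add: le_floor_iff)
  then have "nat (int (n^2)) \<le> nat \<lfloor>real (n^2) * x\<rfloor>" by (rule nat_mono)
  then have "n^2 - n \<le> nat \<lfloor>real (n^2) * x\<rfloor>" by linarith
  then show ?thesis unfolding cell_def by (rule min_absorb2)
qed

text \<open>Helly's theorem is about right continuous functions.\<close>

lemma cell_right_continuous: "continuous (at_right x) (\<lambda>y. g (cell n y) :: real)"
proof (cases "n = 0")
  case True
  then show ?thesis by (simp add: cell_def)
next
  case False
  define N where "N = real (n^2)"
  have N: "N > 0" using False by (simp add: N_def)
  have x: "x < (real_of_int \<lfloor>N * x\<rfloor> + 1) / N" using N by (simp add: field_simps) linarith
  have "eventually (\<lambda>y. y \<in> {x<..<(real_of_int \<lfloor>N * x\<rfloor> + 1) / N}) (at_right x)"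
    by (rule eventually_at_right_real[OF x])
  then have "eventually (\<lambda>y. g (cell n y) = g (cell n x)) (at_right x)"
  proof eventually_elim
    case (elim y)
    then have "N * x \<le> N * y" "N * y < real_of_int \<lfloor>N * x\<rfloor> + 1" using N by (auto simp: field_simps)
    then have "\<lfloor>N * y\<rfloor> = \<lfloor>N * x\<rfloor>" by (intro floor_unique) linarith+
    then show ?case by (simp add: cell_def N_def)
  qed
  then show ?thesis unfolding continuous_within by (rule tendsto_eventually)
qed

lemma rise_mono: "mono (rise n z)" and fall_mono: "mono (fall n z)"
  using monoD[OF mono_pos_var monoD[OF mono_cell]] monoD[OF mono_neg_var monoD[OF mono_cell]]
  by (auto simp: mono_def rise_def fall_def)

lemma rise_right_continuous: "continuous (at_right x) (rise n z)"
  and fall_right_continuous: "continuous (at_right x) (fall n z)"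
  using cell_right_continuous[of x "\<lambda>i. window n z 0 + pos_var (window n z) i" n]
    cell_right_continuous[of x "neg_var (window n z)" n]
  by (simp_all add: rise_def[abs_def] fall_def[abs_def])

lemma window_variation:
  assumes "n \<ge> 1"
  shows "pos_var (window n z) (n^2 - n) + neg_var (window n z) (n^2 - n) = jumps n (n^2) z / real n"
  unfolding pos_var_plus_neg_var window_Suc[OF assms] jumps_def
  by (simp add: sum_divide_distrib)

text \<open>The points \<open>a\<close> and \<open>b\<close> lie outside the unit interval, where both functions are constant; this
  leaves room to choose continuity points of the limits later.\<close>

lemma rise_fall_variation:
  assumes "n \<ge> 1" "a < 0" "1 \<le> b"
  shows "(rise n z b - rise n z a) + (fall n z b - fall n z a) = jumps n (n^2) z / real n"
  using window_variation[OF assms(1), of z] cell_neg[OF assms(2), of n] cell_ge_1[OF assms(3), of n]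
  by (simp add: rise_def fall_def pos_var_def[of _ 0] neg_var_def[of _ 0])

lemma rise_fall_bounds:
  assumes "n \<ge> 1" "\<And>i. z i \<in> {0, 1}"
  shows "\<bar>rise n z x\<bar> \<le> 1 + jumps n (n^2) z / real n" "\<bar>fall n z x\<bar> \<le> 1 + jumps n (n^2) z / real n"
proof -
  note v = window_variation[OF assms(1), of z]
  have p: "0 \<le> pos_var (window n z) i" "0 \<le> neg_var (window n z) i" for i
    by (auto simp: pos_var_def neg_var_def intro: sum_nonneg)
  have "pos_var (window n z) (cell n x) \<le> pos_var (window n z) (n^2 - n)"
    "neg_var (window n z) (cell n x) \<le> neg_var (window n z) (n^2 - n)"
    by (intro monoD[OF mono_pos_var] monoD[OF mono_neg_var] cell_le)+
  then show "\<bar>rise n z x\<bar> \<le> 1 + jumps n (n^2) z / real n" "\<bar>fall n z x\<bar> \<le> 1 + jumps n (n^2) z / real n"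
    using v p[of "cell n x"] p[of "n^2 - n"] window_bounds[of n z 0, OF assms]
    by (auto simp: rise_def fall_def abs_le_iff)
qed

lemma window_fn_borel: "window_fn n z \<in> borel_measurable borel"
  unfolding window_fn_def cell_def by measurable

abbreviation fractional :: "(real \<Rightarrow> real) \<Rightarrow> real set" where
  "fractional u \<equiv> {x \<in> unit_interval. 0 < u x \<and> u x < 1}"

text \<open>The summand \<open>n\<close> accounts for the cells beyond the last complete window.\<close>

lemma measure_window_fn_fractional:
  assumes n: "n \<ge> 1"
  shows "measure lebesgue (fractional (window_fn n z))
    \<le> (real (card {i. i < n^2 - n \<and> 0 < window n z i \<and> window n z i < 1}) + real n) / real (n^2)"
proof -
  define N where "N = n^2"
  define B where "B = {i. i < N - n \<and> 0 < window n z i \<and> window n z i < 1}"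
  have N: "N > 0" "n \<le> N" using n by (auto simp: N_def power2_eq_square)
  have finB: "finite B" by (simp add: B_def)
  define I where "I i = {real i / real N..<(real i + 1) / real N}" for i :: nat
  have sub: "(fractional (window_fn n z)) \<subseteq> (\<Union>i\<in>B \<union> {N - n..<N}. I i)"
  proof
    fix x assume "x \<in> (fractional (window_fn n z))"
    then have x: "0 < x" "x < 1" "0 < window_fn n z x" "window_fn n z x < 1" by auto
    define i where "i = nat \<lfloor>real N * x\<rfloor>"
    have "0 \<le> real N * x" using x by simp
    then have i: "real i \<le> real N * x" "real N * x < real i + 1" by (auto simp: i_def)
    have "real N * x < real N" using x N by simp
    then have "i < N" using i by simp
    have "x \<in> I i" using i N by (auto simp: I_def field_simps)
    moreover have "i \<in> B \<union> {N - n..<N}"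
    proof (cases "i < N - n")
      case True
      then have "cell n x = i" by (simp add: cell_def i_def N_def)
      then show ?thesis using x True by (simp add: B_def window_fn_def)
    qed (use \<open>i < N\<close> in auto)
    ultimately show "x \<in> (\<Union>i\<in>B \<union> {N - n..<N}. I i)" by blast
  qed
  have I: "I i \<in> fmeasurable lebesgue" for i
    unfolding I_def by (intro bounded_set_imp_lmeasurable bounded_Ico) auto
  have mI: "measure lebesgue (I i) = 1 / real N" for i
    using N unfolding I_def by (subst measure_completion) (auto simp: divide_right_mono diff_divide_distrib[symmetric])
  have "measure lebesgue (fractional (window_fn n z))
      \<le> measure lebesgue (\<Union>i\<in>B \<union> {N - n..<N}. I i)"
  proof (rule measure_mono_fmeasurable[OF sub])
    have "(fractional (window_fn n z)) \<in> sets borel"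
      using window_fn_borel[of n z] by measurable
    then show "(fractional (window_fn n z)) \<in> sets lebesgue"
      by (simp add: sets_completionI_sets)
    show "(\<Union>i\<in>B \<union> {N - n..<N}. I i) \<in> fmeasurable lebesgue"
      using finB I by (intro fmeasurable.finite_UN) auto
  qed
  also have "\<dots> \<le> (\<Sum>i\<in>B \<union> {N - n..<N}. measure lebesgue (I i))"
    using finB I by (intro measure_UNION_le) (auto simp: fmeasurableD)
  also have "\<dots> = real (card (B \<union> {N - n..<N})) / real N"
    by (simp add: mI)
  also have "\<dots> \<le> (real (card B) + real n) / real N"
    using card_Un_le[of B "{N - n..<N}"] N by (intro divide_right_mono) auto
  finally show ?thesis unfolding B_def N_def .
qed

lemma lattice_energy_lower_bound:
  assumes n: "n \<ge> 1" and z: "\<And>i. z i \<in> {0, 1}"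
  shows "2 * measure lebesgue (fractional (window_fn n z))
      + jumps n (n^2) z / real n
    \<le> lattice_energy n z + (lattice_energy n z + 2) / real n"
proof -
  define H where "H = jumps 1 (n^2) z"
  define V where "V = jumps n (n^2) z"
  define k where "k = real (card {i. i < n^2 - n \<and> 0 < window n z i \<and> window n z i < 1})"
  have H0: "0 \<le> H" by (simp add: H_def jumps_nonneg)
  have r: "real n > 0" using n by simp
  have "2 * k \<le> real n * H + V"
    unfolding k_def H_def V_def by (rule card_nonconstant_windows[OF n z])
  then have "2 * ((k + real n) / real (n^2)) \<le> (real n * H + V + 2 * real n) / real (n^2)"
    using r by (simp add: divide_right_mono)
  also have "\<dots> = H / real n + V / real n / real n + 2 / real n"
    using r by (simp add: power2_eq_square add_divide_distrib)
  finally have "2 * ((k + real n) / real (n^2)) + V / real n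
      \<le> (H + V) / real n + V / real n / real n + 2 / real n"
    by (simp add: add_divide_distrib)
  \<comment> \<open>Each vertical jump was also counted once by the loops; this is of lower order.\<close>
  also have "V / real n / real n \<le> (H + V) / real n / real n"
    using H0 r by (intro divide_right_mono) auto
  finally have "2 * ((k + real n) / real (n^2)) + V / real n
      \<le> (H + V) / real n + ((H + V) / real n + 2) / real n"
    by (simp add: add_divide_distrib)
  then show ?thesis
    using measure_window_fn_fractional[OF n, of z] unfolding lattice_energy_def H_def V_def k_def
    by linarith
qed

lemma integral_leb01_interval:
  fixes h :: "real \<Rightarrow> real"
  assumes h: "h \<in> borel_measurable borel" and ab: "0 \<le> a" "b \<le> 1"
  shows "(\<integral>x. h x * indicator {a<..<b} x \<partial>leb01) = (\<integral>x. h x * indicator {a<..<b} x \<partial>lborel)"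
proof -
  have "(\<integral>x. h x * indicator {a<..<b} x \<partial>leb01)
      = (\<integral>x. indicator unit_interval x *\<^sub>R (h x * indicator {a<..<b} x) \<partial>lebesgue)"
    by (rule integral_restrict_space) auto
  also have "\<dots> = (\<integral>x. h x * indicator {a<..<b} x \<partial>lebesgue)"
    using ab by (intro Bochner_Integration.integral_cong) (auto simp: indicator_def)
  also have "\<dots> = (\<integral>x. h x * indicator {a<..<b} x \<partial>lborel)"
    using h by (intro integral_completion borel_measurable_times borel_measurable_indicator) auto
  finally show ?thesis .
qed

lemma integrable_bounded_interval:
  assumes h: "h \<in> borel_measurable borel" and B: "\<And>x. \<bar>h x\<bar> \<le> (B::real)"
  shows "integrable lborel (\<lambda>x. h x * indicator {a<..<b::real} x)"
proof (rule Bochner_Integration.integrable_bound)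
  show "integrable lborel (\<lambda>x. B * indicator {a<..<b} x)"
    by (intro integrable_mult_right integrable_real_indicator emeasure_bounded_finite) auto
  show "AE x in lborel. norm (h x * indicator {a<..<b} x) \<le> norm (B * indicator {a<..<b} x)"
    using order_trans[OF B abs_ge_self] by (intro AE_I2) (auto simp: indicator_def)
qed (use h in measurable)

text \<open>The two intervals differ by two pieces of length \<open>t\<close>.\<close>

lemma integral_shift_le:
  assumes h: "h \<in> borel_measurable borel" and h01: "\<And>x. 0 \<le> h x" "\<And>x. h x \<le> (1::real)"
    and t: "0 \<le> t" and ab: "a \<le> (b::real)"
  shows "\<bar>(\<integral>x. h (x + t) * indicator {a<..<b} x \<partial>lborel) - (\<integral>x. h x * indicator {a<..<b} x \<partial>lborel)\<bar> \<le> 2 * t"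
proof -
  have hB: "\<bar>h x\<bar> \<le> 1" for x using h01[of x] by simp
  have "(\<integral>x. h x * indicator {a + t<..<b + t} x \<partial>lborel)
      = (\<integral>x. h (t + 1 * x) * indicator {a + t<..<b + t} (t + 1 * x) \<partial>lborel)"
    by (subst lborel_integral_real_affine[of 1 _ t]) simp_all
  also have "\<dots> = (\<integral>x. h (x + t) * indicator {a<..<b} x \<partial>lborel)"
    by (intro Bochner_Integration.integral_cong) (auto simp: indicator_def add.commute)
  finally have "(\<integral>x. h (x + t) * indicator {a<..<b} x \<partial>lborel) - (\<integral>x. h x * indicator {a<..<b} x \<partial>lborel)
      = (\<integral>x. h x * indicator {a + t<..<b + t} x - h x * indicator {a<..<b} x \<partial>lborel)"
    using integrable_bounded_interval[OF h hB] by simp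
  also have "\<bar>\<dots>\<bar> \<le> (\<integral>x. indicator {a..a + t} x + indicator {b..b + t} x \<partial>lborel)"
  proof (rule integral_abs_bound[THEN order_trans], rule integral_mono)
    fix x
    have 1: "\<bar>indicator {a + t<..<b + t} x - indicator {a<..<b} x\<bar> \<le> indicator {a..a + t} x + (indicator {b..b + t} x :: real)"
      using t ab by (auto simp: indicator_def)
    have "\<bar>h x * indicator {a + t<..<b + t} x - h x * indicator {a<..<b} x\<bar>
        \<le> 1 * \<bar>indicator {a + t<..<b + t} x - indicator {a<..<b} x\<bar>"
      unfolding right_diff_distrib[symmetric] abs_mult by (intro mult_right_mono hB) simp
    then show "\<bar>h x * indicator {a + t<..<b + t} x - h x * indicator {a<..<b} x\<bar>
        \<le> indicator {a..a + t} x + indicator {b..b + t} x"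
      unfolding mult_1 using 1 by (rule order_trans)
  qed (use integrable_bounded_interval[OF h hB] in
      \<open>auto intro!: integrable_real_indicator emeasure_bounded_finite Bochner_Integration.integrable_add\<close>)
  also have "\<dots> = 2 * t"
    using t by (subst Bochner_Integration.integral_add)
      (auto intro!: integrable_real_indicator emeasure_bounded_finite)
  finally show ?thesis .
qed

text \<open>A window average is the mean of \<open>n\<close> translates of \<open>step\<close> by \<open>j / n\<^sup>2\<close> with \<open>j < n\<close>, and a
  translation by at most \<open>1 / n\<close> hardly changes the integral. The bound on \<open>b\<close> keeps the
  translates inside the unit interval.\<close>

lemma window_fn_integral_close:
  assumes n: "n \<ge> 1" and z: "\<And>i. z i \<in> {0, 1}" and ab: "0 < a" "a < b" "b + 1 / real n \<le> 1"
  shows "\<bar>(\<integral>x. window_fn n z x * indicator {a<..<b} x \<partial>leb01)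
    - (\<integral>x. step (n^2) z x * indicator {a<..<b} x \<partial>leb01)\<bar> \<le> 2 / real n"
proof -
  define N where "N = n^2"
  have N: "N > 0" "n \<le> N" using n by (auto simp: N_def power2_eq_square)
  have z01: "0 \<le> z i" "z i \<le> 1" for i using z[of i] by auto
  have s01: "0 \<le> step N z x" "step N z x \<le> 1" for x unfolding step_def by (rule z01)+
  have sB: "\<bar>step N z x\<bar> \<le> 1" for x using s01[of x] by simp
  have b1: "b \<le> 1" using ab(3) n by (smt (verit) divide_nonneg_nonneg of_nat_0_le_iff)
  define J where "J t = (\<integral>x. step N z (x + t) * indicator {a<..<b} x \<partial>lborel)" for t
  have J: "\<bar>J t - J 0\<bar> \<le> 2 * t" if "t \<ge> 0" for t
    using integral_shift_le[OF step_borel s01 that less_imp_le[OF ab(2)]] unfolding J_def by simp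
  have eq: "window_fn n z x * indicator {a<..<b} x
      = (\<Sum>j<n. step N z (x + real j / real N) * indicator {a<..<b} x) / real n" for x
  proof (cases "x \<in> {a<..<b}")
    case True
    define i where "i = nat \<lfloor>real N * x\<rfloor>"
    have "0 \<le> real N * x" using True ab by simp
    then have i: "real i \<le> real N * x" "real N * x < real i + 1" by (auto simp: i_def)
    have "real N * x \<le> real N * b" using True by (intro mult_left_mono) auto
    also have "\<dots> \<le> real N * (1 - 1 / real n)" using ab by (intro mult_left_mono) auto
    also have "\<dots> = real (N - n)" using n N by (simp add: of_nat_diff N_def power2_eq_square field_simps)
    finally have "i \<le> N - n" using i by linarith
    then have "cell n x = i" by (simp add: cell_def i_def N_def)
    moreover have "step N z (x + real j / real N) = z (i + j)" for j
      by (rule step_eq) (use N i in \<open>auto simp: distrib_left\<close>)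
    ultimately show ?thesis using True by (simp add: window_fn_def window_def)
  qed simp
  have int: "integrable lborel (\<lambda>x. step N z (x + t) * indicator {a<..<b} x)" for t
  proof (rule integrable_bounded_interval)
    show "(\<lambda>x. step N z (x + t)) \<in> borel_measurable borel"
      using step_borel[of N z] by measurable
  qed (rule sB)
  have "(\<integral>x. window_fn n z x * indicator {a<..<b} x \<partial>leb01)
      = (\<integral>x. window_fn n z x * indicator {a<..<b} x \<partial>lborel)"
    using ab b1 by (intro integral_leb01_interval window_fn_borel) auto
  also have "\<dots> = (\<Sum>j<n. J (real j / real N)) / real n"
    unfolding eq J_def integral_divide_zero
    by (subst Bochner_Integration.integral_sum[OF int]) (rule refl)
  finally have "(\<integral>x. window_fn n z x * indicator {a<..<b} x \<partial>leb01) - J 0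
      = (\<Sum>j<n. J (real j / real N) - J 0) / real n"
    using n by (simp add: sum_subtractf diff_divide_distrib)
  also have "\<bar>\<dots>\<bar> \<le> (\<Sum>j<n. 2 / real n) / real n"
  proof -
    have "\<bar>J (real j / real N) - J 0\<bar> \<le> 2 / real n" if "j < n" for j
    proof -
      have "real j / real N \<le> real n / real N" using that by (intro divide_right_mono) auto
      also have "\<dots> = 1 / real n" using n by (simp add: N_def power2_eq_square)
      finally show ?thesis using J[of "real j / real N"] by simp
    qed
    then have "\<bar>\<Sum>j<n. J (real j / real N) - J 0\<bar> \<le> (\<Sum>j<n. 2 / real n)"
      by (intro order_trans[OF sum_abs] sum_mono) auto
    then show ?thesis using n by (simp add: abs_divide divide_right_mono)
  qed
  also have "\<dots> = 2 / real n" using n by simp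
  also have "J 0 = (\<integral>x. step N z x * indicator {a<..<b} x \<partial>leb01)"
    using ab b1 unfolding J_def by (subst integral_leb01_interval[OF step_borel]) auto
  finally show ?thesis unfolding N_def .
qed

section \<open>Compactness and the limit inferior inequality\<close>

definition stieltjes :: "(real \<Rightarrow> real) \<Rightarrow> real measure" where
  "stieltjes P = restrict_space (interval_measure P) unit_interval"

lemma sets_stieltjes: "sets (stieltjes P) = sets borel_unit"
  by (simp add: stieltjes_def sets_restrict_space)

context
  fixes P :: "real \<Rightarrow> real"
  assumes P: "mono P" "\<And>x. continuous (at_right x) P"
begin

lemma emeasure_stieltjes_le:
  assumes "A \<subseteq> unit_interval" "A \<subseteq> {a<..b}" "a \<le> b"
  shows "emeasure (stieltjes P) A \<le> ennreal (P b - P a)"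
proof -
  have "emeasure (stieltjes P) A = emeasure (interval_measure P) A"
    unfolding stieltjes_def by (rule emeasure_restrict_space) (use assms in auto)
  also have "\<dots> \<le> emeasure (interval_measure P) {a<..b}"
    by (rule emeasure_mono) (use assms in auto)
  also have "\<dots> = ennreal (P b - P a)"
    by (rule emeasure_interval_measure_Ioc) (use assms P in \<open>auto dest: monoD\<close>)
  finally show ?thesis .
qed

lemma finite_measure_stieltjes: "finite_measure (stieltjes P)"
proof (rule finite_measureI)
  have "emeasure (stieltjes P) unit_interval \<le> ennreal (P 1 - P 0)"
    by (rule emeasure_stieltjes_le) auto
  also have "\<dots> < \<infinity>" by simp
  finally show "emeasure (stieltjes P) (space (stieltjes P)) \<noteq> \<infinity>"
    by (simp add: space_borel_unit[OF sets_stieltjes])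
qed

lemma cumulative_stieltjes:
  assumes "x \<in> unit_interval"
  shows "cumulative (stieltjes P) x = P x - P 0"
proof -
  have "unit_interval \<inter> {..x} = {0<..x}" using assms by auto
  then have "emeasure (stieltjes P) (unit_interval \<inter> {..x}) = emeasure (interval_measure P) {0<..x}"
    unfolding stieltjes_def using assms by (subst emeasure_restrict_space) auto
  also have "\<dots> = ennreal (P x - P 0)"
    by (rule emeasure_interval_measure_Ioc) (use assms P in \<open>auto dest: monoD\<close>)
  finally show ?thesis
    using assms P(1) by (simp add: cumulative_def measure_def monoD)
qed

end

lemma integral_deriv_test_function:
  assumes "\<phi> \<in> test_functions"
  shows "(\<integral>x. deriv \<phi> x \<partial>leb01) = 0"
proof -
  have "(\<integral>x. deriv \<phi> x \<partial>leb01) = integral {0..1} (deriv \<phi>)"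
    by (intro integral_leb01 integrable_test_function test_function_deriv assms)
  also have "\<dots> = \<phi> 1 - \<phi> 0"
    by (intro integral_unique test_function_integral_Icc assms) auto
  also have "\<dots> = 0" using assms by (auto simp: test_functions_def)
  finally show ?thesis .
qed

text \<open>The Stieltjes measures of \<open>P\<close> and \<open>Q\<close> represent the derivative by
  \<open>cumulative_integration_by_parts\<close>. Their masses are at most the increments of \<open>P\<close> and \<open>Q\<close> over
  any larger interval.\<close>

lemma has_derivative_measure_monotone_difference:
  assumes P: "mono P" "\<And>x. continuous (at_right x) P" and Q: "mono Q" "\<And>x. continuous (at_right x) Q"
    and u: "u \<in> borel_measurable leb01" "AE x in leb01. u x = P x - Q x"
    and ab: "a \<le> 0" "1 \<le> b"
  obtains \<nu> where "has_derivative_measure u \<nu>"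
    "total_variation \<nu> unit_interval \<le> ennreal ((P b - P a) + (Q b - Q a))"
proof -
  define M where "M = stieltjes P"
  define N where "N = stieltjes Q"
  have M: "finite_measure M" "sets M = sets borel_unit"
    unfolding M_def by (rule finite_measure_stieltjes[OF P] sets_stieltjes)+
  have N: "finite_measure N" "sets N = sets borel_unit"
    unfolding N_def by (rule finite_measure_stieltjes[OF Q] sets_stieltjes)+
  define \<nu> where "\<nu> B = measure M B - measure N B" for B
  note cum = integrable_cumulative_mult
  have parts: "(\<integral>x. u x * deriv \<phi> x \<partial>leb01) = - (integral\<^sup>L M \<phi> - integral\<^sup>L N \<phi>)"
    if \<phi>: "\<phi> \<in> test_functions" for \<phi>
  proof -
    note \<phi>' = test_function_deriv[OF \<phi>]
    have "AE x in leb01. x \<in> unit_interval" by (rule AE_I2) simp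
    then have ae: "AE x in leb01. u x * deriv \<phi> x =
        (P 0 - Q 0) * deriv \<phi> x + (cumulative M x * deriv \<phi> x - cumulative N x * deriv \<phi> x)"
      using u(2)
    proof eventually_elim
      case (elim x)
      then have ux: "u x = P 0 - Q 0 + (cumulative M x - cumulative N x)"
        using cumulative_stieltjes[OF P, of x] cumulative_stieltjes[OF Q, of x]
        by (simp add: M_def N_def)
      show ?case unfolding ux by (simp add: algebra_simps)
    qed
    have rhs: "integrable leb01 (\<lambda>x. (P 0 - Q 0) * deriv \<phi> x + (cumulative M x * deriv \<phi> x - cumulative N x * deriv \<phi> x))"
      by (intro Bochner_Integration.integrable_add Bochner_Integration.integrable_diff integrable_mult_right
          cum M N \<phi>' integrable_test_function)
    have "(\<integral>x. u x * deriv \<phi> x \<partial>leb01) =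
        (\<integral>x. (P 0 - Q 0) * deriv \<phi> x + (cumulative M x * deriv \<phi> x - cumulative N x * deriv \<phi> x) \<partial>leb01)"
      using u(1) rhs integrable_test_function[OF \<phi>'] by (intro integral_cong_AE ae) auto
    also have "\<dots> = (P 0 - Q 0) * (\<integral>x. deriv \<phi> x \<partial>leb01)
        + ((\<integral>x. cumulative M x * deriv \<phi> x \<partial>leb01) - (\<integral>x. cumulative N x * deriv \<phi> x \<partial>leb01))"
      using cum[OF M \<phi>'] cum[OF N \<phi>'] integrable_test_function[OF \<phi>'] by simp
    also have "\<dots> = - (integral\<^sup>L M \<phi> - integral\<^sup>L N \<phi>)"
      by (simp add: integral_deriv_test_function[OF \<phi>] cumulative_integration_by_parts[OF M \<phi>]
          cumulative_integration_by_parts[OF N \<phi>])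
    finally show ?thesis .
  qed
  have "has_derivative_measure u \<nu>"
    unfolding has_derivative_measure_def using M N parts by (auto simp: \<nu>_def)
  moreover have "total_variation \<nu> unit_interval \<le> ennreal ((P b - P a) + (Q b - Q a))"
  proof -
    have "total_variation \<nu> unit_interval \<le> emeasure M unit_interval + emeasure N unit_interval"
      by (rule total_variation_le[OF M(1) N(1) M(2) N(2)]) (simp add: \<nu>_def)
    also have "\<dots> \<le> ennreal (P b - P a) + ennreal (Q b - Q a)"
      unfolding M_def N_def using ab by (intro add_mono emeasure_stieltjes_le P Q) auto
    also have "\<dots> = ennreal ((P b - P a) + (Q b - Q a))"
      using monoD[OF P(1), of a b] monoD[OF Q(1), of a b] ab by (intro ennreal_plus[symmetric]) simp_all
    finally show ?thesis .
  qed
  ultimately show ?thesis by (rule that)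
qed

text \<open>Helly's theorem is applied to the two monotone parts in turn. Taking continuity points \<open>a\<close> and
  \<open>b\<close> outside the unit interval makes the total variations themselves converge.\<close>

lemma window_compactness:
  fixes n :: "nat \<Rightarrow> nat" and z :: "nat \<Rightarrow> nat \<Rightarrow> real"
  assumes n: "\<And>k. n k \<ge> 1" and z: "\<And>k i. z k i \<in> {0, 1}"
    and K: "\<And>k. jumps (n k) ((n k)^2) (z k) / real (n k) \<le> K"
  obtains s P Q a b D where "strict_mono (s :: nat \<Rightarrow> nat)"
    "mono P" "\<And>x. continuous (at_right x) P" "mono Q" "\<And>x. continuous (at_right x) Q"
    "a \<le> 0" "1 \<le> b" "countable D"
    "\<And>x. x \<notin> D \<Longrightarrow> (\<lambda>k. window_fn (n (s k)) (z (s k)) x) \<longlonglongrightarrow> P x - Q x"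
    "(\<lambda>k. jumps (n (s k)) ((n (s k))^2) (z (s k)) / real (n (s k))) \<longlonglongrightarrow> (P b - P a) + (Q b - Q a)"
proof -
  have bR: "\<bar>rise (n k) (z k) x\<bar> \<le> 1 + K" and bF: "\<bar>fall (n k) (z k) x\<bar> \<le> 1 + K" for k x
    using rise_fall_bounds[of "n k" "z k" x, OF n z] K[of k] by linarith+
  obtain s1 P where s1: "strict_mono (s1 :: nat \<Rightarrow> nat)" and P: "mono P" "\<And>x. continuous (at_right x) P"
    and P_lim: "\<And>x. isCont P x \<Longrightarrow> (\<lambda>k. rise (n (s1 k)) (z (s1 k)) x) \<longlonglongrightarrow> P x"
    using Helly_selection[of "\<lambda>k. rise (n k) (z k)", OF rise_right_continuous rise_mono bR] by blast
  obtain s2 Q where s2: "strict_mono (s2 :: nat \<Rightarrow> nat)" and Q: "mono Q" "\<And>x. continuous (at_right x) Q"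
    and Q_lim: "\<And>x. isCont Q x \<Longrightarrow> (\<lambda>k. fall (n (s1 (s2 k))) (z (s1 (s2 k))) x) \<longlonglongrightarrow> Q x"
    using Helly_selection[of "\<lambda>k. fall (n (s1 k)) (z (s1 k))", OF fall_right_continuous fall_mono bF] by blast
  define s where "s k = s1 (s2 k)" for k
  have s: "strict_mono s"
    using strict_mono_o[OF s1 s2] by (simp add: s_def[abs_def] comp_def)
  have P_lim': "(\<lambda>k. rise (n (s k)) (z (s k)) x) \<longlonglongrightarrow> P x" if "isCont P x" for x
    using LIMSEQ_subseq_LIMSEQ[OF P_lim[OF that] s2] by (simp add: comp_def s_def)
  have Q_lim': "(\<lambda>k. fall (n (s k)) (z (s k)) x) \<longlonglongrightarrow> Q x" if "isCont Q x" for x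
    using Q_lim[OF that] by (simp add: s_def)
  define D where "D = {x. \<not> isCont P x} \<union> {x. \<not> isCont Q x}"
  have D: "countable D"
    unfolding D_def by (intro countable_Un mono_ctble_discont P Q)
  have ex: "\<exists>x. c < x \<and> x < d \<and> x \<notin> D" if "c < d" for c d :: real
  proof (rule ccontr)
    assume "\<not> ?thesis"
    then have "{c<..<d} \<subseteq> D" by auto
    then have "countable {c<..<d}" using D by (rule countable_subset)
    then show False using uncountable_open_interval[of c d] that by simp
  qed
  obtain a where a: "a < 0" "a \<notin> D" using ex[of "-1" 0] by auto
  obtain b where b: "1 < b" "b \<notin> D" using ex[of 1 2] by auto
  have "(\<lambda>k. window_fn (n (s k)) (z (s k)) x) \<longlonglongrightarrow> P x - Q x" if "x \<notin> D" for x
    unfolding window_fn_eq using that by (intro tendsto_diff P_lim' Q_lim') (auto simp: D_def)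
  moreover have "(\<lambda>k. jumps (n (s k)) ((n (s k))^2) (z (s k)) / real (n (s k))) \<longlonglongrightarrow> (P b - P a) + (Q b - Q a)"
  proof -
    have "(\<lambda>k. (rise (n (s k)) (z (s k)) b - rise (n (s k)) (z (s k)) a)
        + (fall (n (s k)) (z (s k)) b - fall (n (s k)) (z (s k)) a)) \<longlonglongrightarrow> (P b - P a) + (Q b - Q a)"
      using a b by (intro tendsto_add tendsto_diff P_lim' Q_lim') (auto simp: D_def)
    then show ?thesis
      using rise_fall_variation[OF n a(1) less_imp_le[OF b(1)]] by simp
  qed
  ultimately show ?thesis
    using that[OF s P Q _ _ D] a b by (meson less_imp_le)
qed

lemma fractional_set_measurable:
  fixes h :: "real \<Rightarrow> real"
  assumes "h \<in> borel_measurable leb01"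
  shows "(fractional h) \<in> sets lebesgue"
proof -
  have "{x \<in> space leb01. 0 < h x \<and> h x < 1} \<in> sets leb01"
    using assms by measurable
  then show ?thesis by (auto simp: sets_restrict_space_iff)
qed

lemma emeasure_subset_unit_interval:
  assumes "A \<subseteq> unit_interval"
  shows "emeasure lebesgue A = ennreal (measure lebesgue A)"
proof (rule emeasure_eq_ennreal_measure)
  have "emeasure lebesgue A \<le> emeasure lebesgue unit_interval"
    by (rule emeasure_mono[OF assms]) auto
  also have "\<dots> < \<infinity>" by simp
  finally show "emeasure lebesgue A \<noteq> top" by auto
qed

text \<open>Fatou's lemma: a fractional limit forces the values to be fractional eventually.\<close>

lemma emeasure_fractional_le_liminf:
  fixes f :: "nat \<Rightarrow> real \<Rightarrow> real"
  assumes f: "\<And>k. f k \<in> borel_measurable leb01" and g: "g \<in> borel_measurable leb01"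
    and lim: "AE x in leb01. (\<lambda>k. f k x) \<longlonglongrightarrow> g x"
  shows "emeasure lebesgue (fractional g)
    \<le> liminf (\<lambda>k. emeasure lebesgue (fractional (f k)))"
proof -
  define A where "A h = {x \<in> unit_interval. 0 < h x \<and> h x < (1::real)}" for h :: "real \<Rightarrow> real"
  have A: "A h \<in> sets lebesgue" if "h \<in> borel_measurable leb01" for h
    unfolding A_def using that by (rule fractional_set_measurable)
  have "emeasure lebesgue (A g) = (\<integral>\<^sup>+x. indicator (A g) x \<partial>lebesgue)"
    using A[OF g] by simp
  also have "\<dots> \<le> (\<integral>\<^sup>+x. liminf (\<lambda>k. indicator (A (f k)) x) \<partial>lebesgue)"
  proof (rule nn_integral_mono_AE)
    have "AE x in lebesgue. x \<in> unit_interval \<longrightarrow> (\<lambda>k. f k x) \<longlonglongrightarrow> g x"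
      using lim by (subst (asm) AE_restrict_space_iff) auto
    then show "AE x in lebesgue. (indicator (A g) x :: ennreal) \<le> liminf (\<lambda>k. indicator (A (f k)) x)"
    proof eventually_elim
      case (elim x)
      show ?case
      proof (cases "x \<in> A g")
        case True
        then have "eventually (\<lambda>k. 0 < f k x) sequentially" "eventually (\<lambda>k. f k x < 1) sequentially"
          using elim by (auto simp: A_def intro: order_tendstoD)
        then have "eventually (\<lambda>k. 1 \<le> (indicator (A (f k)) x :: ennreal)) sequentially"
          by eventually_elim (use True in \<open>auto simp: A_def\<close>)
        then show ?thesis using True by (simp add: Liminf_bounded)
      qed simp
    qed
  qed
  also have "\<dots> \<le> liminf (\<lambda>k. \<integral>\<^sup>+x. indicator (A (f k)) x \<partial>lebesgue)"
    using A[OF f] by (intro nn_integral_liminf) auto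
  also have "\<dots> = liminf (\<lambda>k. emeasure lebesgue (A (f k)))"
    using A[OF f] by simp
  finally show ?thesis unfolding A_def .
qed

lemma integrable_interval_indicator:
  "0 < a \<Longrightarrow> b < 1 \<Longrightarrow> integrable leb01 (indicator {a<..<b} :: real \<Rightarrow> real)"
  by (rule integrable_leb01_bounded[where C = 1])
     (auto intro!: borel_measurable_leb01 simp: indicator_def)

lemma total_variation_derivative_measure:
  assumes "has_derivative_measure u \<nu>"
  shows "total_variation (derivative_measure u) unit_interval = total_variation \<nu> unit_interval"
proof -
  have "has_derivative_measure u (derivative_measure u)"
    unfolding derivative_measure_def using assms by (rule someI[where P = "has_derivative_measure u"])
  then show ?thesis
    using derivative_measure_unique[OF _ assms] by (intro total_variation_cong) auto
qed

text \<open>Along a subsequence that realises the limit inferior, the window averages converge almost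
  everywhere by \<open>window_compactness\<close>. Testing against intervals identifies the limit with \<open>u\<close>, and
  then \<open>lattice_energy_lower_bound\<close> passes to the limit.\<close>

lemma F_limit_le_liminf:
  assumes weak: "weak_star_conv us u"
  shows "F_limit u \<le> liminf (\<lambda>n. F_discrete n (us n))"
proof (cases "liminf (\<lambda>n. F_discrete n (us n)) = \<infinity>")
  case True
  then show ?thesis by simp
next
  case False
  define F where "F n = F_discrete n (us n)" for n
  obtain L where L: "liminf F = ennreal L" "0 \<le> L"
    using False unfolding F_def by (cases "liminf (\<lambda>n. F_discrete n (us n))") auto
  obtain r0 where r0: "strict_mono r0" "(F \<circ> r0) \<longlonglongrightarrow> liminf F"
    using liminf_subseq_lim by blast
  have "liminf F < ennreal (L + 1)" using L by (simp add: ennreal_less_iff)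
  then have "eventually (\<lambda>k. (F \<circ> r0) k < ennreal (L + 1)) sequentially"
    by (rule order_tendstoD(2)[OF r0(2)])
  then obtain K where K: "\<And>k. k \<ge> K \<Longrightarrow> F (r0 k) < ennreal (L + 1)"
    by (auto simp: eventually_sequentially)
  \<comment> \<open>The shift by \<open>K\<close> makes the energies finite, the shift by 2 makes the sizes at
    least 2.\<close>
  define r where "r k = r0 (k + (K + 2))" for k
  have r: "strict_mono r" using r0(1) by (auto simp: r_def strict_mono_def)
  have r2: "r k \<ge> 2" for k using seq_suble[OF r0(1), of "k + (K + 2)"] by (simp add: r_def)
  have r_lim: "(\<lambda>k. F (r k)) \<longlonglongrightarrow> ennreal L"
    using LIMSEQ_ignore_initial_segment[OF r0(2), of "K + 2"] L by (simp add: r_def comp_def)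
  have r_bd: "F (r k) < ennreal (L + 1)" for k using K by (simp add: r_def)
  have "\<exists>z. (\<forall>i. z i \<in> {0, 1}) \<and> (AE x in leb01. us (r k) x = step ((r k)^2) z x)
      \<and> F (r k) = ennreal (lattice_energy (r k) z)" for k
  proof -
    have "F_discrete (r k) (us (r k)) < \<infinity>"
      using less_trans[OF r_bd[of k] ennreal_less_top[of "L + 1"]] by (simp add: F_def)
    from F_discrete_finite_imp_step[OF r2 this] show ?thesis unfolding F_def by metis
  qed
  then obtain z where z: "\<And>k i. z k i \<in> {0, 1}"
    "\<And>k. AE x in leb01. us (r k) x = step ((r k)^2) (z k) x"
    "\<And>k. F (r k) = ennreal (lattice_energy (r k) (z k))" by metis
  define E where "E k = lattice_energy (r k) (z k)" for k
  have E0: "0 \<le> E k" for k unfolding E_def lattice_energy_def by (simp add: jumps_nonneg)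
  have E_lim: "E \<longlonglongrightarrow> L"
    using r_lim E0 L(2) unfolding z(3) E_def[symmetric] by (intro tendsto_ennrealD) auto
  have E_bd: "E k \<le> L + 1" for k
    using r_bd[of k] unfolding z(3) E_def[symmetric] ennreal_less_iff[OF E0] by simp
  have V_bd: "jumps (r k) ((r k)^2) (z k) / real (r k) \<le> L + 1" for k
  proof -
    have "jumps (r k) ((r k)^2) (z k) / real (r k) \<le> E k"
      unfolding E_def lattice_energy_def by (intro divide_right_mono) (auto simp: jumps_nonneg)
    then show ?thesis using E_bd[of k] by simp
  qed
  have r1: "r k \<ge> 1" for k using r2[of k] by simp
  obtain s P Q a b D where s: "strict_mono (s :: nat \<Rightarrow> nat)"
    and P: "mono P" "\<And>x. continuous (at_right x) P" and Q: "mono Q" "\<And>x. continuous (at_right x) Q"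
    and ab: "a \<le> 0" "1 \<le> b" and D: "countable D"
    and w_lim: "\<And>x. x \<notin> D \<Longrightarrow> (\<lambda>k. window_fn (r (s k)) (z (s k)) x) \<longlonglongrightarrow> P x - Q x"
    and V_lim: "(\<lambda>k. jumps (r (s k)) ((r (s k))^2) (z (s k)) / real (r (s k))) \<longlonglongrightarrow> (P b - P a) + (Q b - Q a)"
    using window_compactness[of r z "L + 1", OF r1 z(1) V_bd] by blast
  define w where "w k = window_fn (r (s k)) (z (s k))" for k
  have w01: "0 \<le> w k x" "w k x \<le> 1" for k x
    unfolding w_def window_fn_def using window_bounds[of "r (s k)" "z (s k)", OF r1 z(1)] by auto
  have w_meas: "w k \<in> borel_measurable leb01" for k
    unfolding w_def by (intro borel_measurable_leb01 window_fn_borel)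
  have PQ_meas: "(\<lambda>x. P x - Q x) \<in> borel_measurable leb01"
    by (intro borel_measurable_leb01 borel_measurable_diff borel_measurable_mono P Q)
  have PQ01: "0 \<le> P x - Q x \<and> P x - Q x \<le> 1" if "x \<notin> D" for x
    using LIMSEQ_le_const[OF w_lim[OF that], of 0] LIMSEQ_le_const2[OF w_lim[OF that], of 1] w01
    unfolding w_def by blast
  have AE_D: "AE x in leb01. x \<notin> D" by (rule AE_not_in_countable[OF D])
  obtain C where u_meas: "u \<in> borel_measurable leb01" and C: "AE x in leb01. \<bar>u x\<bar> \<le> C"
    using weak by (auto simp: weak_star_conv_def Linfty_def)
  have rs: "strict_mono (\<lambda>k. r (s k))" using strict_mono_o[OF r s] by (simp add: comp_def)
  have inv_lim: "(\<lambda>k. 1 / real (r (s k))) \<longlonglongrightarrow> 0"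
    using LIMSEQ_subseq_LIMSEQ[OF lim_1_over_n rs] by (simp add: comp_def)
  have "AE x in leb01. u x - (P x - Q x) = 0"
  proof (rule AE_zero_if_interval_integrals_zero)
    show "(\<lambda>x. u x - (P x - Q x)) \<in> borel_measurable leb01"
      using u_meas PQ_meas by (rule borel_measurable_diff)
    show "AE x in leb01. \<bar>u x - (P x - Q x)\<bar> \<le> C + 1"
      using C AE_D
    proof eventually_elim
      case (elim x)
      then show ?case using PQ01[of x] by auto
    qed
    fix c d :: real assume cd: "0 < c" "c < d" "d < 1"
    define I where "I h = (\<integral>x. h x * indicator {c<..<d} x \<partial>leb01)" for h :: "real \<Rightarrow> real"
    have ind: "integrable leb01 (indicator {c<..<d} :: real \<Rightarrow> real)"
      using cd by (intro integrable_interval_indicator)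
    have w_I: "(\<lambda>k. I (w k)) \<longlonglongrightarrow> I (\<lambda>x. P x - Q x)"
      unfolding I_def
    proof (rule integral_dominated_convergence[where w = "\<lambda>x. indicator {c<..<d} x"])
      show "AE x in leb01. (\<lambda>k. w k x * indicator {c<..<d} x) \<longlonglongrightarrow> (P x - Q x) * indicator {c<..<d} x"
        using AE_D
      proof eventually_elim
        case (elim x)
        then show ?case unfolding w_def by (intro tendsto_mult w_lim tendsto_const)
      qed
      show "AE x in leb01. norm (w k x * indicator {c<..<d} x) \<le> indicator {c<..<d} x" for k
        using w01[of k] by (intro AE_I2) (auto simp: indicator_def)
    qed (use ind PQ_meas w_meas in auto)
    have us_I: "(\<lambda>k. I (us (r (s k)))) \<longlonglongrightarrow> I u"
    proof -
      have "(\<lambda>n. I (us n)) \<longlonglongrightarrow> I u"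
        using weak ind unfolding weak_star_conv_def I_def by blast
      from LIMSEQ_subseq_LIMSEQ[OF this rs] show ?thesis by (simp add: comp_def)
    qed
    have "(\<lambda>k. I (w k) - I (us (r (s k)))) \<longlonglongrightarrow> 0"
    proof (rule Lim_null_comparison)
      have "eventually (\<lambda>k. 1 / real (r (s k)) < 1 - d) sequentially"
        using inv_lim by (rule order_tendstoD) (use cd in simp)
      then show "eventually (\<lambda>k. norm (I (w k) - I (us (r (s k)))) \<le> 2 * (1 / real (r (s k)))) sequentially"
      proof eventually_elim
        case (elim k)
        have us_meas: "us (r (s k)) \<in> borel_measurable leb01"
          using weak by (auto simp: weak_star_conv_def Linfty_def)
        have "I (us (r (s k))) = I (step ((r (s k))^2) (z (s k)))"
          unfolding I_def
        proof (rule integral_cong_AE)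
          show "AE x in leb01. us (r (s k)) x * indicator {c<..<d} x
              = step ((r (s k))^2) (z (s k)) x * indicator {c<..<d} x"
            using z(2)[of "s k"] by eventually_elim simp
          show "(\<lambda>x. us (r (s k)) x * indicator {c<..<d} x) \<in> borel_measurable leb01"
            using us_meas borel_measurable_integrable[OF ind] by (rule borel_measurable_times)
          show "(\<lambda>x. step ((r (s k))^2) (z (s k)) x * indicator {c<..<d} x) \<in> borel_measurable leb01"
            using borel_measurable_leb01[OF step_borel] borel_measurable_integrable[OF ind]
            by (rule borel_measurable_times)
        qed
        then show ?case
          using window_fn_integral_close[of "r (s k)" "z (s k)" c d, OF r1 z(1)] cd elim
          unfolding I_def w_def by simp
      qed
      show "(\<lambda>k. 2 * (1 / real (r (s k)))) \<longlonglongrightarrow> 0"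
        using tendsto_mult_left[OF inv_lim, of 2] by simp
    qed
    from LIMSEQ_unique[OF tendsto_diff[OF w_I us_I] this]
    have "I u = I (\<lambda>x. P x - Q x)" by simp
    moreover have "I (\<lambda>x. u x - (P x - Q x)) = I u - I (\<lambda>x. P x - Q x)"
    proof -
      have "integrable leb01 (\<lambda>x. u x * indicator {c<..<d} x)"
        by (rule integrable_bounded_mult[OF u_meas C ind])
      moreover have "integrable leb01 (\<lambda>x. (P x - Q x) * indicator {c<..<d} x)"
      proof (rule integrable_bounded_mult[OF PQ_meas _ ind])
        show "AE x in leb01. \<bar>P x - Q x\<bar> \<le> 1"
          using AE_D by eventually_elim (use PQ01 in auto)
      qed
      ultimately show ?thesis unfolding I_def by (simp add: left_diff_distrib[of "u _"])
    qed
    ultimately show "(\<integral>x. (u x - (P x - Q x)) * indicator {c<..<d} x \<partial>leb01) = 0"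
      unfolding I_def by simp
  qed
  then have u_eq: "AE x in leb01. u x = P x - Q x" by eventually_elim simp
  obtain \<nu> where \<nu>: "has_derivative_measure u \<nu>"
    "total_variation \<nu> unit_interval \<le> ennreal ((P b - P a) + (Q b - Q a))"
    using has_derivative_measure_monotone_difference[OF P Q u_meas u_eq ab] by blast
  have "integrable leb01 u" by (rule integrable_leb01_bounded[OF u_meas C])
  then have "u \<in> BV" using \<nu>(1) by (auto simp: BV_def)
  moreover have "AE x in leb01. 0 \<le> u x \<and> u x \<le> 1"
    using u_eq AE_D by eventually_elim (use PQ01 in auto)
  ultimately have F_limit: "F_limit u = 2 * emeasure lebesgue (fractional u)
      + total_variation \<nu> unit_interval"
    by (simp add: F_limit_def total_variation_derivative_measure[OF \<nu>(1)])
  define h where "h k = emeasure lebesgue (fractional (w k))" for k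
  define T where "T k = jumps (r (s k)) ((r (s k))^2) (z (s k)) / real (r (s k))" for k
  have "AE x in leb01. (\<lambda>k. w k x) \<longlonglongrightarrow> u x"
    using u_eq AE_D by eventually_elim (use w_lim in \<open>auto simp: w_def\<close>)
  then have h_liminf: "emeasure lebesgue (fractional u) \<le> liminf h"
    unfolding h_def by (intro emeasure_fractional_le_liminf w_meas u_meas)
  \<comment> \<open>Only the measures \<open>h\<close> need not converge; a last subsequence realises their limit
    inferior.\<close>
  obtain t where t: "strict_mono (t :: nat \<Rightarrow> nat)" "(h \<circ> t) \<longlonglongrightarrow> liminf h"
    using liminf_subseq_lim by blast
  have "2 * liminf h + ennreal ((P b - P a) + (Q b - Q a)) \<le> ennreal L"
  proof (rule LIMSEQ_le)
    have "(\<lambda>k. T (t k)) \<longlonglongrightarrow> (P b - P a) + (Q b - Q a)"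
      using LIMSEQ_subseq_LIMSEQ[OF V_lim t(1)] by (simp add: comp_def T_def)
    then show "(\<lambda>k. 2 * h (t k) + ennreal (T (t k))) \<longlonglongrightarrow> 2 * liminf h + ennreal ((P b - P a) + (Q b - Q a))"
      using t(2) by (intro tendsto_add tendsto_ennrealI ennreal_tendsto_cmult) (auto simp: comp_def)
    define q where "q k = s (t k)" for k
    have q: "strict_mono q" using strict_mono_o[OF s t(1)] by (simp add: q_def[abs_def] comp_def)
    have E_q: "(\<lambda>k. E (q k)) \<longlonglongrightarrow> L" using LIMSEQ_subseq_LIMSEQ[OF E_lim q] by (simp add: comp_def)
    have inv_q: "(\<lambda>k. 1 / real (r (q k))) \<longlonglongrightarrow> 0"
      using LIMSEQ_subseq_LIMSEQ[OF inv_lim t(1)] by (simp add: comp_def q_def)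
    have "(\<lambda>k. E (q k) + (E (q k) + 2) * (1 / real (r (q k)))) \<longlonglongrightarrow> L + (L + 2) * 0"
      by (intro tendsto_intros E_q inv_q)
    then show "(\<lambda>k. ennreal (E (q k) + (E (q k) + 2) * (1 / real (r (q k))))) \<longlonglongrightarrow> ennreal L"
      by (intro tendsto_ennrealI) simp
    have "2 * h (t k) + ennreal (T (t k)) \<le> ennreal (E (q k) + (E (q k) + 2) * (1 / real (r (q k))))" for k
    proof -
      define A where "A = (fractional (w (t k)))"
      have "h (t k) = ennreal (measure lebesgue A)"
        unfolding h_def A_def by (rule emeasure_subset_unit_interval) auto
      moreover have "0 \<le> T (t k)" by (simp add: T_def jumps_nonneg)
      ultimately have "2 * h (t k) + ennreal (T (t k)) = ennreal (2 * measure lebesgue A + T (t k))"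
        by (simp add: ennreal_mult)
      also have "\<dots> \<le> ennreal (E (q k) + (E (q k) + 2) * (1 / real (r (q k))))"
        using lattice_energy_lower_bound[of "r (q k)" "z (q k)", OF r1 z(1)]
        by (intro ennreal_leI) (simp add: A_def w_def T_def E_def q_def)
      finally show ?thesis .
    qed
    then show "\<exists>N. \<forall>k\<ge>N. 2 * h (t k) + ennreal (T (t k)) \<le> ennreal (E (q k) + (E (q k) + 2) * (1 / real (r (q k))))"
      by blast
  qed
  moreover have "F_limit u \<le> 2 * liminf h + ennreal ((P b - P a) + (Q b - Q a))"
    unfolding F_limit by (intro add_mono mult_left_mono h_liminf \<nu>(2)) simp
  ultimately show ?thesis
    using L(1) unfolding F_def by simp
qed

section \<open>Rounding and prefix rows\<close>

text \<open>Rounding towards the previous result keeps the variation from growing; independent rounding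
  could add 1 at every step.\<close>

primrec sticky_round :: "(nat \<Rightarrow> real) \<Rightarrow> nat \<Rightarrow> int" where
  "sticky_round y 0 = \<lfloor>y 0\<rfloor>"
| "sticky_round y (Suc k) =
     (if real_of_int (sticky_round y k) \<le> y (Suc k) then \<lfloor>y (Suc k)\<rfloor> else \<lceil>y (Suc k)\<rceil>)"

lemma sticky_round_close: "\<bar>real_of_int (sticky_round y k) - y k\<bar> < 1"
  by (cases k; simp; linarith)

lemma sticky_round_bounds:
  assumes "0 \<le> y k" "y k \<le> real n"
  shows "0 \<le> sticky_round y k" "sticky_round y k \<le> int n"
  using sticky_round_close[of y k] assms by linarith+

lemma sticky_round_of_int: "y k = real_of_int i \<Longrightarrow> sticky_round y k = i"
  using sticky_round_close[of y k] by linarith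

text \<open>The new value lies between the old one and \<open>y (Suc k)\<close>. Hence the distance to \<open>y\<close> is a potential
  that pays for every move, and only its initial value is added to the variation of \<open>y\<close>.\<close>

lemma sticky_round_variation:
  "(\<Sum>k<K. \<bar>real_of_int (sticky_round y (Suc k)) - real_of_int (sticky_round y k)\<bar>)
    \<le> 1 + (\<Sum>k<K. \<bar>y (Suc k) - y k\<bar>)"
proof -
  have "(\<Sum>k<K. \<bar>real_of_int (sticky_round y (Suc k)) - real_of_int (sticky_round y k)\<bar>)
      + \<bar>real_of_int (sticky_round y K) - y K\<bar> \<le> 1 + (\<Sum>k<K. \<bar>y (Suc k) - y k\<bar>)"
  proof (induction K)
    case 0
    show ?case using sticky_round_close[of y 0] by simp
  next
    case (Suc K)
    have "\<bar>real_of_int (sticky_round y (Suc K)) - real_of_int (sticky_round y K)\<bar>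
        + \<bar>real_of_int (sticky_round y (Suc K)) - y (Suc K)\<bar>
        = \<bar>real_of_int (sticky_round y K) - y (Suc K)\<bar>"
    proof (cases "real_of_int (sticky_round y K) \<le> y (Suc K)")
      case True
      then have "sticky_round y K \<le> \<lfloor>y (Suc K)\<rfloor>" by (simp add: le_floor_iff)
      then show ?thesis using True by simp
    next
      case False
      then have "\<lceil>y (Suc K)\<rceil> \<le> sticky_round y K" by (simp add: ceiling_le_iff)
      then show ?thesis using False by simp
    qed
    then show ?case using Suc by simp
  qed
  then show ?thesis by linarith
qed

definition prefix_rows :: "nat \<Rightarrow> (nat \<Rightarrow> int) \<Rightarrow> nat \<Rightarrow> real" where
  "prefix_rows n m i = (if int (i mod n) < m (i div n) then 1 else 0)"

lemma prefix_rows_01: "prefix_rows n m i \<in> {0, 1}"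
  by (simp add: prefix_rows_def)

lemma prefix_rows_eq: "j < n \<Longrightarrow> prefix_rows n m (k * n + j) = (if int j < m k then 1 else 0)"
  by (simp add: prefix_rows_def)

lemma sum_lessThan_add: "(\<Sum>i<a + b. f i) = (\<Sum>i<a. f i) + (\<Sum>j<b. f (a + j :: nat) :: real)"
  by (induction b) (auto simp: add.assoc)

lemma sum_rows: "(\<Sum>i<K * n. f i) = (\<Sum>k<K. \<Sum>j<n. f (k * n + j :: nat) :: real)"
proof (induction K)
  case (Suc K)
  have "(\<Sum>i<Suc K * n. f i) = (\<Sum>i<K * n + n. f i)" by (simp add: add.commute)
  then show ?case using Suc by (simp add: sum_lessThan_add)
qed simp

lemma sum_prefix: "0 \<le> a \<Longrightarrow> a \<le> int n \<Longrightarrow> (\<Sum>j<n. if int j < a then 1 else 0 :: real) = real_of_int a"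
proof (induction n)
  case (Suc n)
  show ?case
  proof (cases "a = int (Suc n)")
    case True
    have "(\<Sum>j<Suc n. if int j < a then 1 else 0 :: real) = (\<Sum>j<Suc n. 1)"
      using True by (intro sum.cong) auto
    then show ?thesis using True by simp
  next
    case False
    then show ?thesis using Suc by simp
  qed
qed simp

lemma sum_prefix_diff:
  assumes "0 \<le> a" "a \<le> int n" "0 \<le> b" "b \<le> int n"
  shows "(\<Sum>j<n. \<bar>(if int j < a then 1 else 0) - (if int j < b then 1 else 0 :: real)\<bar>) = \<bar>real_of_int a - real_of_int b\<bar>"
proof -
  have *: "(\<Sum>j<n. \<bar>(if int j < a then 1 else 0) - (if int j < b then 1 else 0 :: real)\<bar>) = real_of_int a - real_of_int b"
    if "b \<le> a" "0 \<le> a" "a \<le> int n" "0 \<le> b" "b \<le> int n" for a b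
  proof -
    have "(\<Sum>j<n. \<bar>(if int j < a then 1 else 0) - (if int j < b then 1 else 0 :: real)\<bar>)
        = (\<Sum>j<n. (if int j < a then 1 else 0) - (if int j < b then 1 else 0 :: real))"
      using that by (intro sum.cong) auto
    then show ?thesis using that by (simp add: sum_subtractf sum_prefix)
  qed
  show ?thesis
  proof (cases "b \<le> a")
    case True
    then show ?thesis using *[of b a] assms by simp
  next
    case False
    then show ?thesis using *[of a b] assms by (simp add: abs_minus_commute)
  qed
qed

lemma vertical_jumps_prefix_rows:
  assumes n: "n \<ge> 1" and m: "\<And>k. 0 \<le> m k" "\<And>k. m k \<le> int n"
  shows "jumps n (n^2) (prefix_rows n m) = (\<Sum>k<n - 1. \<bar>real_of_int (m (Suc k)) - real_of_int (m k)\<bar>)"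
proof -
  have "n^2 - n = (n - 1) * n" by (simp add: power2_eq_square diff_mult_distrib)
  then have "jumps n (n^2) (prefix_rows n m)
      = (\<Sum>k<n - 1. \<Sum>j<n. \<bar>prefix_rows n m (k * n + j + n) - prefix_rows n m (k * n + j)\<bar>)"
    by (simp add: jumps_def sum_rows)
  also have "\<dots> = (\<Sum>k<n - 1. \<Sum>j<n. \<bar>(if int j < m (Suc k) then 1 else 0) - (if int j < m k then 1 else 0)\<bar>)"
  proof (intro sum.cong refl)
    fix k j assume "j \<in> {..<n}"
    moreover have "k * n + j + n = Suc k * n + j" by simp
    ultimately show "\<bar>prefix_rows n m (k * n + j + n) - prefix_rows n m (k * n + j)\<bar>
        = \<bar>(if int j < m (Suc k) then 1 else 0) - (if int j < m k then 1 else 0)\<bar>"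
      by (simp only: prefix_rows_eq lessThan_iff)
  qed
  also have "\<dots> = (\<Sum>k<n - 1. \<bar>real_of_int (m (Suc k)) - real_of_int (m k)\<bar>)"
    by (intro sum.cong refl sum_prefix_diff m)
  finally show ?thesis .
qed

text \<open>Ascents and descents alternate.\<close>

lemma horizontal_jumps_le_drops:
  assumes "\<And>i. z i \<in> {0, 1 :: real}"
  shows "jumps 1 N z \<le> 2 * neg_var z N + 1"
proof -
  have "jumps 1 N z = pos_var z (N - 1) + neg_var z (N - 1)"
    by (simp add: jumps_def pos_var_plus_neg_var)
  also have "\<dots> = z (N - 1) - z 0 + 2 * neg_var z (N - 1)"
    using pos_var_minus_neg_var[of z "N - 1"] by simp
  also have "\<dots> \<le> 1 + 2 * neg_var z N"
    using assms[of "N - 1"] assms[of 0] monoD[OF mono_neg_var, of "N - 1" N z] by auto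
  finally show ?thesis by simp
qed

text \<open>A descent inside a row is at its last 1 and exists only if the row is not constant. A descent
  from the end of a row to the next one means that the row is full and the next one empty, that
  is, \<open>\<bar>m (Suc k) - m k\<bar> = n\<close>.\<close>

lemma drops_prefix_rows:
  assumes n: "n \<ge> 1" and m: "\<And>k. 0 \<le> m k" "\<And>k. m k \<le> int n"
  shows "neg_var (prefix_rows n m) (n^2)
    \<le> real (card {k. k < n \<and> 0 < m k \<and> m k < int n})
      + (\<Sum>k<n. \<bar>real_of_int (m (Suc k)) - real_of_int (m k)\<bar>) / real n"
proof -
  define z where "z = prefix_rows n m"
  define d where "d k = \<bar>real_of_int (m (Suc k)) - real_of_int (m k)\<bar> / real n" for k
  define c where "c k j = (if j = nat (m k) - 1 then (if 0 < m k \<and> m k < int n then 1 else 0) else 0 :: real)" for k j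
  have d0: "0 \<le> d k" for k by (simp add: d_def)
  have pt: "max 0 (z (k * n + j) - z (Suc (k * n + j))) \<le> c k j + (if j = n - 1 then d k else 0)"
    if j: "j < n" for k j
  proof (cases "Suc j < n")
    case True
    have "z (k * n + j) = (if int j < m k then 1 else 0)" unfolding z_def by (rule prefix_rows_eq[OF j])
    moreover have "z (Suc (k * n + j)) = (if int (Suc j) < m k then 1 else 0)"
      using prefix_rows_eq[OF True, of m k] by (simp add: z_def)
    ultimately show ?thesis using True d0[of k] by (auto simp: c_def)
  next
    case False
    then have jn: "j = n - 1" using j by simp
    have "z (k * n + j) = (if int j < m k then 1 else 0)" unfolding z_def by (rule prefix_rows_eq[OF j])
    moreover have "z (Suc (k * n + j)) = (if 0 < m (Suc k) then 1 else 0)"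
    proof -
      have "Suc (k * n + j) = Suc k * n + 0" using jn n by simp
      then show ?thesis unfolding z_def by (simp only: prefix_rows_eq[of 0 n m "Suc k"] n) (use n in \<open>simp add: prefix_rows_def\<close>)
    qed
    moreover have "1 \<le> d k" if "int j < m k" "\<not> 0 < m (Suc k)"
    proof -
      have "m k = int n" "m (Suc k) = 0" using that jn m[of k] m(1)[of "Suc k"] n by linarith+
      then show ?thesis using n by (simp add: d_def)
    qed
    moreover have "0 \<le> c k j" by (simp add: c_def)
    ultimately show ?thesis using jn d0[of k] by auto
  qed
  have "neg_var z (n^2) = (\<Sum>k<n. \<Sum>j<n. max 0 (z (k * n + j) - z (Suc (k * n + j))))"
    by (simp add: neg_var_def power2_eq_square sum_rows)
  also have "\<dots> \<le> (\<Sum>k<n. \<Sum>j<n. c k j + (if j = n - 1 then d k else 0))"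
    by (intro sum_mono pt) simp
  also have "\<dots> = (\<Sum>k<n. (\<Sum>j<n. c k j) + d k)"
    using n by (simp add: sum.distrib)
  also have "\<dots> \<le> (\<Sum>k<n. (if 0 < m k \<and> m k < int n then 1 else 0) + d k)"
  proof (intro sum_mono add_mono order_refl)
    fix k
    show "(\<Sum>j<n. c k j) \<le> (if 0 < m k \<and> m k < int n then 1 else 0)"
      unfolding c_def by (subst sum.delta) auto
  qed
  also have "\<dots> = real (card {k. k < n \<and> 0 < m k \<and> m k < int n}) + (\<Sum>k<n. d k)"
  proof -
    have "(\<Sum>k<n. if 0 < m k \<and> m k < int n then 1 else 0 :: real) = (\<Sum>k\<in>{k\<in>{..<n}. 0 < m k \<and> m k < int n}. 1)"
      by (rule sum.inter_filter[symmetric]) simp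
    also have "{k\<in>{..<n}. 0 < m k \<and> m k < int n} = {k. k < n \<and> 0 < m k \<and> m k < int n}" by auto
    finally show ?thesis by (simp add: sum.distrib)
  qed
  finally show ?thesis unfolding z_def d_def by (simp add: sum_divide_distrib)
qed

text \<open>The rounding, the transitions between full and empty rows, and the possible excess of one ascent
  over the descents contribute terms that stay bounded before the division by \<open>n\<close>.\<close>

lemma lattice_energy_prefix_rows:
  assumes n: "n \<ge> 1" and m: "\<And>k. 0 \<le> m k" "\<And>k. m k \<le> int n"
    and R: "real (card {k. k < n \<and> 0 < m k \<and> m k < int n}) \<le> real n * h"
    and V: "(\<Sum>k<n. \<bar>real_of_int (m (Suc k)) - real_of_int (m k)\<bar>) \<le> 1 + real n * t" and t: "t \<ge> 0"
  shows "lattice_energy n (prefix_rows n m) \<le> 2 * h + t + (4 + 2 * t) / real n"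
proof -
  define V' where "V' = (\<Sum>k<n. \<bar>real_of_int (m (Suc k)) - real_of_int (m k)\<bar>)"
  have r: "1 \<le> real n" using n by simp
  have "jumps n (n^2) (prefix_rows n m) \<le> V'"
    unfolding vertical_jumps_prefix_rows[of n m, OF n m] V'_def by (intro sum_mono2) auto
  also have "\<dots> \<le> 1 + real n * t" using V by (simp add: V'_def)
  finally have vert: "jumps n (n^2) (prefix_rows n m) \<le> 1 + real n * t" .
  have "jumps 1 (n^2) (prefix_rows n m) \<le> 2 * neg_var (prefix_rows n m) (n^2) + 1"
    by (rule horizontal_jumps_le_drops[OF prefix_rows_01])
  also have "\<dots> \<le> 2 * (real n * h + (1 + real n * t) / real n) + 1"
  proof -
    have "V' / real n \<le> (1 + real n * t) / real n" using V r unfolding V'_def by (intro divide_right_mono) auto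
    then have "neg_var (prefix_rows n m) (n^2) \<le> real n * h + (1 + real n * t) / real n"
      using drops_prefix_rows[of n m, OF n m] add_mono[OF R] unfolding V'_def by (meson order_trans)
    then show ?thesis by (intro add_right_mono mult_left_mono) simp_all
  qed
  also have "(1 + real n * t) / real n \<le> 1 + t"
    using r by (simp add: add_divide_distrib)
  finally have "jumps 1 (n^2) (prefix_rows n m) + jumps n (n^2) (prefix_rows n m)
      \<le> 2 * (real n * h) + real n * t + (4 + 2 * t)"
    using vert by simp
  then have "lattice_energy n (prefix_rows n m) \<le> (2 * (real n * h) + real n * t + (4 + 2 * t)) / real n"
    unfolding lattice_energy_def using r by (intro divide_right_mono) auto
  also have "\<dots> = 2 * h + t + (4 + 2 * t) / real n"
    using r by (simp add: add_divide_distrib)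
  finally show ?thesis .
qed

lemma borel_bounded_integrable_on:
  fixes h :: "real \<Rightarrow> real"
  assumes "h \<in> borel_measurable borel" "\<And>x. \<bar>h x\<bar> \<le> B"
  shows "h integrable_on {a..b}"
proof (rule measurable_bounded_by_integrable_imp_integrable)
  have "h \<in> borel_measurable lebesgue" using assms(1) by (simp add: measurable_completion)
  then show "h \<in> borel_measurable (lebesgue_on {a..b})" by (rule measurable_restrict_space1)
  show "(\<lambda>_. B) integrable_on {a..b}" by (rule integrable_const_ivl)
qed (use assms in auto)

lemma integral_leb01_indicator:
  fixes h :: "real \<Rightarrow> real"
  assumes h: "h \<in> borel_measurable borel" "\<And>x. \<bar>h x\<bar> \<le> B" and ab: "0 \<le> a" "a \<le> b" "b \<le> 1"
  shows "(\<integral>x. h x * indicator {a<..<b} x \<partial>leb01) = integral {a..b} h"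
proof -
  have "integrable leb01 (\<lambda>x. h x * indicator {a<..<b} x)"
  proof (rule integrable_leb01_bounded)
    show "(\<lambda>x. h x * indicator {a<..<b} x) \<in> borel_measurable leb01"
      using h by (intro borel_measurable_leb01 borel_measurable_times) auto
    show "AE x in leb01. \<bar>h x * indicator {a<..<b} x\<bar> \<le> \<bar>B\<bar>"
      using order_trans[OF h(2) abs_ge_self] by (intro AE_I2) (auto simp: indicator_def)
  qed
  then have "(\<integral>x. h x * indicator {a<..<b} x \<partial>leb01) = integral {0..1} (\<lambda>x. h x * indicator {a<..<b} x)"
    by (rule integral_leb01)
  also have "\<dots> = integral {0..1} (\<lambda>x. if x \<in> {a<..<b} then h x else 0)"
    by (intro Henstock_Kurzweil_Integration.integral_cong) (auto simp: indicator_def)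
  also have "\<dots> = integral ({0..1} \<inter> {a<..<b}) h" by (subst integral_restrict_Int) (simp add: Int_commute)
  also have "{0..1} \<inter> {a<..<b} = {a<..<b}" using ab by auto
  also have "integral {a<..<b} h = integral {a..b} h" by (rule integral_open_interval_real[symmetric])
  finally show ?thesis .
qed

lemma integral_step_cells:
  assumes N: "N > 0" and z: "\<And>i. \<bar>z i\<bar> \<le> B"
  shows "integral {0..real J / real N} (step N z) = (\<Sum>i<J. z i) / real N"
proof (induction J)
  case (Suc J)
  have "integral {0..real J / real N} (step N z) + integral {real J / real N..real (Suc J) / real N} (step N z)
      = integral {0..real (Suc J) / real N} (step N z)"
    using N by (intro Henstock_Kurzweil_Integration.integral_combine borel_bounded_integrable_on[OF step_borel, of _ _ B])
      (auto simp: step_def z divide_right_mono)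
  moreover have "integral {real J / real N..real (Suc J) / real N} (step N z) = z J / real N"
  proof -
    have "integral {real J / real N..real (Suc J) / real N} (step N z)
        = integral {real J / real N..real (Suc J) / real N} (\<lambda>_. z J)"
    proof (rule integral_spike[of "{real (Suc J) / real N}"])
      fix x assume x: "x \<in> {real J / real N..real (Suc J) / real N} - {real (Suc J) / real N}"
      then have "x < real (Suc J) / real N" by auto
      then have "real J \<le> real N * x" "real N * x < real J + 1" using N x by (auto simp: field_simps)
      then show "z J = step N z x" using step_eq[OF N] by simp
    qed simp
    also have "\<dots> = z J / real N" using N by (simp add: divide_right_mono diff_divide_distrib[symmetric])
    finally show ?thesis .
  qed
  ultimately show ?case using Suc by (simp add: add_divide_distrib)
qed simp

lemma abs_integral_le:
  fixes f :: "real \<Rightarrow> real"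
  assumes "f integrable_on {a..b}" "a \<le> b" "\<And>x. x \<in> {a..b} \<Longrightarrow> \<bar>f x\<bar> \<le> B"
  shows "\<bar>integral {a..b} f\<bar> \<le> B * (b - a)"
proof -
  have "0 \<le> B" using assms(2) assms(3)[of a] by auto
  then show ?thesis
    using has_integral_bound_real[where B = B, OF _ finite.emptyI integrable_integral[OF assms(1)]] assms by simp
qed

abbreviation closed_row :: "nat \<Rightarrow> nat \<Rightarrow> real set" where
  "closed_row n k \<equiv> {real k / real n..real (Suc k) / real n}"

text \<open>An estimate for a Riemann sum: the oscillation of \<open>v\<close> on a row is bounded by the increment of
  the increasing function \<open>G\<close>, and the sum of these increments telescopes.\<close>

lemma row_averages_close:
  fixes v G :: "real \<Rightarrow> real"
  assumes n: "n \<ge> 1" and v: "v \<in> borel_measurable borel" "\<And>x. \<bar>v x\<bar> \<le> B"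
    and z: "\<And>i. z i \<in> {0, 1}"
    and G: "\<And>x y. x \<le> y \<Longrightarrow> \<bar>v y - v x\<bar> \<le> G y - G x" "\<And>x. 0 \<le> G x" "\<And>x. G x \<le> S"
    and x: "\<And>k. k < n \<Longrightarrow> x k \<in> closed_row n k"
    and rows: "\<And>k. k < n \<Longrightarrow> \<bar>(\<Sum>j<n. z (k * n + j)) - real n * v (x k)\<bar> \<le> 1"
    and t: "0 \<le> t" "t \<le> 1"
  shows "\<bar>integral {0..t} (\<lambda>x. step (n^2) z x - v x)\<bar> \<le> (2 + B + S) / real n"
proof -
  define g where "g x = step (n^2) z x - v x" for x
  define N where "N = n^2"
  have N: "N > 0" using n by (simp add: N_def)
  have r: "real n > 0" using n by simp
  have zB: "\<bar>z i\<bar> \<le> 1" for i using z[of i] by auto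
  have sB: "\<bar>step N z x\<bar> \<le> 1" for x by (simp add: step_def zB)
  have gB: "\<bar>g x\<bar> \<le> 1 + B" for x using sB[of x] v(2)[of x] by (simp add: g_def N_def)
  have g_meas: "g \<in> borel_measurable borel"
    unfolding g_def using v(1) by (intro borel_measurable_diff step_borel)
  have s_int: "step N z integrable_on {a..b}" for a b
    by (rule borel_bounded_integrable_on[OF step_borel sB])
  have v_int: "v integrable_on {a..b}" for a b
    by (rule borel_bounded_integrable_on[OF v])
  have g_int: "g integrable_on {a..b}" for a b
    by (rule borel_bounded_integrable_on[OF g_meas gB])
  have row: "\<bar>integral (closed_row n k) v - v (x k) / real n\<bar>
      \<le> (G (real (Suc k) / real n) - G (real k / real n)) / real n" if k: "k < n" for k
  proof -
    let ?I = "closed_row n k"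
    have len: "real (Suc k) / real n - real k / real n = 1 / real n"
      by (simp add: diff_divide_distrib[symmetric])
    have le: "real k / real n \<le> real (Suc k) / real n" by (intro divide_right_mono) auto
    have "\<bar>integral ?I (\<lambda>y. v y - v (x k))\<bar>
        \<le> (G (real (Suc k) / real n) - G (real k / real n)) * (real (Suc k) / real n - real k / real n)"
    proof (rule abs_integral_le[OF _ le])
      show "(\<lambda>y. v y - v (x k)) integrable_on ?I"
        by (intro Henstock_Kurzweil_Integration.integrable_diff v_int integrable_const_ivl)
      fix y assume y: "y \<in> ?I"
      have mono: "G a \<le> G b" if "a \<le> b" for a b using G(1)[OF that] by linarith
      show "\<bar>v y - v (x k)\<bar> \<le> G (real (Suc k) / real n) - G (real k / real n)"
      proof (cases "y \<le> x k")
        case True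
        then have "\<bar>v y - v (x k)\<bar> \<le> G (x k) - G y" using G(1)[of y "x k"] by (simp add: abs_minus_commute)
        then show ?thesis using mono[of "real k / real n" y] mono[of "x k" "real (Suc k) / real n"] x[OF k] y
          by simp
      next
        case False
        then have "\<bar>v y - v (x k)\<bar> \<le> G y - G (x k)" using G(1)[of "x k" y] by simp
        then show ?thesis using mono[of "real k / real n" "x k"] mono[of y "real (Suc k) / real n"] x[OF k] y
          by simp
      qed
    qed
    moreover have "integral ?I (\<lambda>y. v y - v (x k)) = integral ?I v - v (x k) / real n"
      using le by (subst Henstock_Kurzweil_Integration.integral_diff[OF v_int integrable_const_ivl]) (simp add: len del: of_nat_Suc)
    ultimately show ?thesis by (simp add: len del: of_nat_Suc)
  qed
  have grid: "\<bar>integral {0..real K / real n} g\<bar> \<le> (1 + S) / real n" if K: "K \<le> n" for K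
  proof -
    have s_eq: "integral {0..real K / real n} (step N z) = (\<Sum>k<K. (\<Sum>j<n. z (k * n + j)) / real N)"
    proof -
      have "real K / real n = real (K * n) / real N" using r by (simp add: N_def power2_eq_square)
      then show ?thesis
        using integral_step_cells[OF N zB, of "K * n"] by (simp only: sum_rows sum_divide_distrib)
    qed
    have v_eq: "integral {0..real K / real n} v = (\<Sum>k<K. integral (closed_row n k) v)"
    proof (induction K)
      case (Suc K)
      have "integral {0..real K / real n} v + integral {real K / real n..real (Suc K) / real n} v
          = integral {0..real (Suc K) / real n} v"
        by (intro Henstock_Kurzweil_Integration.integral_combine v_int divide_right_mono) auto
      then show ?case using Suc by simp
    qed simp
    have "integral {0..real K / real n} g = (\<Sum>k<K. (\<Sum>j<n. z (k * n + j)) / real N)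
        - (\<Sum>k<K. integral (closed_row n k) v)"
      unfolding g_def s_eq[symmetric] v_eq[symmetric] N_def[symmetric]
      by (rule Henstock_Kurzweil_Integration.integral_diff[OF s_int v_int])
    also have "\<dots> = (\<Sum>k<K. (\<Sum>j<n. z (k * n + j)) / real N
        - integral (closed_row n k) v)"
      by (simp add: sum_subtractf)
    also have "\<bar>\<dots>\<bar> \<le> (\<Sum>k<K. 1 / real N + (G (real (Suc k) / real n) - G (real k / real n)) / real n)"
    proof (intro order_trans[OF sum_abs] sum_mono)
      fix k assume "k \<in> {..<K}"
      then have k: "k < n" using K by auto
      have "\<bar>(\<Sum>j<n. z (k * n + j)) / real N - v (x k) / real n\<bar>
          = \<bar>(\<Sum>j<n. z (k * n + j)) - real n * v (x k)\<bar> / real N"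
        using r by (simp add: N_def power2_eq_square field_simps abs_divide[symmetric])
      also have "\<dots> \<le> 1 / real N" using rows[OF k] by (intro divide_right_mono) auto
      finally show "\<bar>(\<Sum>j<n. z (k * n + j)) / real N - integral (closed_row n k) v\<bar>
          \<le> 1 / real N + (G (real (Suc k) / real n) - G (real k / real n)) / real n"
        using row[OF k] by linarith
    qed
    also have "\<dots> = real K / real N + (G (real K / real n) - G 0) / real n"
      using sum_lessThan_telescope[of "\<lambda>k. G (real k / real n)" K]
      by (simp add: sum.distrib sum_divide_distrib[symmetric] del: of_nat_Suc)
    also have "\<dots> \<le> 1 / real n + S / real n"
    proof (rule add_mono)
      have "real K / real N \<le> real n / real N" using K by (intro divide_right_mono) auto
      then show "real K / real N \<le> 1 / real n" using r by (simp add: N_def power2_eq_square)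
      show "(G (real K / real n) - G 0) / real n \<le> S / real n"
        using G(2)[of 0] G(3)[of "real K / real n"] by (intro divide_right_mono) auto
    qed
    finally show ?thesis by (simp add: add_divide_distrib)
  qed
  define K where "K = nat \<lfloor>real n * t\<rfloor>"
  have "0 \<le> real n * t" using t r by simp
  then have K: "real K \<le> real n * t" "real n * t < real K + 1" by (auto simp: K_def)
  have "real n * t \<le> real n" using t r by simp
  then have "K \<le> n" using K by simp
  have Kt: "real K / real n \<le> t" "t - real K / real n \<le> 1 / real n"
  proof -
    show "real K / real n \<le> t" using K r by (simp add: divide_le_eq mult.commute)
    have "t \<le> (real K + 1) / real n" using K r by (simp add: le_divide_eq mult.commute)
    then show "t - real K / real n \<le> 1 / real n" by (simp add: add_divide_distrib)
  qed
  have "integral {0..real K / real n} g + integral {real K / real n..t} g = integral {0..t} g"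
    using Kt by (intro Henstock_Kurzweil_Integration.integral_combine g_int) auto
  moreover have "\<bar>integral {real K / real n..t} g\<bar> \<le> (1 + B) * (1 / real n)"
  proof -
    have "\<bar>integral {real K / real n..t} g\<bar> \<le> (1 + B) * (t - real K / real n)"
      using Kt gB by (intro abs_integral_le g_int) auto
    also have "\<dots> \<le> (1 + B) * (1 / real n)"
      using Kt gB[of 0] by (intro mult_left_mono) auto
    finally show ?thesis .
  qed
  ultimately have "\<bar>integral {0..t} g\<bar> \<le> (1 + S) / real n + (1 + B) * (1 / real n)"
    using grid[OF \<open>K \<le> n\<close>] by linarith
  also have "\<dots> = (2 + B + S) / real n" by (simp add: add_divide_distrib[symmetric])
  finally show ?thesis unfolding g_def .
qed

section \<open>The recovery sequence and Gamma-convergence\<close>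

abbreviation row :: "nat \<Rightarrow> nat \<Rightarrow> real set" where
  "row n k \<equiv> {real k / real n<..<real (Suc k) / real n}"

lemma row_subset_unit_interval:
  assumes "k < n"
  shows "row n k \<subseteq> unit_interval"
proof
  fix x assume x: "x \<in> row n k"
  have "0 \<le> real k / real n" by simp
  also have "\<dots> < x" using x by simp
  finally have "0 < x" .
  have "x < real (Suc k) / real n" using x by simp
  also have "\<dots> \<le> 1" using assms by (simp del: of_nat_Suc)
  finally show "x \<in> unit_interval" using \<open>0 < x\<close> by simp
qed

text \<open>The values 0 and 1 are preferred, because they make the row constant. If neither is available,
  almost all of the row belongs to the set where \<open>u\<close> is fractional.\<close>

lemma row_sample:
  fixes u v :: "real \<Rightarrow> real"
  assumes good: "AE x in leb01. 0 \<le> u x \<and> u x \<le> 1 \<and> u x = v x" and k: "k < n"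
  obtains y where "y \<in> row n k" "0 \<le> u y" "u y \<le> 1" "u y = v y"
    "0 < u y \<and> u y < 1 \<longrightarrow>
      (AE x in leb01. x \<in> row n k \<longrightarrow> 0 < u x \<and> u x < 1)"
proof -
  let ?I = "row n k"
  show ?thesis
  proof (cases "\<exists>y\<in>?I. (u y = 0 \<or> u y = 1) \<and> u y = v y")
    case True
    then obtain y where "y \<in> ?I" "u y = 0 \<or> u y = 1" "u y = v y" by blast
    then show ?thesis by (intro that[of y]) auto
  next
    case False
    have "real k / real n < real (Suc k) / real n" "real (Suc k) / real n \<le> 1"
      using k by (auto intro!: divide_strict_right_mono simp del: of_nat_Suc)
    then obtain y where y: "y \<in> ?I" "0 \<le> u y \<and> u y \<le> 1 \<and> u y = v y"
      using AE_leb01_ex[OF good, of "real k / real n" "real (Suc k) / real n"] by auto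
    have "AE x in leb01. x \<in> ?I \<longrightarrow> 0 < u x \<and> u x < 1"
      using good
    proof eventually_elim
      case (elim x)
      show ?case
      proof
        assume "x \<in> ?I"
        then have "u x \<noteq> 0" "u x \<noteq> 1" using False elim by blast+
        then show "0 < u x \<and> u x < 1" using elim by linarith
      qed
    qed
    then show ?thesis using y by (intro that[of y]) auto
  qed
qed

lemma card_fractional_rows_le:
  assumes R: "R \<subseteq> {..<n}" and A: "A \<in> sets lebesgue" "A \<subseteq> unit_interval"
    and row: "\<And>k. k \<in> R \<Longrightarrow> AE x in leb01. x \<in> row n k \<longrightarrow> x \<in> A"
  shows "real (card R) \<le> real n * measure lebesgue A"
proof (cases "n = 0")
  case True
  then show ?thesis using R by simp
next
  case False
  then have r: "real n > 0" by simp
  define I where "I k = row n k" for k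
  have finR: "finite R" using R by (rule finite_subset) simp
  have I01: "I k \<subseteq> unit_interval" if "k \<in> R" for k
    unfolding I_def using that R by (intro row_subset_unit_interval) auto
  have disj: "disjoint_family_on I R"
    unfolding disjoint_family_on_def
  proof (intro ballI impI)
    have *: "I i \<inter> I j = {}" if "i < j" for i j
    proof -
      have "real (Suc i) / real n \<le> real j / real n" using that by (intro divide_right_mono) auto
      then show ?thesis unfolding I_def by auto
    qed
    fix i j :: nat assume "i \<noteq> j"
    then show "I i \<inter> I j = {}" using *[of i j] *[of j i] by (cases i j rule: linorder_cases) auto
  qed
  have mI: "emeasure lebesgue (I k) = ennreal (1 / real n)" for k
  proof -
    have "real k / real n \<le> real (Suc k) / real n" by (intro divide_right_mono) auto
    then show ?thesis unfolding I_def by (simp add: diff_divide_distrib[symmetric])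
  qed
  have "ennreal (real (card R) / real n) = (\<Sum>k\<in>R. emeasure lebesgue (I k))"
    unfolding mI by (simp add: ennreal_mult'[symmetric] ennreal_of_nat_eq_real_of_nat)
  also have "\<dots> = emeasure lebesgue (\<Union>k\<in>R. I k)"
    by (intro sum_emeasure disj finR) (auto simp: I_def)
  also have "\<dots> \<le> emeasure lebesgue A"
  proof (rule emeasure_mono_AE[OF _ A(1)])
    have "AE x in lebesgue. x \<in> I k \<longrightarrow> x \<in> A" if "k \<in> R" for k
    proof -
      have "AE x in lebesgue. x \<in> unit_interval \<longrightarrow> x \<in> I k \<longrightarrow> x \<in> A"
        using row[OF that] unfolding I_def by (subst (asm) AE_restrict_space_iff) auto
      then show ?thesis by eventually_elim (use I01[OF that] in auto)
    qed
    then have "AE x in lebesgue. \<forall>k\<in>R. x \<in> I k \<longrightarrow> x \<in> A"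
      using finR by (intro AE_finite_allI)
    then show "AE x in lebesgue. x \<in> (\<Union>k\<in>R. I k) \<longrightarrow> x \<in> A"
      by eventually_elim auto
  qed
  also have "\<dots> = ennreal (measure lebesgue A)"
    by (rule emeasure_subset_unit_interval[OF A(2)])
  finally have "real (card R) / real n \<le> measure lebesgue A" by simp
  then show ?thesis using r by (simp add: field_simps)
qed

text \<open>Rows are filled according to the rounded samples. The samples are taken where \<open>u\<close> agrees with
  the representative \<open>v\<close>, so that \<open>sum_le_total_variation\<close> applies to their increments.\<close>

lemma recovery_sequence:
  assumes u: "u \<in> Linfty" "AE x in leb01. 0 \<le> u x \<and> u x \<le> 1"
    and \<nu>: "has_derivative_measure u \<nu>" "total_variation \<nu> unit_interval = ennreal t" "0 \<le> t"
  obtains us where "\<And>n. us n \<in> Linfty" "weak_star_conv us u"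
    "limsup (\<lambda>n. F_discrete n (us n))
      \<le> 2 * emeasure lebesgue (fractional u) + ennreal t"
proof -
  define A where "A = (fractional u)"
  define h where "h = measure lebesgue A"
  have u_meas: "u \<in> borel_measurable leb01" using u(1) by (simp add: Linfty_def)
  have A_sets: "A \<in> sets lebesgue"
    unfolding A_def using u_meas by (rule fractional_set_measurable)
  have A_h: "emeasure lebesgue A = ennreal h"
    unfolding h_def by (rule emeasure_subset_unit_interval) (auto simp: A_def)
  from \<nu>(1) obtain M N where MN: "finite_measure M" "finite_measure N" "sets M = sets borel_unit" "sets N = sets borel_unit"
    "\<And>B. B \<in> sets borel_unit \<Longrightarrow> \<nu> B = measure M B - measure N B"
    "\<And>\<phi>. \<phi> \<in> test_functions \<Longrightarrow> (\<integral>x. u x * deriv \<phi> x \<partial>leb01) = - (integral\<^sup>L M \<phi> - integral\<^sup>L N \<phi>)"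
    unfolding has_derivative_measure_def by blast
  have u_bd: "AE x in leb01. \<bar>u x\<bar> \<le> 1" using u(2) by eventually_elim auto
  obtain c where c: "AE x in leb01. u x = c + cumulative M x - cumulative N x"
    using has_derivative_measure_representation[OF u_meas u_bd MN(1-4,6)] by blast
  define v where "v x = c + cumulative M x - cumulative N x" for x
  define G where "G x = cumulative M x + cumulative N x" for x
  define S where "S = measure M unit_interval + measure N unit_interval"
  define B where "B = \<bar>c\<bar> + S"
  note cumM = cumulative_bounds[OF MN(1,3)] and cumN = cumulative_bounds[OF MN(2,4)]
  have v_meas: "v \<in> borel_measurable borel"
    unfolding v_def by (intro borel_measurable_diff borel_measurable_add cumulative_borel MN) simp
  have v_bd: "\<bar>v x\<bar> \<le> B" for x
    using cumM[of x] cumN[of x] unfolding v_def B_def S_def by linarith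
  have G: "\<bar>v b - v a\<bar> \<le> G b - G a" if "a \<le> b" for a b
    using cumulative_mono[OF MN(1,3) that] cumulative_mono[OF MN(2,4) that]
    unfolding v_def G_def by linarith
  have G0: "0 \<le> G a" "G a \<le> S" for a using cumM[of a] cumN[of a] unfolding G_def S_def by linarith+
  have good: "AE x in leb01. 0 \<le> u x \<and> u x \<le> 1 \<and> u x = v x"
    using u(2) c by eventually_elim (simp add: v_def)
  define sample where "sample n k y \<longleftrightarrow>
      y \<in> row n k \<and> 0 \<le> u y \<and> u y \<le> 1 \<and> u y = v y
      \<and> (0 < u y \<and> u y < 1 \<longrightarrow>
        (AE x in leb01. x \<in> row n k \<longrightarrow> 0 < u x \<and> u x < 1))"
    for n k y
  define x where "x n k = (SOME y. sample n k y)" for n k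
  have sample: "sample n k (x n k)" if kn: "k < n" for n k
  proof -
    obtain y where "y \<in> row n k" "0 \<le> u y" "u y \<le> 1" "u y = v y"
      "0 < u y \<and> u y < 1 \<longrightarrow>
        (AE x in leb01. x \<in> row n k \<longrightarrow> 0 < u x \<and> u x < 1)"
      by (rule row_sample[OF good kn])
    then have "sample n k y" unfolding sample_def by blast
    then show ?thesis unfolding x_def by (rule someI)
  qed
  have x: "x n k \<in> row n k" "0 \<le> u (x n k)" "u (x n k) \<le> 1" "u (x n k) = v (x n k)"
    "0 < u (x n k) \<and> u (x n k) < 1 \<Longrightarrow>
        AE y in leb01. y \<in> row n k \<longrightarrow> 0 < u y \<and> u y < 1"
    if "k < n" for n k
    using sample[OF that] unfolding sample_def by blast+
  \<comment> \<open>The minimum repeats the last sample, so that no variation arises beyond the last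
    row.\<close>
  define y where "y n k = real n * u (x n (min k (n - 1)))" for n k
  define m where "m n = sticky_round (y n)" for n
  define us where "us n = step (n^2) (prefix_rows n (m n))" for n
  have us01: "0 \<le> us n a" "us n a \<le> 1" for n a
    using prefix_rows_01[of n "m n"] unfolding us_def step_def by (metis insertE order_refl singletonD zero_le_one)+
  have us_borel: "us n \<in> borel_measurable borel" for n unfolding us_def by (rule step_borel)
  have us_Linfty: "us n \<in> Linfty" for n
  proof -
    have "\<bar>us n a\<bar> \<le> 1" for a using us01[of n a] by simp
    then show ?thesis
      unfolding Linfty_def using borel_measurable_leb01[OF us_borel] by auto
  qed
  have y_bd: "0 \<le> y n k" "y n k \<le> real n" if "n \<ge> 1" for n k
  proof -
    have "min k (n - 1) < n" using that by auto
    then show "0 \<le> y n k" "y n k \<le> real n"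
      using x(2,3)[of "min k (n - 1)" n] by (simp_all add: y_def mult_left_le)
  qed
  have m_bd: "0 \<le> m n k" "m n k \<le> int n" if "n \<ge> 1" for n k
    unfolding m_def using sticky_round_bounds[of "y n" k n] y_bd[OF that] by auto
  have y_eq: "y n k = real n * u (x n k)" if "k < n" for n k
  proof -
    have "min k (n - 1) = k" using that by (intro min_absorb1) simp
    then show ?thesis by (simp only: y_def)
  qed
  have energy: "lattice_energy n (prefix_rows n (m n)) \<le> 2 * h + t + (4 + 2 * t) / real n" if n: "n \<ge> 1" for n
  proof (rule lattice_energy_prefix_rows[OF n m_bd[OF n] _ _ \<nu>(3)])
    show "real (card {k. k < n \<and> 0 < m n k \<and> m n k < int n}) \<le> real n * h"
      unfolding h_def
    proof (rule card_fractional_rows_le[OF _ A_sets])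
      fix k assume "k \<in> {k. k < n \<and> 0 < m n k \<and> m n k < int n}"
      then have k: "k < n" "0 < m n k" "m n k < int n" by auto
      have "u (x n k) \<noteq> 0"
      proof
        assume "u (x n k) = 0"
        then have "y n k = real_of_int 0" using y_eq[OF k(1)] by simp
        then show False using sticky_round_of_int[of "y n" k 0] k by (simp add: m_def)
      qed
      moreover have "u (x n k) \<noteq> 1"
      proof
        assume "u (x n k) = 1"
        then have "y n k = real_of_int (int n)" using y_eq[OF k(1)] by simp
        then show False using sticky_round_of_int[of "y n" k "int n"] k by (simp add: m_def)
      qed
      ultimately have "0 < u (x n k) \<and> u (x n k) < 1" using x(2,3)[OF k(1)] by linarith
      from x(5)[OF k(1) this] have ae: "AE a in leb01. a \<in> row n k \<longrightarrow> 0 < u a \<and> u a < 1" .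
      have "AE a in leb01. a \<in> unit_interval" by (rule AE_I2) simp
      then show "AE a in leb01. a \<in> row n k \<longrightarrow> a \<in> A"
        using ae by eventually_elim (auto simp: A_def)
    qed (auto simp: A_def)
    have "(\<Sum>k<n. \<bar>real_of_int (m n (Suc k)) - real_of_int (m n k)\<bar>) \<le> 1 + (\<Sum>k<n. \<bar>y n (Suc k) - y n k\<bar>)"
      unfolding m_def by (rule sticky_round_variation)
    also have "(\<Sum>k<n. \<bar>y n (Suc k) - y n k\<bar>) = real n * (\<Sum>k<n - 1. \<bar>\<nu> {x n k<..x n (Suc k)}\<bar>)"
    proof -
      obtain n' where n': "n = Suc n'" using n by (cases n) auto
      have "\<bar>y n (Suc k) - y n k\<bar> = real n * \<bar>\<nu> {x n k<..x n (Suc k)}\<bar>" if "k < n'" for k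
      proof -
        have k: "k < n" "Suc k < n" using that n' by auto
        have "x n k \<in> unit_interval" "x n (Suc k) \<in> unit_interval"
          using x(1)[OF k(1)] x(1)[OF k(2)] row_subset_unit_interval[OF k(1)] row_subset_unit_interval[OF k(2)]
          by blast+
        moreover have "x n k < real (Suc k) / real n" "real (Suc k) / real n < x n (Suc k)"
          using x(1)[OF k(1)] x(1)[OF k(2)] by simp_all
        ultimately have ord: "0 < x n k" "x n k \<le> x n (Suc k)" "x n (Suc k) < 1" by auto
        then have "{x n k<..x n (Suc k)} \<in> sets borel_unit" by (auto simp: sets_borel_unit_iff)
        then have "\<nu> {x n k<..x n (Suc k)} = v (x n (Suc k)) - v (x n k)"
          using MN(5) cumulative_diff[OF MN(1,3) ord(2,1,3)] cumulative_diff[OF MN(2,4) ord(2,1,3)]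
          by (simp add: v_def)
        then show ?thesis
          using x(4)[OF k(1)] x(4)[OF k(2)] y_eq[OF k(1)] y_eq[OF k(2)]
          by (simp add: abs_mult right_diff_distrib[symmetric])
      qed
      moreover have "y n (Suc n') = y n n'" by (simp add: y_def n')
      ultimately show ?thesis using n' by (simp add: sum_distrib_left)
    qed
    also have "1 + real n * (\<Sum>k<n - 1. \<bar>\<nu> {x n k<..x n (Suc k)}\<bar>) \<le> 1 + real n * t"
    proof -
      have "ennreal (\<Sum>k<n - 1. \<bar>\<nu> {x n k<..x n (Suc k)}\<bar>) \<le> total_variation \<nu> unit_interval"
      proof (rule sum_le_total_variation)
        fix k assume "k \<le> n - 1"
        then have k: "k < n" using n by simp
        show "x n k \<in> unit_interval" using x(1)[OF k] row_subset_unit_interval[OF k] by blast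
      next
        fix j k assume jk: "j \<le> k" "k \<le> n - 1"
        show "x n j \<le> x n k"
        proof (cases "j = k")
          case False
          then have "real (Suc j) / real n \<le> real k / real n" using jk by (intro divide_right_mono) auto
          moreover have "j < n" "k < n" using jk n by linarith+
          ultimately show ?thesis using x(1)[of j n] x(1)[of k n] by auto
        qed simp
      qed
      then have "(\<Sum>k<n - 1. \<bar>\<nu> {x n k<..x n (Suc k)}\<bar>) \<le> t" using \<nu>(2,3) by simp
      then show ?thesis by (simp add: mult_left_mono)
    qed
    finally show "(\<Sum>k<n. \<bar>real_of_int (m n (Suc k)) - real_of_int (m n k)\<bar>) \<le> 1 + real n * t" by simp
  qed
  have bound: "\<bar>integral {0..b} (\<lambda>a. us n a - v a)\<bar> \<le> (2 + B + S) / real n" if n: "n \<ge> 1" and b: "0 \<le> b" "b \<le> 1" for n b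
    unfolding us_def
  proof (rule row_averages_close[where G = G and x = "x n", OF n v_meas v_bd prefix_rows_01 G G0 _ _ b])
    fix k assume k: "k < n"
    show "x n k \<in> closed_row n k" using x(1)[OF k] by auto
    have "(\<Sum>j<n. prefix_rows n (m n) (k * n + j)) = (\<Sum>j<n. if int j < m n k then 1 else 0)"
      by (intro sum.cong refl prefix_rows_eq) simp
    also have "\<dots> = real_of_int (m n k)" by (intro sum_prefix m_bd n)
    finally show "\<bar>(\<Sum>j<n. prefix_rows n (m n) (k * n + j)) - real n * v (x n k)\<bar> \<le> 1"
      using sticky_round_close[of "y n" k] y_eq[OF k] x(4)[OF k] by (simp add: m_def)
  qed
  have weak: "weak_star_conv us u"
    unfolding weak_star_conv_def
  proof (intro conjI allI impI)
    show "us n \<in> Linfty" for n by (rule us_Linfty)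
    show "u \<in> Linfty" by (rule u(1))
    fix \<phi> :: "real \<Rightarrow> real" assume \<phi>: "integrable leb01 \<phi>"
    define f where "f n a = us n a - v a" for n a
    have f_borel: "f n \<in> borel_measurable borel" for n
      unfolding f_def by (intro borel_measurable_diff us_borel v_meas)
    have f_bd: "\<bar>f n a\<bar> \<le> 1 + B" for n a
      using us01[of n a] v_bd[of a] unfolding f_def by linarith
    have f_int: "f n integrable_on {a..b}" for n a b
      by (rule borel_bounded_integrable_on[OF f_borel f_bd])
    have "(\<lambda>n. \<integral>a. f n a * \<phi> a \<partial>leb01) \<longlonglongrightarrow> 0"
    proof (rule weak_null_sequence[OF _ _ _ \<phi>])
      show "f n \<in> borel_measurable leb01" for n by (rule borel_measurable_leb01[OF f_borel])
      show "AE a in leb01. \<bar>f n a\<bar> \<le> 1 + B" for n using f_bd by simp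
      fix a b :: real assume ab: "0 < a" "a < b" "b < 1"
      show "(\<lambda>n. \<integral>x. f n x * indicator {a<..<b} x \<partial>leb01) \<longlonglongrightarrow> 0"
      proof (rule Lim_null_comparison)
        show "eventually (\<lambda>n. norm (\<integral>x. f n x * indicator {a<..<b} x \<partial>leb01) \<le> 2 * (2 + B + S) * (1 / real n)) sequentially"
          using eventually_ge_at_top[of 1]
        proof eventually_elim
          case (elim n)
          have "(\<integral>x. f n x * indicator {a<..<b} x \<partial>leb01) = integral {a..b} (f n)"
            using ab by (intro integral_leb01_indicator[OF f_borel f_bd]) auto
          moreover have "integral {0..a} (f n) + integral {a..b} (f n) = integral {0..b} (f n)"
            using ab by (intro Henstock_Kurzweil_Integration.integral_combine f_int) auto
          moreover have "\<bar>integral {0..a} (f n)\<bar> \<le> (2 + B + S) / real n" "\<bar>integral {0..b} (f n)\<bar> \<le> (2 + B + S) / real n"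
            unfolding f_def using ab elim by (auto intro!: bound)
          moreover have "2 * (2 + B + S) * (1 / real n) = (2 + B + S) / real n + (2 + B + S) / real n" by simp
          ultimately show ?case unfolding real_norm_def by linarith
        qed
        show "(\<lambda>n. 2 * (2 + B + S) * (1 / real n)) \<longlonglongrightarrow> 0"
          using tendsto_mult_left[OF lim_1_over_n, of "2 * (2 + B + S)"] by simp
      qed
    qed
    then have "(\<lambda>n. (\<integral>a. f n a * \<phi> a \<partial>leb01) + (\<integral>a. u a * \<phi> a \<partial>leb01)) \<longlonglongrightarrow> 0 + (\<integral>a. u a * \<phi> a \<partial>leb01)"
      by (intro tendsto_add tendsto_const)
    moreover have "(\<integral>a. f n a * \<phi> a \<partial>leb01) + (\<integral>a. u a * \<phi> a \<partial>leb01) = (\<integral>a. us n a * \<phi> a \<partial>leb01)" for n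
    proof -
      have i1: "integrable leb01 (\<lambda>a. f n a * \<phi> a)"
        using f_bd by (intro integrable_bounded_mult[OF borel_measurable_leb01[OF f_borel] _ \<phi>, where D = "1 + B"]) simp
      have i2: "integrable leb01 (\<lambda>a. u a * \<phi> a)" by (rule integrable_bounded_mult[OF u_meas u_bd \<phi>])
      have "(\<integral>a. f n a * \<phi> a \<partial>leb01) + (\<integral>a. u a * \<phi> a \<partial>leb01)
          = (\<integral>a. f n a * \<phi> a + u a * \<phi> a \<partial>leb01)"
        using i1 i2 by simp
      also have "\<dots> = (\<integral>a. us n a * \<phi> a \<partial>leb01)"
      proof (rule integral_cong_AE)
        show "AE a in leb01. f n a * \<phi> a + u a * \<phi> a = us n a * \<phi> a"
          using good by eventually_elim (simp add: f_def algebra_simps)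
        show "(\<lambda>a. f n a * \<phi> a + u a * \<phi> a) \<in> borel_measurable leb01"
          using i1 i2 by (intro borel_measurable_add borel_measurable_integrable)
        show "(\<lambda>a. us n a * \<phi> a) \<in> borel_measurable leb01"
          using \<phi> by (intro borel_measurable_times borel_measurable_leb01 us_borel borel_measurable_integrable)
      qed
      finally show ?thesis .
    qed
    ultimately show "(\<lambda>n. \<integral>a. us n a * \<phi> a \<partial>leb01) \<longlonglongrightarrow> (\<integral>a. u a * \<phi> a \<partial>leb01)"
      by simp
  qed
  have "limsup (\<lambda>n. F_discrete n (us n)) \<le> limsup (\<lambda>n. ennreal (2 * h + t + (4 + 2 * t) * (1 / real n)))"
  proof (rule Limsup_mono)
    show "eventually (\<lambda>n. F_discrete n (us n) \<le> ennreal (2 * h + t + (4 + 2 * t) * (1 / real n))) sequentially"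
      using eventually_ge_at_top[of 2]
    proof eventually_elim
      case (elim n)
      have "F_discrete n (us n) = ennreal (lattice_energy n (prefix_rows n (m n)))"
        by (rule F_discrete_step[OF elim prefix_rows_01]) (simp add: us_def)
      then show ?case using energy[of n] elim by (simp add: ennreal_leI)
    qed
  qed
  also have "\<dots> = ennreal (2 * h + t)"
  proof (rule lim_imp_Limsup)
    have "(\<lambda>n. 2 * h + t + (4 + 2 * t) * (1 / real n)) \<longlonglongrightarrow> 2 * h + t + (4 + 2 * t) * 0"
      by (intro tendsto_intros lim_1_over_n)
    then show "(\<lambda>n. ennreal (2 * h + t + (4 + 2 * t) * (1 / real n))) \<longlonglongrightarrow> ennreal (2 * h + t)"
      by (intro tendsto_ennrealI) simp
  qed simp
  also have "\<dots> = 2 * emeasure lebesgue A + ennreal t"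
    using \<nu>(3) unfolding A_h by (simp add: h_def ennreal_mult)
  finally show ?thesis
    using that[OF us_Linfty weak] unfolding A_def by blast
qed

text \<open>If the limit functional is infinite, the constant sequence will do.\<close>

lemma limsup_inequality:
  assumes u: "u \<in> Linfty"
  shows "\<exists>us. (\<forall>n. us n \<in> Linfty) \<and> weak_star_conv us u \<and> limsup (\<lambda>n. F_discrete n (us n)) \<le> F_limit u"
proof (cases "F_limit u = \<infinity>")
  case True
  then show ?thesis
    using u by (intro exI[of _ "\<lambda>_. u"]) (auto simp: weak_star_conv_def)
next
  case False
  then have bv: "u \<in> BV" "AE x in leb01. 0 \<le> u x \<and> u x \<le> 1"
    by (auto simp: F_limit_def split: if_splits)
  obtain \<nu> where \<nu>: "has_derivative_measure u \<nu>" using bv(1) by (auto simp: BV_def)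
  have F: "F_limit u = 2 * emeasure lebesgue (fractional u) + total_variation \<nu> unit_interval"
    using bv by (simp add: F_limit_def total_variation_derivative_measure[OF \<nu>])
  then obtain t where t: "total_variation \<nu> unit_interval = ennreal t" "0 \<le> t"
    using False by (cases "total_variation \<nu> unit_interval") auto
  obtain us where "\<And>n. us n \<in> Linfty" "weak_star_conv us u"
    "limsup (\<lambda>n. F_discrete n (us n))
      \<le> 2 * emeasure lebesgue (fractional u) + ennreal t"
    using recovery_sequence[OF u bv(2) \<nu> t] by blast
  then show ?thesis
    unfolding F t(1) by blast
qed

theorem theorem1: "Gamma_converges Linfty weak_star_conv F_discrete F_limit"
  unfolding Gamma_converges_def using F_limit_le_liminf limsup_inequality by blast

end
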